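(* Let $B\subset L(\mathbb{Z}^2)$ be the von Neumann subalgebra of elements whose Fourier coefficients are invariant under $v\mapsto -v$, and let $q=\frac{u_{id}+u_{-id}}{2}$, where $id$ denotes the identity matrix in $SL_2(\mathbb{Z})$. If $P$ is a von Neumann algebra between $L(SL_2(\mathbb{Z}))$ and $B\rtimes SL_2(\mathbb{Z})$, then \[P=q\big[(B\cap L(n\mathbb{Z}^2))\rtimes SL_2(\mathbb{Z})\big]\oplus (1-q)\big[(B\cap L(m\mathbb{Z}^2))\rtimes SL_2(\mathbb{Z})\big]\] for two integers $n$, $m$.
   Context: For a countable discrete group $\Gamma$, $L(\Gamma)$ denotes its group von Neumann algebra, with canonical unitaries $u_g$, $g\in\Gamma$. $SL_2(\mathbb{Z})$ acts on $\mathbb{Z}^2$ by matrix multiplication from the left, and $L(\mathbb{Z}^2)$, $L(SL_2(\mathbb{Z}))$ are regarded as subalgebras of $L(\mathbb{Z}^2\rtimes SL_2(\mathbb{Z}))$. $B$ is the von Neumann subalgebra of $L(\mathbb{Z}^2)$ consisting of all elements $\sum_{x,y}\lambda_{x,y}u_{x,y}$ (Fourier expansion over $(x,y)\in\mathbb{Z}^2$) with $\lambda_{x,y}=\lambda_{-x,-y}$ for all $x,y\in\mathbb{Z}$. For an integer $n$ (possibly $0$), $L(n\mathbb{Z}^2)\subset L(\mathbb{Z}^2)$ is the subalgebra of the subgroup $n\mathbb{Z}^2$. For an $SL_2(\mathbb{Z})$-invariant von Neumann subalgebra $D\subset L(\mathbb{Z}^2)$, $D\rtimes SL_2(\mathbb{Z})$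 is the von Neumann subalgebra of $L(\mathbb{Z}^2\rtimes SL_2(\mathbb{Z}))$ generated by $D$ and $L(SL_2(\mathbb{Z}))$. The element $q$ is a central projection in $B\rtimes SL_2(\mathbb{Z})$. *)

theory Defs
  imports "HOL-Analysis.Analysis" "HOL-Algebra.Group"
begin

section \<open>The complex Hilbert space of square-summable functions\<close>

typedef 'a ell2 = "{f :: 'a \<Rightarrow> complex. (\<lambda>x. (cmod (f x))\<^sup>2) summable_on UNIV}"
  morphisms ell2_apply Abs_ell2
  by (rule exI[of _ "\<lambda>_. 0"]) simp

setup_lifting type_definition_ell2

lemma square_summable_add:
  fixes f g :: "'a \<Rightarrow> complex"
  assumes "(\<lambda>x. (cmod (f x))\<^sup>2) summable_on UNIV" "(\<lambda>x. (cmod (g x))\<^sup>2) summable_on UNIV"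
  shows "(\<lambda>x. (cmod (f x + g x))\<^sup>2) summable_on UNIV"
proof (rule summable_on_comparison_test)
  show "(\<lambda>x. 2 * (cmod (f x))\<^sup>2 + 2 * (cmod (g x))\<^sup>2) summable_on UNIV"
    using assms by (intro summable_on_add summable_on_cmult_right)
  fix x
  have "(cmod (f x + g x))\<^sup>2 \<le> (cmod (f x) + cmod (g x))\<^sup>2"
    by (intro power_mono norm_triangle_ineq) auto
  also have "\<dots> \<le> 2 * (cmod (f x))\<^sup>2 + 2 * (cmod (g x))\<^sup>2"
    using sum_squares_bound[of "cmod (f x)" "cmod (g x)"] by (simp add: power2_sum)
  finally show "(cmod (f x + g x))\<^sup>2 \<le> 2 * (cmod (f x))\<^sup>2 + 2 * (cmod (g x))\<^sup>2" .
qed auto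

lemma square_summable_scale:
  fixes f :: "'a \<Rightarrow> complex"
  assumes "(\<lambda>x. (cmod (f x))\<^sup>2) summable_on UNIV"
  shows "(\<lambda>x. (cmod (c * f x))\<^sup>2) summable_on UNIV"
  using assms by (simp add: norm_mult power_mult_distrib summable_on_cmult_right)

lemma square_summable_prod:
  fixes f g :: "'a \<Rightarrow> complex"
  assumes "(\<lambda>x. (cmod (f x))\<^sup>2) summable_on UNIV" "(\<lambda>x. (cmod (g x))\<^sup>2) summable_on UNIV"
  shows "(\<lambda>x. f x * cnj (g x)) summable_on UNIV"
proof -
  have "(\<lambda>x. norm (f x * cnj (g x))) summable_on UNIV"
  proof (rule summable_on_comparison_test)
    show "(\<lambda>x. (cmod (f x))\<^sup>2 + (cmod (g x))\<^sup>2) summable_on UNIV"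
      using assms by (rule summable_on_add)
    fix x
    show "norm (f x * cnj (g x)) \<le> (cmod (f x))\<^sup>2 + (cmod (g x))\<^sup>2"
      using sum_squares_bound[of "cmod (f x)" "cmod (g x)"]
        mult_nonneg_nonneg[OF norm_ge_zero norm_ge_zero, of "f x" "g x"]
      unfolding norm_mult complex_mod_cnj by linarith
  qed auto
  then show ?thesis by (rule abs_summable_summable)
qed

lemma ell2_summable: "(\<lambda>x. (cmod (ell2_apply f x))\<^sup>2) summable_on UNIV"
  using ell2_apply[of f] by simp

lift_definition scaleC_ell2 :: "complex \<Rightarrow> 'a ell2 \<Rightarrow> 'a ell2" is "\<lambda>c f x. c * f x"
  by (rule square_summable_scale)

text \<open>Linear in the first argument.\<close>

definition cinner_ell2 :: "'a ell2 \<Rightarrow> 'a ell2 \<Rightarrow> complex" where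
  "cinner_ell2 f g = (\<Sum>\<^sub>\<infinity>x. ell2_apply f x * cnj (ell2_apply g x))"

lift_definition delta_ell2 :: "'a \<Rightarrow> 'a ell2" is "\<lambda>a x. if x = a then 1 else 0"
proof -
  fix a :: 'a
  show "(\<lambda>x. (cmod (if x = a then 1 else 0))\<^sup>2) summable_on UNIV"
    by (rule finite_nonzero_values_imp_summable_on)
      (rule finite_subset[of _ "{a}"], auto split: if_splits)
qed

text \<open>
  The real inner product space underlying the complex one.  The two induce the same norm, so that
  the library's bounded operators on it are the bounded real-linear operators.
\<close>

instantiation ell2 :: (type) real_inner
begin

lift_definition zero_ell2 :: "'a ell2" is "\<lambda>_. 0" by simp

lift_definition plus_ell2 :: "'a ell2 \<Rightarrow> 'a ell2 \<Rightarrow> 'a ell2" is "\<lambda>f g x. f x + g x"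
  by (rule square_summable_add)

lift_definition uminus_ell2 :: "'a ell2 \<Rightarrow> 'a ell2" is "\<lambda>f x. - f x" by simp

lift_definition minus_ell2 :: "'a ell2 \<Rightarrow> 'a ell2 \<Rightarrow> 'a ell2" is "\<lambda>f g x. f x - g x"
proof -
  fix f g :: "'a \<Rightarrow> complex"
  assume "(\<lambda>x. (cmod (f x))\<^sup>2) summable_on UNIV" "(\<lambda>x. (cmod (g x))\<^sup>2) summable_on UNIV"
  then show "(\<lambda>x. (cmod (f x - g x))\<^sup>2) summable_on UNIV"
    using square_summable_add[of f "\<lambda>x. - g x"] by simp
qed

lift_definition scaleR_ell2 :: "real \<Rightarrow> 'a ell2 \<Rightarrow> 'a ell2" is "\<lambda>r f x. of_real r * f x"
  by (rule square_summable_scale)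

definition inner_ell2 :: "'a ell2 \<Rightarrow> 'a ell2 \<Rightarrow> real" where
  "inner_ell2 f g = Re (cinner_ell2 f g)"

definition norm_ell2 :: "'a ell2 \<Rightarrow> real" where
  "norm_ell2 f = sqrt (inner f f)"

definition dist_ell2 :: "'a ell2 \<Rightarrow> 'a ell2 \<Rightarrow> real" where
  "dist_ell2 f g = norm (f - g)"

definition sgn_ell2 :: "'a ell2 \<Rightarrow> 'a ell2" where
  "sgn_ell2 f = inverse (norm f) *\<^sub>R f"

definition uniformity_ell2 :: "('a ell2 \<times> 'a ell2) filter" where
  "uniformity_ell2 = (INF e\<in>{0<..}. principal {(f, g). dist f g < e})"

definition open_ell2 :: "'a ell2 set \<Rightarrow> bool" where
  "open_ell2 U \<longleftrightarrow> (\<forall>f\<in>U. eventually (\<lambda>(f', g). f' = f \<longrightarrow> g \<in> U) uniformity)"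

instance
proof
  fix f g h :: "'a ell2" and r s :: real
  show "f + g + h = f + (g + h)" by transfer (simp add: algebra_simps)
  show "f + g = g + f" by transfer (simp add: algebra_simps)
  show "0 + f = f" by transfer simp
  show "- f + f = 0" by transfer simp
  show "f - g = f + - g" by transfer simp
  show "r *\<^sub>R (f + g) = r *\<^sub>R f + r *\<^sub>R g" by transfer (simp add: algebra_simps)
  show "(r + s) *\<^sub>R f = r *\<^sub>R f + s *\<^sub>R f" by transfer (simp add: algebra_simps)
  show "r *\<^sub>R s *\<^sub>R f = (r * s) *\<^sub>R f" by transfer (simp add: mult.assoc)
  show "1 *\<^sub>R f = f" by transfer simp
  show "dist f g = norm (f - g)" by (rule dist_ell2_def)
  show "sgn f = inverse (norm f) *\<^sub>R f" by (rule sgn_ell2_def)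
  show "(uniformity :: ('a ell2 \<times> 'a ell2) filter) = (INF e\<in>{0<..}. principal {(f, g). dist f g < e})"
    by (rule uniformity_ell2_def)
  show "open U \<longleftrightarrow> (\<forall>f\<in>U. eventually (\<lambda>(f', g). f' = f \<longrightarrow> g \<in> U) uniformity)" for U :: "'a ell2 set"
    by (rule open_ell2_def)
  have prod: "(\<lambda>x. ell2_apply f x * cnj (ell2_apply g x)) summable_on UNIV" for f g :: "'a ell2"
    by (intro square_summable_prod ell2_summable)
  have "cinner_ell2 g f = cnj (cinner_ell2 f g)"
    unfolding cinner_ell2_def by (subst infsum_cnj[symmetric]) (simp add: mult.commute)
  then show "inner f g = inner g f" by (simp add: inner_ell2_def)
  have "cinner_ell2 (f + g) h = cinner_ell2 f h + cinner_ell2 g h"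
    unfolding cinner_ell2_def
    by (subst infsum_add[symmetric]) (auto intro: prod simp: plus_ell2.rep_eq algebra_simps)
  then show "inner (f + g) h = inner f h + inner g h" by (simp add: inner_ell2_def)
  have "cinner_ell2 (r *\<^sub>R f) g = of_real r * cinner_ell2 f g"
    unfolding cinner_ell2_def
    by (subst infsum_cmult_right'[symmetric]) (simp add: scaleR_ell2.rep_eq mult.assoc)
  then show "inner (r *\<^sub>R f) g = r * inner f g" by (simp add: inner_ell2_def)
  have self: "inner f f = (\<Sum>\<^sub>\<infinity>x. (cmod (ell2_apply f x))\<^sup>2)"
    unfolding inner_ell2_def cinner_ell2_def infsum_Re[OF prod, symmetric]
    unfolding cmod_power2 by (simp add: power2_eq_square)
  show nonneg: "0 \<le> inner f f" unfolding self by (rule infsum_nonneg) simp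
  show "norm f = sqrt (inner f f)" by (rule norm_ell2_def)
  show "inner f f = 0 \<longleftrightarrow> f = 0"
  proof
    assume "inner f f = 0"
    then have "(cmod (ell2_apply f x))\<^sup>2 = 0" for x
      unfolding self by (intro nonneg_infsum_le_0D[where A = UNIV and x = x]) (auto intro: ell2_summable)
    then show "f = 0" by (intro iffD1[OF ell2_apply_inject]) (auto simp: zero_ell2.rep_eq)
  next
    assume "f = 0"
    then show "inner f f = 0" unfolding self by (simp add: zero_ell2.rep_eq)
  qed
qed

end


section \<open>Von Neumann algebras\<close>

text \<open>
  The library's type \<open>\<Rightarrow>\<^sub>L\<close> consists of the bounded real-linear operators; the bounded operators of
  the complex Hilbert space are the complex-linear ones among them.
\<close>

definition bounded_ops :: "('a ell2 \<Rightarrow>\<^sub>L 'a ell2) set" where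
  "bounded_ops = {T. \<forall>c f. blinfun_apply T (scaleC_ell2 c f) = scaleC_ell2 c (blinfun_apply T f)}"

definition is_adjoint :: "('a ell2 \<Rightarrow>\<^sub>L 'a ell2) \<Rightarrow> ('a ell2 \<Rightarrow>\<^sub>L 'a ell2) \<Rightarrow> bool" where
  "is_adjoint S T \<longleftrightarrow>
    (\<forall>f g. cinner_ell2 (blinfun_apply T f) g = cinner_ell2 f (blinfun_apply S g))"

definition commutant :: "('a ell2 \<Rightarrow>\<^sub>L 'a ell2) set \<Rightarrow> ('a ell2 \<Rightarrow>\<^sub>L 'a ell2) set" where
  "commutant M = {T \<in> bounded_ops. \<forall>S\<in>M. T o\<^sub>L S = S o\<^sub>L T}"

text \<open>
  Von Neumann algebras are the self-adjoint sets of bounded operators that equal their bicommutant.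
  Being a commutant, such an \<open>M\<close> is automatically a weakly closed complex subalgebra containing the
  identity operator.
\<close>

definition von_neumann_algebra :: "('a ell2 \<Rightarrow>\<^sub>L 'a ell2) set \<Rightarrow> bool" where
  "von_neumann_algebra M \<longleftrightarrow>
    M \<subseteq> bounded_ops \<and> (\<forall>T\<in>M. \<exists>S\<in>M. is_adjoint S T) \<and> commutant (commutant M) = M"

definition vn_generated :: "('a ell2 \<Rightarrow>\<^sub>L 'a ell2) set \<Rightarrow> ('a ell2 \<Rightarrow>\<^sub>L 'a ell2) set" where
  "vn_generated S = \<Inter>{M. von_neumann_algebra M \<and> S \<subseteq> M}"

definition is_direct_sum ::
  "('a ell2 \<Rightarrow>\<^sub>L 'a ell2) set \<Rightarrow> ('a ell2 \<Rightarrow>\<^sub>L 'a ell2) set \<Rightarrow> ('a ell2 \<Rightarrow>\<^sub>L 'a ell2) set \<Rightarrow> bool" where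
  "is_direct_sum P X Y \<longleftrightarrow> P = {x + y | x y. x \<in> X \<and> y \<in> Y} \<and> X \<inter> Y = {0}"


section \<open>Group von Neumann algebras\<close>

text \<open>
  The canonical unitary \<open>u\<^sub>g\<close> is left translation by \<open>g\<close>, so \<open>u\<^sub>g \<delta>\<^sub>h = \<delta>\<^sub>g\<^sub>h\<close>.  Groups are assumed to
  have all of their type as carrier, which makes \<^typ>\<open>'a ell2\<close> the \<open>\<ell>\<^sup>2\<close>-space of the group.
\<close>

definition group_unitary :: "('a, 'b) monoid_scheme \<Rightarrow> 'a \<Rightarrow> ('a ell2 \<Rightarrow>\<^sub>L 'a ell2)" where
  "group_unitary G g = Blinfun (\<lambda>f. Abs_ell2 (\<lambda>h. ell2_apply f (inv\<^bsub>G\<^esub> g \<otimes>\<^bsub>G\<^esub> h)))"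

text \<open>\<open>group_vna G H\<close> is \<open>L(H)\<close> for a subgroup \<open>H\<close> of \<open>G\<close>, as a subalgebra of \<open>L(G)\<close>.\<close>

definition group_vna :: "('a, 'b) monoid_scheme \<Rightarrow> 'a set \<Rightarrow> ('a ell2 \<Rightarrow>\<^sub>L 'a ell2) set" where
  "group_vna G H = vn_generated (group_unitary G ` H)"

text \<open>
  For \<open>T = \<Sum>\<^sub>g \<lambda>\<^sub>g u\<^sub>g\<close> in \<open>L(G)\<close> one has \<open>T \<delta>\<^sub>1 = \<Sum>\<^sub>g \<lambda>\<^sub>g \<delta>\<^sub>g\<close>, whence \<open>\<lambda>\<^sub>g = (T \<delta>\<^sub>1)(g)\<close>.
\<close>

definition fourier_coeff ::
  "('a, 'b) monoid_scheme \<Rightarrow> ('a ell2 \<Rightarrow>\<^sub>L 'a ell2) \<Rightarrow> 'a \<Rightarrow> complex" where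
  "fourier_coeff G T g = ell2_apply (blinfun_apply T (delta_ell2 \<one>\<^bsub>G\<^esub>)) g"

lemma group_unitary_apply:
  fixes G (structure)
  assumes "group G" "carrier G = UNIV"
  shows "ell2_apply (blinfun_apply (group_unitary G g) f) h = ell2_apply f (inv g \<otimes> h)"
proof -
  interpret group G by fact
  define \<tau> where "\<tau> = (\<lambda>h. inv g \<otimes> h)"
  have bij: "bij \<tau>"
  proof (rule bij_betw_byWitness[where f' = "\<lambda>h. g \<otimes> h"])
    show "\<forall>h\<in>UNIV. g \<otimes> \<tau> h = h" "\<forall>h\<in>UNIV. \<tau> (g \<otimes> h) = h"
      using assms(2) by (auto simp: \<tau>_def m_assoc[symmetric])
  qed auto
  have summ: "(\<lambda>h. (cmod (ell2_apply f (\<tau> h)))\<^sup>2) summable_on UNIV" for f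
    using summable_on_reindex_bij_betw[OF bij, of "\<lambda>x. (cmod (ell2_apply f x))\<^sup>2"] ell2_summable[of f]
    by simp
  define U where "U = (\<lambda>f. Abs_ell2 (\<lambda>h. ell2_apply f (\<tau> h)))"
  have U: "ell2_apply (U f) h = ell2_apply f (\<tau> h)" for f h
    unfolding U_def using summ[of f] by (subst Abs_ell2_inverse) auto
  have "norm (U f) = norm f" for f
    unfolding norm_eq_sqrt_inner inner_ell2_def cinner_ell2_def U
    using infsum_reindex_bij_betw[OF bij, of "\<lambda>x. ell2_apply f x * cnj (ell2_apply f x)"] by simp
  then have "bounded_linear U"
    by (intro bounded_linear_intro[where K = 1])
      (auto simp: ell2_apply_inject[symmetric] U plus_ell2.rep_eq scaleR_ell2.rep_eq)
  then have "blinfun_apply (group_unitary G g) = U"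
    unfolding group_unitary_def U_def \<tau>_def by (rule bounded_linear_Blinfun_apply)
  then show ?thesis by (simp add: U \<tau>_def)
qed

lemma group_unitary_delta:
  fixes G (structure)
  assumes "group G" "carrier G = UNIV"
  shows "blinfun_apply (group_unitary G g) (delta_ell2 h) = delta_ell2 (g \<otimes> h)"
proof -
  interpret group G by fact
  have "inv g \<otimes> x = h \<longleftrightarrow> x = g \<otimes> h" for x
    using assms(2) by (metis UNIV_I inv_closed inv_solve_left l_inv m_assoc l_one r_inv)
  then show ?thesis
    by (subst ell2_apply_inject[symmetric])
      (auto simp: fun_eq_iff group_unitary_apply[OF assms] delta_ell2.rep_eq)
qed


section \<open>The group \<open>\<int>\<^sup>2 \<rtimes> SL\<^sub>2(\<int>)\<close>\<close>

typedef sl2z = "{A :: int^2^2. det A = 1}"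
  morphisms mat_of_sl2z Abs_sl2z
  by (rule exI[of _ "mat 1"]) simp

setup_lifting type_definition_sl2z

lift_definition sl2z_mult :: "sl2z \<Rightarrow> sl2z \<Rightarrow> sl2z" is "\<lambda>A B. A ** B"
  by (simp add: det_mul)

lift_definition sl2z_id :: sl2z is "mat 1" by simp

lift_definition sl2z_neg :: "sl2z \<Rightarrow> sl2z" is "\<lambda>A. - A" by (simp add: det_2)

definition Z2_SL2Z :: "((int^2) \<times> sl2z) monoid" where
  "Z2_SL2Z = \<lparr>carrier = UNIV,
     mult = (\<lambda>(v, A) (w, B). (v + mat_of_sl2z A *v w, sl2z_mult A B)),
     one = (0, sl2z_id)\<rparr>"

lemma group_Z2_SL2Z: "group Z2_SL2Z"
proof (rule groupI)
  fix x y z :: "(int^2) \<times> sl2z"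
  show "x \<otimes>\<^bsub>Z2_SL2Z\<^esub> y \<otimes>\<^bsub>Z2_SL2Z\<^esub> z = x \<otimes>\<^bsub>Z2_SL2Z\<^esub> (y \<otimes>\<^bsub>Z2_SL2Z\<^esub> z)"
    by (auto simp: Z2_SL2Z_def split_beta mat_of_sl2z_inject[symmetric] sl2z_mult.rep_eq
        matrix_mul_assoc matrix_vector_mul_assoc matrix_vector_right_distrib)
  show "\<one>\<^bsub>Z2_SL2Z\<^esub> \<otimes>\<^bsub>Z2_SL2Z\<^esub> x = x"
    by (auto simp: Z2_SL2Z_def split_beta prod_eq_iff mat_of_sl2z_inject[symmetric]
        sl2z_mult.rep_eq sl2z_id.rep_eq)
  obtain v A where x: "x = (v, A)" by fastforce
  let ?A = "mat_of_sl2z A"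
  define C :: "int^2^2" where "C = vector [vector [?A$2$2, - ?A$1$2], vector [- ?A$2$1, ?A$1$1]]"
  have "det ?A = 1" using mat_of_sl2z[of A] by simp
  then have det: "?A$1$1 * ?A$2$2 - ?A$1$2 * ?A$2$1 = 1" by (simp add: det_2)
  have "det C = 1" using det by (simp add: C_def det_2 algebra_simps)
  then have C: "mat_of_sl2z (Abs_sl2z C) = C" by (simp add: Abs_sl2z_inverse)
  have "C ** ?A = mat 1"
    using det by (simp add: vec_eq_iff forall_2 C_def matrix_matrix_mult_def sum_2 mat_def algebra_simps)
  then have "(- (C *v v), Abs_sl2z C) \<otimes>\<^bsub>Z2_SL2Z\<^esub> x = \<one>\<^bsub>Z2_SL2Z\<^esub>"
    by (simp add: x Z2_SL2Z_def mat_of_sl2z_inject[symmetric] sl2z_mult.rep_eq sl2z_id.rep_eq C)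
  then show "\<exists>y\<in>carrier Z2_SL2Z. y \<otimes>\<^bsub>Z2_SL2Z\<^esub> x = \<one>\<^bsub>Z2_SL2Z\<^esub>"
    by (intro bexI[of _ "(- (C *v v), Abs_sl2z C)"]) (simp_all add: Z2_SL2Z_def)
qed (auto simp: Z2_SL2Z_def)

type_synonym Z2_SL2Z_op = "((int^2) \<times> sl2z) ell2 \<Rightarrow>\<^sub>L ((int^2) \<times> sl2z) ell2"

definition L_SL2Z :: "Z2_SL2Z_op set" where
  "L_SL2Z = group_vna Z2_SL2Z {(0, A) | A. True}"

text \<open>\<open>L_nZ2 n\<close> is \<open>L(n\<int>\<^sup>2)\<close>; in particular \<open>L_nZ2 1\<close> is \<open>L(\<int>\<^sup>2)\<close> and \<open>L_nZ2 0\<close> the scalars.\<close>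

definition L_nZ2 :: "int \<Rightarrow> Z2_SL2Z_op set" where
  "L_nZ2 n = group_vna Z2_SL2Z {(n *s v, sl2z_id) | v. True}"

definition L_Z2 :: "Z2_SL2Z_op set" where
  "L_Z2 = group_vna Z2_SL2Z {(v, sl2z_id) | v. True}"

definition B_alg :: "Z2_SL2Z_op set" where
  "B_alg = {T \<in> L_Z2. \<forall>v. fourier_coeff Z2_SL2Z T (v, sl2z_id) = fourier_coeff Z2_SL2Z T (- v, sl2z_id)}"

definition crossed_SL2Z :: "Z2_SL2Z_op set \<Rightarrow> Z2_SL2Z_op set" where
  "crossed_SL2Z D = vn_generated (D \<union> L_SL2Z)"

definition q_proj :: Z2_SL2Z_op where
  "q_proj = (1/2) *\<^sub>R (group_unitary Z2_SL2Z (0, sl2z_id) + group_unitary Z2_SL2Z (0, sl2z_neg sl2z_id))"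

end

theory Submission
  imports Defs
begin

text \<open>
  Let \<open>\<Gamma>\<close> be \<open>SL\<^sub>2(\<int>)\<close>. An operator commuting with all right translations of \<open>\<int>\<^sup>2 \<rtimes> \<Gamma>\<close> is
  determined by its Fourier coefficients \<open>t(v, A)\<close>, and membership in a von Neumann algebra \<open>P\<close> of
  such operators can be tested on coefficients: it passes to coefficientwise limits of elements
  whose coefficients are bounded in \<open>\<ell>\<^sup>2\<close> (\<open>vna_closed_coefficientwise\<close>). Truncating Fourier series
  then shows that \<open>(B \<inter> L(n\<int>\<^sup>2)) \<rtimes> \<Gamma>\<close> consists of all operators with \<open>t(-v, A) = t(v, A)\<close> whose
  coefficients vanish off \<open>n\<int>\<^sup>2 \<times> \<Gamma>\<close> (\<open>crossed_eq_even_lattice_algebra\<close>).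

  An intermediate algebra \<open>P\<close> contains \<open>q\<close>, hence is the sum of its two parts given by
  \<open>t(v, -A) = \<sigma> t(v, A)\<close> with \<open>\<sigma> = 1\<close> and \<open>\<sigma> = -1\<close>. Fix \<open>\<sigma>\<close> and let \<open>p\<close> be the corresponding projection
  \<open>q\<close> or \<open>1 - q\<close>. Since every \<open>v\<close> is \<open>A(k, 0)\<close> for some \<open>A\<close> in \<open>\<Gamma>\<close>, and \<open>P\<close> is invariant under
  multiplication by \<open>\<Gamma>\<close> on both sides, the part is known once it is known which \<open>k\<close> admit an element
  with \<open>t((k, 0), 1) \<noteq> 0\<close>, and that for these \<open>k\<close> the element \<open>p(u\<^sub>(\<^sub>k\<^sub>,\<^sub>0\<^sub>) + u\<^sub>(\<^sub>-\<^sub>k\<^sub>,\<^sub>0\<^sub>))\<close> belongs to \<open>P\<close>.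

  Conjugation by high powers of the unipotent matrix with rows \<open>(1, 1)\<close>, \<open>(0, 1)\<close> fixes the
  coefficients at \<open>((j, 0), A)\<close> with \<open>A\<close> upper triangular and moves every other point to infinity. A
  limit thus cuts any element down to these coefficients without leaving \<open>P\<close>
  (\<open>signed_line_part\<close>). Apply this to two elements \<open>S\<close>, \<open>T\<close>, multiply \<open>S\<close> by the conjugate of \<open>T\<close> under
  some \<open>g\<close>, and cut the product down to the corresponding coefficients for the line through
  \<open>h(1, 0)\<close>. If this line differs from those through \<open>(1, 0)\<close> and \<open>g(1, 0)\<close>, and the lower left
  entry of \<open>g\<close> is at least 3, no nontrivial product of the unipotents
  involved lies in the stabilizer of that line up to sign (\<open>upper_triangular_product_rigidity\<close>).
  What survives is an element of \<open>p L(\<int>\<^sup>2)\<close>, and its coefficients on the new line are products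
  \<open>f(\<beta>k) g(\<gamma>k)\<close> of coefficients of \<open>S\<close> and \<open>T\<close>, placed at \<open>\<alpha>k\<close>, where
  \<open>\<alpha> h(1, 0) = \<beta>(1, 0) + \<gamma> g(1, 0)\<close> (\<open>line_coefs_combination\<close>).

  So the coefficient sequences of elements of \<open>p L(\<int>\<^sup>2)\<close> in \<open>P\<close> supported on the line of the \<open>(k, 0)\<close>
  are closed under pointwise products, dilations and slices. Polynomials in \<open>\<bar>f\<bar>\<^sup>2\<close> and a limit give
  indicator functions of finite level sets, and comparing ratios of elements of a minimal such set
  shows that it is of the form \<open>{k, -k}\<close> (\<open>ind_pair\<close>). The integers \<open>k\<close> obtained are closed under
  addition, hence are the multiples of one integer; this integer depends on \<open>\<sigma>\<close>, which is why two
  integers occur in the theorem.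
\<close>

section \<open>The Hilbert space of square-summable functions\<close>

lemma ell2_eqI: "(\<And>x. ell2_apply f x = ell2_apply g x) \<Longrightarrow> f = g"
  by (intro iffD1[OF ell2_apply_inject]) (simp add: fun_eq_iff)

lemmas ell2_coord = plus_ell2.rep_eq minus_ell2.rep_eq uminus_ell2.rep_eq zero_ell2.rep_eq
  scaleR_ell2.rep_eq scaleC_ell2.rep_eq delta_ell2.rep_eq

lemma ell2_apply_sum: "ell2_apply (sum f F) x = (\<Sum>i\<in>F. ell2_apply (f i) x)"
  by (induction F rule: infinite_finite_induct) (auto simp: ell2_coord)

lemma cinner_summable: "(\<lambda>x. ell2_apply f x * cnj (ell2_apply g x)) summable_on UNIV"
  by (intro square_summable_prod ell2_summable)

lemma cinner_add_left: "cinner_ell2 (f + g) h = cinner_ell2 f h + cinner_ell2 g h"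
  unfolding cinner_ell2_def
  by (subst infsum_add[symmetric]) (auto intro: cinner_summable simp: ell2_coord algebra_simps)

lemma cinner_scaleC_left: "cinner_ell2 (scaleC_ell2 c f) g = c * cinner_ell2 f g"
  unfolding cinner_ell2_def
  by (subst infsum_cmult_right'[symmetric]) (simp add: ell2_coord mult.assoc)

lemma scaleR_conv_scaleC: "r *\<^sub>R f = scaleC_ell2 (of_real r) f"
  by (rule ell2_eqI) (simp add: ell2_coord)

lemma cinner_commute: "cinner_ell2 g f = cnj (cinner_ell2 f g)"
  unfolding cinner_ell2_def by (subst infsum_cnj[symmetric]) (simp add: mult.commute)

lemma cinner_add_right: "cinner_ell2 h (f + g) = cinner_ell2 h f + cinner_ell2 h g"
  by (simp add: cinner_add_left cinner_commute[of h])

lemma cinner_scaleC_right: "cinner_ell2 g (scaleC_ell2 c f) = cnj c * cinner_ell2 g f"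
  by (simp add: cinner_scaleC_left cinner_commute[of g])

lemma norm_ell2_square: "(norm f)\<^sup>2 = (\<Sum>\<^sub>\<infinity>x. (cmod (ell2_apply f x))\<^sup>2)"
proof -
  have "(norm f)\<^sup>2 = inner f f"
    by (simp add: power2_norm_eq_inner)
  also have "\<dots> = (\<Sum>\<^sub>\<infinity>x. Re (ell2_apply f x * cnj (ell2_apply f x)))"
    unfolding inner_ell2_def cinner_ell2_def by (rule infsum_Re[OF cinner_summable, symmetric])
  also have "(\<lambda>x. Re (ell2_apply f x * cnj (ell2_apply f x))) = (\<lambda>x. (cmod (ell2_apply f x))\<^sup>2)"
    by (rule ext, simp only: cmod_power2) (simp add: power2_eq_square)
  finally show ?thesis .
qed

lemma cinner_self: "cinner_ell2 f f = of_real ((norm f)\<^sup>2)"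
proof -
  have "cinner_ell2 f f = (\<Sum>\<^sub>\<infinity>x. of_real ((cmod (ell2_apply f x))\<^sup>2))"
    unfolding cinner_ell2_def by (intro infsum_cong) (simp only: complex_norm_square)
  also have "\<dots> = of_real ((norm f)\<^sup>2)"
    using has_sum_of_real[OF has_sum_infsum[OF ell2_summable[of f]], where ?'a = complex]
    unfolding norm_ell2_square by (simp add: infsumI)
  finally show ?thesis .
qed

lemma norm_scaleC: "norm (scaleC_ell2 c f) = cmod c * norm f"
proof -
  have "(norm (scaleC_ell2 c f))\<^sup>2 = (cmod c * norm f)\<^sup>2"
    unfolding power_mult_distrib norm_ell2_square
    by (subst infsum_cmult_right'[symmetric]) (simp add: ell2_coord norm_mult power_mult_distrib)
  then show ?thesis
    by (simp add: power2_eq_iff_nonneg)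
qed

lemma cinner_le: "cmod (cinner_ell2 f g) \<le> norm f * norm g"
proof (cases "cinner_ell2 f g = 0")
  case False
  define c where "c = cnj (sgn (cinner_ell2 f g))"
  have c: "cmod c = 1"
    using False by (simp add: c_def norm_sgn)
  have "cinner_ell2 (scaleC_ell2 c f) g = of_real (cmod (cinner_ell2 f g))"
    unfolding cinner_scaleC_left c_def sgn_eq using False
    by (simp add: field_simps complex_norm_square[symmetric] power2_eq_square)
  then have "cmod (cinner_ell2 f g) = inner (scaleC_ell2 c f) g"
    by (simp add: inner_ell2_def)
  also have "\<dots> \<le> norm (scaleC_ell2 c f) * norm g"
    using Cauchy_Schwarz_ineq2 abs_le_D1 by blast
  finally show ?thesis
    by (simp add: norm_scaleC c)
qed auto

lemma finite_sum_le_norm: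
  assumes "finite F"
  shows "(\<Sum>x\<in>F. (cmod (ell2_apply f x))\<^sup>2) \<le> (norm f)\<^sup>2"
  unfolding norm_ell2_square
  by (rule finite_sum_le_infsum[OF ell2_summable assms]) auto

lemma coord_le_norm: "cmod (ell2_apply f x) \<le> norm f"
  using finite_sum_le_norm[of "{x}" f] by (simp add: power2_le_iff_abs_le)

text \<open>
  Sequences arising as limits or as values of functionals are only known through bounds on their
  finite partial sums; this is how they become vectors.
\<close>

lemma ell2_of_bounded_sums:
  assumes "\<And>F. finite F \<Longrightarrow> (\<Sum>x\<in>F. (cmod (\<phi> x))\<^sup>2) \<le> C\<^sup>2" and "0 \<le> C"
  obtains f where "\<And>x. ell2_apply f x = \<phi> x" "norm f \<le> C"
proof -
  have summ: "(\<lambda>x. (cmod (\<phi> x))\<^sup>2) summable_on UNIV"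
    by (rule nonneg_bdd_above_summable_on) (auto intro!: bdd_aboveI2 assms(1))
  define f where "f = Abs_ell2 \<phi>"
  have f: "ell2_apply f x = \<phi> x" for x
    unfolding f_def using summ by (simp add: Abs_ell2_inverse)
  have "(norm f)\<^sup>2 \<le> C\<^sup>2"
    unfolding norm_ell2_square f by (rule infsum_le_finite_sums[OF summ]) (use assms in auto)
  then show thesis
    using that[OF f] assms(2) by (simp add: power2_le_iff_abs_le)
qed

text \<open>
  The squared distance from \<open>f\<close> to its restriction to \<open>F\<close> is the tail \<open>\<parallel>f\<parallel>\<^sup>2 - \<Sum>\<^sub>F \<bar>f\<bar>\<^sup>2\<close>. Applying bounded
  linear maps to this expansion gives the matrix description of operators below.
\<close>

lemma delta_has_sum:
  "((\<lambda>y. scaleC_ell2 (ell2_apply f y) (delta_ell2 y)) has_sum f) UNIV"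
proof -
  let ?s = "\<lambda>F. \<Sum>y\<in>F. scaleC_ell2 (ell2_apply f y) (delta_ell2 y)"
  have "norm (?s F - f) = sqrt ((norm f)\<^sup>2 - (\<Sum>x\<in>F. (cmod (ell2_apply f x))\<^sup>2))" if "finite F" for F
  proof -
    have "ell2_apply (?s F - f) x = (if x \<in> F then 0 else - ell2_apply f x)" for x
      using that by (simp add: ell2_apply_sum ell2_coord if_distrib if_distribR sum.delta cong: if_cong)
    then have "(norm (?s F - f))\<^sup>2 = (\<Sum>\<^sub>\<infinity>x\<in>UNIV - F. (cmod (ell2_apply f x))\<^sup>2)"
      unfolding norm_ell2_square by (intro infsum_cong_neutral) auto
    also have "\<dots> = (norm f)\<^sup>2 - (\<Sum>x\<in>F. (cmod (ell2_apply f x))\<^sup>2)"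
      unfolding norm_ell2_square using that
      by (subst infsum_Diff) (auto intro: ell2_summable)
    finally show ?thesis
      by (intro real_sqrt_unique[symmetric]) auto
  qed
  moreover have "((\<lambda>F. sqrt ((norm f)\<^sup>2 - (\<Sum>x\<in>F. (cmod (ell2_apply f x))\<^sup>2)))
      \<longlongrightarrow> sqrt ((norm f)\<^sup>2 - (norm f)\<^sup>2)) (finite_subsets_at_top UNIV)"
    using has_sum_infsum[OF ell2_summable[of f]] unfolding has_sum_def norm_ell2_square
    by (intro tendsto_intros)
  ultimately have "((\<lambda>F. norm (?s F - f)) \<longlongrightarrow> 0) (finite_subsets_at_top UNIV)"
    by (subst tendsto_cong[OF eventually_finite_subsets_at_top_weakI]) auto
  then have "((\<lambda>F. ?s F - f) \<longlongrightarrow> 0) (finite_subsets_at_top UNIV)"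
    by (rule tendsto_norm_zero_cancel)
  then show ?thesis
    unfolding has_sum_def by (rule LIM_zero_cancel)
qed

text \<open>
  The representing vector can only have the coordinates \<open>cnj (\<phi> (\<delta> x))\<close>. It is square-summable because
  evaluating \<open>\<phi>\<close> on its restriction to a finite set gives the squared norm of that restriction.
\<close>

lemma riesz:
  fixes \<phi> :: "'a ell2 \<Rightarrow> complex"
  assumes add: "\<And>f g. \<phi> (f + g) = \<phi> f + \<phi> g" and scale: "\<And>c f. \<phi> (scaleC_ell2 c f) = c * \<phi> f"
    and bound: "\<And>f. cmod (\<phi> f) \<le> C * norm f" and "0 \<le> C"
  obtains r where "\<And>f. \<phi> f = cinner_ell2 f r" "norm r \<le> C"
proof -
  have bl: "bounded_linear \<phi>"
    by (rule bounded_linear_intro[where K = C])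
      (use bound in \<open>auto simp: add scaleR_conv_scaleC scale scaleR_conv_of_real mult.commute\<close>)
  have "(\<Sum>x\<in>F. (cmod (cnj (\<phi> (delta_ell2 x))))\<^sup>2) \<le> C\<^sup>2" if "finite F" for F
  proof -
    define s where "s = (\<Sum>x\<in>F. (cmod (\<phi> (delta_ell2 x)))\<^sup>2)"
    define f where "f = (\<Sum>x\<in>F. scaleC_ell2 (cnj (\<phi> (delta_ell2 x))) (delta_ell2 x))"
    have f: "ell2_apply f x = (if x \<in> F then cnj (\<phi> (delta_ell2 x)) else 0)" for x
      using that by (simp add: f_def ell2_apply_sum ell2_coord if_distrib if_distribR sum.delta cong: if_cong)
    have "(norm f)\<^sup>2 = (\<Sum>\<^sub>\<infinity>x\<in>F. (cmod (\<phi> (delta_ell2 x)))\<^sup>2)"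
      unfolding norm_ell2_square f by (rule infsum_cong_neutral) auto
    then have nf: "(norm f)\<^sup>2 = s"
      using that by (simp add: s_def)
    have "\<phi> f = of_real s"
      unfolding f_def s_def linear_sum[OF bounded_linear.linear[OF bl]] scale of_real_sum
      by (intro sum.cong refl) (simp only: complex_norm_square mult.commute)
    moreover have "0 \<le> s"
      by (simp add: s_def sum_nonneg)
    ultimately have "s \<le> C * norm f"
      using bound[of f] by simp
    then have "norm f \<le> C"
      unfolding nf[symmetric] power2_eq_square using assms(4) by (cases "norm f = 0") auto
    then show ?thesis
      using power_mono[OF _ norm_ge_zero, of f C 2] nf by (simp add: s_def)
  qed
  then obtain r where r: "\<And>x. ell2_apply r x = cnj (\<phi> (delta_ell2 x))" "norm r \<le> C"
    using ell2_of_bounded_sums[of "\<lambda>x. cnj (\<phi> (delta_ell2 x))" C] assms(4) by auto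
  have "\<phi> f = cinner_ell2 f r" for f
  proof -
    have "((\<lambda>y. ell2_apply f y * cnj (ell2_apply r y)) has_sum \<phi> f) UNIV"
      using has_sum_bounded_linear[OF bl delta_has_sum[of f]] by (simp add: o_def scale r)
    then show ?thesis
      unfolding cinner_ell2_def by (simp add: infsumI)
  qed
  then show thesis
    using that r(2) by blast
qed

lemma cinner_eqI:
  assumes "\<And>f. cinner_ell2 f r = cinner_ell2 f s"
  shows "r = s"
proof -
  have "cinner_ell2 (r - s) (r - s) + cinner_ell2 (r - s) s = cinner_ell2 (r - s) r"
    by (simp flip: cinner_add_right)
  then have "cinner_ell2 (r - s) (r - s) = 0"
    using assms[of "r - s"] by simp
  then show ?thesis
    unfolding cinner_self by (simp add: power2_eq_square)
qed

text \<open>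
  Bounded coordinatewise convergence is weak convergence: against a finitely supported vector only
  finitely many coordinates matter, and these vectors are dense.
\<close>

lemma tendsto_cinner_of_coordinates:
  fixes a :: "'i \<Rightarrow> 'a ell2"
  assumes "\<forall>\<^sub>F i in \<F>. norm (a i) \<le> C"
    and lim: "\<And>x. ((\<lambda>i. ell2_apply (a i) x) \<longlongrightarrow> ell2_apply b x) \<F>"
  shows "((\<lambda>i. cinner_ell2 (a i) g) \<longlongrightarrow> cinner_ell2 b g) \<F>"
proof (rule tendstoI)
  fix e :: real
  assume e: "0 < e"
  define K where "K = \<bar>C\<bar> + norm b + 1"
  have K: "K > 0"
    by (simp add: K_def add_nonneg_pos)
  let ?s = "\<lambda>F. \<Sum>y\<in>F. scaleC_ell2 (ell2_apply g y) (delta_ell2 y)"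
  have "\<forall>\<^sub>F F in finite_subsets_at_top UNIV. dist (?s F) g < e / (2 * K)"
    using delta_has_sum[of g] e K unfolding has_sum_def by (intro tendstoD) auto
  then obtain F where F: "dist (?s F) g < e / (2 * K)"
    using eventually_happens' finite_subsets_at_top_neq_bot by blast
  have sF: "cinner_ell2 f (?s F) = (\<Sum>y\<in>F. cnj (ell2_apply g y) * ell2_apply f y)" for f
  proof (induction F rule: infinite_finite_induct)
    case (insert y F)
    have "cinner_ell2 f (delta_ell2 y) = (\<Sum>\<^sub>\<infinity>x\<in>{y}. ell2_apply f x)"
      unfolding cinner_ell2_def by (rule infsum_cong_neutral) (auto simp: ell2_coord)
    then show ?case
      using insert by (simp add: cinner_add_right cinner_scaleC_right)
  qed (auto simp: cinner_ell2_def ell2_coord)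
  have "((\<lambda>i. cinner_ell2 (a i) (?s F)) \<longlongrightarrow> cinner_ell2 b (?s F)) \<F>"
    unfolding sF by (intro tendsto_intros lim)
  then have "\<forall>\<^sub>F i in \<F>. dist (cinner_ell2 (a i) (?s F)) (cinner_ell2 b (?s F)) < e / 2"
    using e by (intro tendstoD) auto
  with assms(1) show "\<forall>\<^sub>F i in \<F>. dist (cinner_ell2 (a i) g) (cinner_ell2 b g) < e"
  proof eventually_elim
    case (elim i)
    have split: "cinner_ell2 f g = cinner_ell2 f (?s F) + cinner_ell2 f (g - ?s F)" for f
      by (simp flip: cinner_add_right)
    have ab: "cinner_ell2 (a i) h = cinner_ell2 b h + cinner_ell2 (a i - b) h" for h
      by (simp flip: cinner_add_left)
    have "cmod (cinner_ell2 (a i - b) (g - ?s F)) \<le> norm (a i - b) * norm (g - ?s F)"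
      by (rule cinner_le)
    also have "\<dots> \<le> K * norm (g - ?s F)"
      using elim(1) norm_triangle_ineq4[of "a i" b] by (intro mult_right_mono) (auto simp: K_def)
    also have "\<dots> < e / 2"
      using F K by (simp add: dist_norm norm_minus_commute field_simps)
    finally have "cmod (cinner_ell2 (a i - b) (g - ?s F)) < e / 2" .
    moreover have "cinner_ell2 (a i) g - cinner_ell2 b g =
        (cinner_ell2 (a i) (?s F) - cinner_ell2 b (?s F)) + cinner_ell2 (a i - b) (g - ?s F)"
      unfolding split[of "a i"] split[of b] by (simp add: ab[of "g - ?s F"])
    ultimately show ?case
      using elim(2) unfolding dist_norm
      by (smt (verit, ccfv_SIG) norm_triangle_ineq field_sum_of_halves)
  qed
qed

section \<open>Bounded operators and their matrices\<close>

lemma bounded_op_exists: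
  fixes \<Phi> :: "'a ell2 \<Rightarrow> 'a ell2"
  assumes "\<And>f g. \<Phi> (f + g) = \<Phi> f + \<Phi> g" "\<And>c f. \<Phi> (scaleC_ell2 c f) = scaleC_ell2 c (\<Phi> f)"
    and "\<And>f. norm (\<Phi> f) \<le> C * norm f"
  obtains T where "T \<in> bounded_ops" "\<And>f. blinfun_apply T f = \<Phi> f"
proof -
  have "bounded_linear \<Phi>"
    by (rule bounded_linear_intro[where K = C])
      (use assms in \<open>auto simp: scaleR_conv_scaleC mult.commute\<close>)
  then have "blinfun_apply (Blinfun \<Phi>) f = \<Phi> f" for f
    by (simp add: bounded_linear_Blinfun_apply)
  then show thesis
    using that[of "Blinfun \<Phi>"] assms(2) by (simp add: bounded_ops_def)
qed

lemma bounded_opsD: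
  "T \<in> bounded_ops \<Longrightarrow> blinfun_apply T (scaleC_ell2 c f) = scaleC_ell2 c (blinfun_apply T f)"
  by (simp add: bounded_ops_def)

lemma adjoint_exists:
  assumes T: "T \<in> bounded_ops"
  obtains S where "S \<in> bounded_ops" "is_adjoint S T"
proof -
  have "\<exists>r. (\<forall>f. cinner_ell2 (blinfun_apply T f) g = cinner_ell2 f r) \<and> norm r \<le> norm T * norm g" for g
  proof -
    obtain r where "\<And>f. cinner_ell2 (blinfun_apply T f) g = cinner_ell2 f r" "norm r \<le> norm T * norm g"
    proof (rule riesz[of "\<lambda>f. cinner_ell2 (blinfun_apply T f) g" "norm T * norm g"])
      fix f
      have "cmod (cinner_ell2 (blinfun_apply T f) g) \<le> norm (blinfun_apply T f) * norm g"
        by (rule cinner_le)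
      also have "\<dots> \<le> (norm T * norm f) * norm g"
        by (intro mult_right_mono norm_blinfun) auto
      finally show "cmod (cinner_ell2 (blinfun_apply T f) g) \<le> norm T * norm g * norm f"
        by (simp add: mult_ac)
    qed (auto simp: blinfun.add_right cinner_add_left bounded_opsD[OF T] cinner_scaleC_left)
    then show ?thesis
      by blast
  qed
  then obtain \<Phi> where \<Phi>: "\<And>f g. cinner_ell2 (blinfun_apply T f) g = cinner_ell2 f (\<Phi> g)"
    and bound: "\<And>g. norm (\<Phi> g) \<le> norm T * norm g"
    by metis
  obtain S where "S \<in> bounded_ops" "\<And>f. blinfun_apply S f = \<Phi> f"
  proof (rule bounded_op_exists[of \<Phi> "norm T"])
    show "\<Phi> (f + g) = \<Phi> f + \<Phi> g" for f g
      by (rule cinner_eqI) (simp add: cinner_add_right flip: \<Phi>)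
    show "\<Phi> (scaleC_ell2 c f) = scaleC_ell2 c (\<Phi> f)" for c f
      by (rule cinner_eqI) (simp add: cinner_scaleC_right flip: \<Phi>)
  qed (use bound in auto)
  then show thesis
    using that \<Phi> by (simp add: is_adjoint_def)
qed

lemma bounded_op_has_sum:
  assumes "T \<in> bounded_ops"
  shows "((\<lambda>y. ell2_apply f y * ell2_apply (blinfun_apply T (delta_ell2 y)) x)
    has_sum ell2_apply (blinfun_apply T f) x) UNIV"
proof -
  have "bounded_linear (\<lambda>f. ell2_apply f x)"
    by (rule bounded_linear_intro[where K = 1])
      (auto simp: ell2_coord scaleR_conv_of_real coord_le_norm)
  then have "bounded_linear (\<lambda>f. ell2_apply (blinfun_apply T f) x)"
    by (rule bounded_linear_compose) (rule blinfun.bounded_linear_right)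
  from has_sum_bounded_linear[OF this delta_has_sum[of f]] show ?thesis
    by (simp add: o_def bounded_opsD[OF assms] ell2_coord)
qed

lemma bounded_op_eqI:
  assumes "S \<in> bounded_ops" "T \<in> bounded_ops"
    and "\<And>x y. ell2_apply (blinfun_apply S (delta_ell2 y)) x = ell2_apply (blinfun_apply T (delta_ell2 y)) x"
  shows "S = T"
proof (rule blinfun_eqI, rule ell2_eqI)
  fix f x
  show "ell2_apply (blinfun_apply S f) x = ell2_apply (blinfun_apply T f) x"
    using bounded_op_has_sum[OF assms(1), of f x] bounded_op_has_sum[OF assms(2), of f x]
    unfolding assms(3) by (rule has_sum_unique)
qed

lemma bounded_op_row:
  assumes "T \<in> bounded_ops"
  obtains r where "\<And>f. ell2_apply (blinfun_apply T f) x = cinner_ell2 f r"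
proof (rule riesz[of "\<lambda>f. ell2_apply (blinfun_apply T f) x" "norm T"])
  show "cmod (ell2_apply (blinfun_apply T f) x) \<le> norm T * norm f" for f
    by (rule order_trans[OF coord_le_norm norm_blinfun])
qed (auto simp: blinfun.add_right ell2_coord bounded_opsD[OF assms] that)

lemma comp_in_bounded_ops: "S \<in> bounded_ops \<Longrightarrow> T \<in> bounded_ops \<Longrightarrow> S o\<^sub>L T \<in> bounded_ops"
  by (simp add: bounded_ops_def)

lemma scalar_op_exists:
  obtains T :: "'a ell2 \<Rightarrow>\<^sub>L 'a ell2"
  where "T \<in> bounded_ops" "\<And>f. blinfun_apply T f = scaleC_ell2 c f"
proof (rule bounded_op_exists[of "scaleC_ell2 c" "cmod c"])
  show "scaleC_ell2 c (f + g) = scaleC_ell2 c f + scaleC_ell2 c g"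
    "scaleC_ell2 c (scaleC_ell2 d f) = scaleC_ell2 d (scaleC_ell2 c f)" for f g :: "'a ell2" and d
    by (rule ell2_eqI, simp add: ell2_coord algebra_simps)+
qed (simp_all add: norm_scaleC)

lemma is_adjoint_swap: "is_adjoint S T \<Longrightarrow> is_adjoint T S"
  unfolding is_adjoint_def by (metis cinner_commute)

text \<open>
  The case where \<open>H\<close> is everything gives translations and the operators induced by group
  automorphisms; the case where \<open>\<pi>\<close> is the identity gives the projection onto the functions supported
  on \<open>H\<close>.
\<close>

definition pullback_on :: "'a set \<Rightarrow> ('a \<Rightarrow> 'a) \<Rightarrow> ('a ell2 \<Rightarrow>\<^sub>L 'a ell2)" where
  "pullback_on H \<pi> = Blinfun (\<lambda>f. Abs_ell2 (\<lambda>x. if x \<in> H then ell2_apply f (\<pi> x) else 0))"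

lemma
  assumes inj: "inj_on \<pi> H"
  shows pullback_on_apply: "ell2_apply (blinfun_apply (pullback_on H \<pi>) f) x =
      (if x \<in> H then ell2_apply f (\<pi> x) else 0)"
    and pullback_on_in_bounded_ops: "pullback_on H \<pi> \<in> bounded_ops"
proof -
  define \<Phi> where "\<Phi> f = Abs_ell2 (\<lambda>x. if x \<in> H then ell2_apply f (\<pi> x) else 0)" for f
  have \<Phi>: "(\<forall>x. ell2_apply (\<Phi> f) x = (if x \<in> H then ell2_apply f (\<pi> x) else 0)) \<and> norm (\<Phi> f) \<le> norm f" for f
  proof -
    obtain g where g: "\<And>x. ell2_apply g x = (if x \<in> H then ell2_apply f (\<pi> x) else 0)" "norm g \<le> norm f"
    proof (rule ell2_of_bounded_sums)
      fix F :: "'a set"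
      assume "finite F"
      then have "(\<Sum>x\<in>F. (cmod (if x \<in> H then ell2_apply f (\<pi> x) else 0))\<^sup>2) =
          (\<Sum>x\<in>F \<inter> H. (cmod (ell2_apply f (\<pi> x)))\<^sup>2)"
        by (intro sum.mono_neutral_cong_right) auto
      also have "\<dots> = (\<Sum>y\<in>\<pi> ` (F \<inter> H). (cmod (ell2_apply f y))\<^sup>2)"
        using inj by (subst sum.reindex) (auto simp: inj_on_def)
      also have "\<dots> \<le> (norm f)\<^sup>2"
        using \<open>finite F\<close> by (intro finite_sum_le_norm) auto
      finally show "(\<Sum>x\<in>F. (cmod (if x \<in> H then ell2_apply f (\<pi> x) else 0))\<^sup>2) \<le> (norm f)\<^sup>2" .
    qed auto
    then have "ell2_apply g = (\<lambda>x. if x \<in> H then ell2_apply f (\<pi> x) else 0)"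
      by auto
    then have "\<Phi> f = g"
      unfolding \<Phi>_def by (metis ell2_apply_inverse)
    with g show ?thesis
      by blast
  qed
  obtain T where T: "T \<in> bounded_ops" "\<And>f. blinfun_apply T f = \<Phi> f"
  proof (rule bounded_op_exists[of \<Phi> 1])
    show "\<Phi> (f + g) = \<Phi> f + \<Phi> g" "\<Phi> (scaleC_ell2 c f) = scaleC_ell2 c (\<Phi> f)" for c f g
      by (rule ell2_eqI, simp add: \<Phi> ell2_coord)+
  qed (use \<Phi> in auto)
  have "pullback_on H \<pi> = T"
    unfolding pullback_on_def \<Phi>_def[symmetric] T(2)[symmetric] by (rule blinfun_apply_inverse)
  with T \<Phi> show "ell2_apply (blinfun_apply (pullback_on H \<pi>) f) x =
      (if x \<in> H then ell2_apply f (\<pi> x) else 0)" "pullback_on H \<pi> \<in> bounded_ops"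
    by auto
qed

lemma pullback_on_adjoint:
  assumes "bij_betw \<pi> H H'" "\<And>x. x \<in> H \<Longrightarrow> \<pi>' (\<pi> x) = x"
  shows "is_adjoint (pullback_on H' \<pi>') (pullback_on H \<pi>)"
proof -
  have inj: "inj_on \<pi> H" "inj_on \<pi>' H'"
    using assms by (auto simp: bij_betw_def inj_on_def)
  show ?thesis
    unfolding is_adjoint_def
  proof (intro allI)
    fix f g
    have "cinner_ell2 (blinfun_apply (pullback_on H \<pi>) f) g =
        (\<Sum>\<^sub>\<infinity>x\<in>H. ell2_apply f (\<pi> x) * cnj (ell2_apply g (\<pi>' (\<pi> x))))"
      unfolding cinner_ell2_def pullback_on_apply[OF inj(1)]
      by (rule infsum_cong_neutral) (auto simp: assms(2))
    also have "\<dots> = (\<Sum>\<^sub>\<infinity>y\<in>H'. ell2_apply f y * cnj (ell2_apply g (\<pi>' y)))"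
      by (rule infsum_reindex_bij_betw[OF assms(1)])
    also have "\<dots> = cinner_ell2 f (blinfun_apply (pullback_on H' \<pi>') g)"
      unfolding cinner_ell2_def pullback_on_apply[OF inj(2)]
      by (rule infsum_cong_neutral) auto
    finally show "cinner_ell2 (blinfun_apply (pullback_on H \<pi>) f) g =
        cinner_ell2 f (blinfun_apply (pullback_on H' \<pi>') g)" .
  qed
qed

section \<open>Von Neumann algebras\<close>

lemma commutantI: "T \<in> bounded_ops \<Longrightarrow> (\<And>S. S \<in> X \<Longrightarrow> T o\<^sub>L S = S o\<^sub>L T) \<Longrightarrow> T \<in> commutant X"
  by (simp add: commutant_def)

lemma commutant_antimono: "X \<subseteq> Y \<Longrightarrow> commutant Y \<subseteq> commutant X"
  by (auto simp: commutant_def)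

lemma commutant_subset: "commutant X \<subseteq> bounded_ops"
  by (auto simp: commutant_def)

lemma subset_bicommutant: "X \<subseteq> bounded_ops \<Longrightarrow> X \<subseteq> commutant (commutant X)"
  by (auto simp: commutant_def)

text \<open>
  Taking adjoints turns the relation \<open>T S = S T\<close> into the relation for the adjoints, so the adjoint of
  \<open>T\<close> commutes with the adjoints of the elements of \<open>X\<close>, which are in \<open>X\<close> again.
\<close>

lemma von_neumann_algebra_commutant:
  assumes "X \<subseteq> bounded_ops" and adj: "\<And>S. S \<in> X \<Longrightarrow> \<exists>S'\<in>X. is_adjoint S' S"
  shows "von_neumann_algebra (commutant X)"
  unfolding von_neumann_algebra_def
proof (intro conjI ballI)
  fix T
  assume T: "T \<in> commutant X"
  then obtain T' where T': "T' \<in> bounded_ops" "is_adjoint T' T"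
    using adjoint_exists commutant_subset by (metis subsetD)
  have "T' o\<^sub>L S = S o\<^sub>L T'" if S: "S \<in> X" for S
  proof (rule blinfun_eqI, rule cinner_eqI)
    fix f g
    obtain S' where S': "S' \<in> X" "is_adjoint S' S"
      using adj[OF S] by blast
    have TS: "blinfun_apply T (blinfun_apply S' f) = blinfun_apply S' (blinfun_apply T f)" for f
      using T S'(1) by (simp add: commutant_def flip: blinfun_apply_blinfun_compose)
    have "cinner_ell2 f (blinfun_apply T' (blinfun_apply S g)) =
        cinner_ell2 (blinfun_apply S' (blinfun_apply T f)) g"
      using T'(2) is_adjoint_swap[OF S'(2)] by (simp add: is_adjoint_def)
    also have "\<dots> = cinner_ell2 f (blinfun_apply S (blinfun_apply T' g))"
      using T'(2) is_adjoint_swap[OF S'(2)] by (simp add: is_adjoint_def flip: TS)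
    finally show "cinner_ell2 f (blinfun_apply (T' o\<^sub>L S) g) = cinner_ell2 f (blinfun_apply (S o\<^sub>L T') g)"
      by simp
  qed
  with T' show "\<exists>S\<in>commutant X. is_adjoint S T"
    by (auto intro: commutantI)
next
  show "commutant (commutant (commutant X)) = commutant X"
    using commutant_antimono[OF subset_bicommutant[OF assms(1)]] subset_bicommutant[OF commutant_subset]
    by (rule subset_antisym)
qed (rule commutant_subset)

text \<open>
  The family of algebras that is intersected contains the algebra of all bounded operators, which is
  the commutant of the empty set. Closure under adjoints passes to the intersection because an
  adjoint is unique and hence the same in all members of the family.
\<close>

lemma von_neumann_algebra_vn_generated:
  assumes "X \<subseteq> bounded_ops"
  shows "von_neumann_algebra (vn_generated X)"
proof -
  let ?M = "{M. von_neumann_algebra M \<and> X \<subseteq> M}"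
  have "von_neumann_algebra (commutant {} :: ('a ell2 \<Rightarrow>\<^sub>L 'a ell2) set)"
    by (rule von_neumann_algebra_commutant) auto
  then have top: "bounded_ops \<in> ?M"
    using assms by (simp add: commutant_def)
  then have sub: "vn_generated X \<subseteq> bounded_ops"
    by (auto simp: vn_generated_def)
  have "\<exists>S\<in>vn_generated X. is_adjoint S T" if T: "T \<in> vn_generated X" for T
  proof -
    obtain S where S: "is_adjoint S T" "S \<in> bounded_ops"
      using adjoint_exists T sub by (metis subsetD)
    have "S \<in> M" if M: "M \<in> ?M" for M
    proof -
      have "T \<in> M" "\<forall>T\<in>M. \<exists>S\<in>M. is_adjoint S T"
        using M T by (simp_all add: vn_generated_def von_neumann_algebra_def)
      then obtain S' where "S' \<in> M" "is_adjoint S' T"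
        by blast
      moreover have "S' = S"
      proof (rule blinfun_eqI, rule cinner_eqI)
        fix f g
        show "cinner_ell2 f (blinfun_apply S' g) = cinner_ell2 f (blinfun_apply S g)"
          using S(1) \<open>is_adjoint S' T\<close> by (simp add: is_adjoint_def)
      qed
      ultimately show ?thesis
        by simp
    qed
    with S(1) show ?thesis
      by (auto simp: vn_generated_def)
  qed
  moreover have "commutant (commutant (vn_generated X)) \<subseteq> M" if "M \<in> ?M" for M
  proof -
    have "vn_generated X \<subseteq> M"
      using that by (auto simp: vn_generated_def)
    then have "commutant (commutant (vn_generated X)) \<subseteq> commutant (commutant M)"
      by (intro commutant_antimono)
    with that show ?thesis
      by (simp add: von_neumann_algebra_def)
  qed
  then have "commutant (commutant (vn_generated X)) \<subseteq> vn_generated X"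
    by (auto simp: vn_generated_def)
  ultimately show ?thesis
    using sub subset_bicommutant[OF sub] by (auto simp: von_neumann_algebra_def)
qed

lemma vn_generated_least: "von_neumann_algebra M \<Longrightarrow> X \<subseteq> M \<Longrightarrow> vn_generated X \<subseteq> M"
  by (auto simp: vn_generated_def)

lemma subset_vn_generated: "X \<subseteq> vn_generated X"
  by (auto simp: vn_generated_def)

context
  fixes P :: "('a ell2 \<Rightarrow>\<^sub>L 'a ell2) set"
  assumes P: "von_neumann_algebra P"
begin

lemma vna_bounded: "T \<in> P \<Longrightarrow> T \<in> bounded_ops"
  using P by (auto simp: von_neumann_algebra_def)

lemma vna_adjoint: "T \<in> P \<Longrightarrow> \<exists>S\<in>P. is_adjoint S T"
  using P by (auto simp: von_neumann_algebra_def)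

lemma vnaI:
  assumes "T \<in> bounded_ops" "\<And>S. S \<in> commutant P \<Longrightarrow> T o\<^sub>L S = S o\<^sub>L T"
  shows "T \<in> P"
proof -
  have "T \<in> commutant (commutant P)"
    using assms by (rule commutantI)
  with P show ?thesis
    by (simp add: von_neumann_algebra_def)
qed

lemma vna_commute:
  assumes "T \<in> P" "S \<in> commutant P"
  shows "blinfun_apply T (blinfun_apply S f) = blinfun_apply S (blinfun_apply T f)"
proof -
  have "S o\<^sub>L T = T o\<^sub>L S"
    using assms by (simp add: commutant_def)
  from arg_cong[OF this, of "\<lambda>R. blinfun_apply R f"] show ?thesis
    by simp
qed

lemma vna_comp:
  assumes "S \<in> P" "T \<in> P"
  shows "S o\<^sub>L T \<in> P"
proof (rule vnaI)
  show "S o\<^sub>L T \<in> bounded_ops"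
    using assms by (simp add: comp_in_bounded_ops vna_bounded)
  fix R
  assume "R \<in> commutant P"
  then show "S o\<^sub>L T o\<^sub>L R = R o\<^sub>L (S o\<^sub>L T)"
    using assms by (intro blinfun_eqI[of "S o\<^sub>L T o\<^sub>L R"]) (simp add: vna_commute)
qed

lemma vna_add:
  assumes "S \<in> P" "T \<in> P"
  shows "S + T \<in> P"
proof (rule vnaI)
  show "S + T \<in> bounded_ops"
    using assms[THEN vna_bounded]
    by (auto simp: bounded_ops_def blinfun.add_left intro!: ell2_eqI simp: ell2_coord algebra_simps)
  fix R
  assume "R \<in> commutant P"
  then show "(S + T) o\<^sub>L R = R o\<^sub>L (S + T)"
    using assms by (intro blinfun_eqI[of "(S + T) o\<^sub>L R"])
      (simp add: vna_commute blinfun.add_left blinfun.add_right)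
qed

lemma vna_scalar:
  obtains S where "S \<in> P" "\<And>f. blinfun_apply S f = scaleC_ell2 c f"
proof -
  obtain S :: "'a ell2 \<Rightarrow>\<^sub>L 'a ell2" where
    S: "S \<in> bounded_ops" "\<And>f. blinfun_apply S f = scaleC_ell2 c f"
    by (rule scalar_op_exists[of c], rule that)
  have "S \<in> P"
  proof (rule vnaI[OF S(1)])
    fix R
    assume "R \<in> commutant P"
    then have "R \<in> bounded_ops"
      using commutant_subset by blast
    then show "S o\<^sub>L R = R o\<^sub>L S"
      by (intro blinfun_eqI[of "S o\<^sub>L R"]) (simp add: S(2) bounded_opsD)
  qed
  with S that show thesis
    by blast
qed

end

lemma von_neumann_algebra_Int:
  assumes "von_neumann_algebra M" "von_neumann_algebra N"
  shows "von_neumann_algebra (M \<inter> N)"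
proof -
  have "vn_generated (M \<inter> N) = M \<inter> N"
    using vn_generated_least[OF assms(1), of "M \<inter> N"] vn_generated_least[OF assms(2), of "M \<inter> N"]
      subset_vn_generated[of "M \<inter> N"] by auto
  moreover have "M \<inter> N \<subseteq> bounded_ops"
    using vna_bounded[OF assms(1)] by auto
  ultimately show ?thesis
    using von_neumann_algebra_vn_generated by metis
qed

section \<open>Fourier coefficients of operators commuting with right translations\<close>

locale full_group = group G for G (structure) +
  assumes carrier_UNIV: "carrier G = UNIV"
begin

lemma in_carrier [simp]: "x \<in> carrier G"
  by (simp add: carrier_UNIV)

lemma mult_inv_cancel [simp]: "x \<otimes> (inv x \<otimes> y) = y" "inv x \<otimes> (x \<otimes> y) = y"
    "x \<otimes> inv y \<otimes> y = x" "x \<otimes> y \<otimes> inv y = x"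
  by (simp_all add: m_assoc) (simp_all flip: m_assoc)

abbreviation "U \<equiv> group_unitary G"
abbreviation "fourier \<equiv> fourier_coeff G"

definition right_translation :: "'a \<Rightarrow> ('a ell2 \<Rightarrow>\<^sub>L 'a ell2)" where
  "right_translation g = pullback_on UNIV (\<lambda>x. x \<otimes> g)"

text \<open>
  The group unitaries commute with right translations, so every von Neumann algebra generated by some
  of them is contained in this one. Its elements have matrices that depend only on \<open>x y\<inverse>\<close> and are
  therefore determined by their Fourier coefficients.
\<close>

definition right_commutant :: "('a ell2 \<Rightarrow>\<^sub>L 'a ell2) set" where
  "right_commutant = commutant (range right_translation)"

lemma bij_right_mult: "bij (\<lambda>x. x \<otimes> g)"
  by (rule bij_betw_byWitness[where f' = "\<lambda>x. x \<otimes> inv g"]) auto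

lemma inj_right_mult [simp]: "inj (\<lambda>x. x \<otimes> g)"
  using bij_right_mult by (rule bij_is_inj)

lemma right_translation_apply [simp]:
  "ell2_apply (blinfun_apply (right_translation g) f) x = ell2_apply f (x \<otimes> g)"
  by (simp add: right_translation_def pullback_on_apply)

lemma right_translation_bounded: "right_translation g \<in> bounded_ops"
  by (simp add: right_translation_def pullback_on_in_bounded_ops)

lemma right_translation_adjoint: "is_adjoint (right_translation (inv g)) (right_translation g)"
  unfolding right_translation_def
  by (rule pullback_on_adjoint) (use bij_right_mult in auto)

lemma right_translation_delta: "blinfun_apply (right_translation (inv y)) (delta_ell2 \<one>) = delta_ell2 y"
proof (rule ell2_eqI)
  fix x
  have "x \<otimes> inv y = \<one> \<longleftrightarrow> x = y"
    by (metis mult_inv_cancel(3) in_carrier l_one r_inv)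
  then show "ell2_apply (blinfun_apply (right_translation (inv y)) (delta_ell2 \<one>)) x =
      ell2_apply (delta_ell2 y) x"
    by (simp add: ell2_coord)
qed

lemma right_commutant_bounded: "T \<in> right_commutant \<Longrightarrow> T \<in> bounded_ops"
  using commutant_subset by (auto simp: right_commutant_def)

lemma right_commutantI:
  assumes "T \<in> bounded_ops"
    and "\<And>g f x. ell2_apply (blinfun_apply T (blinfun_apply (right_translation g) f)) x =
      ell2_apply (blinfun_apply T f) (x \<otimes> g)"
  shows "T \<in> right_commutant"
  unfolding right_commutant_def
proof (rule commutantI[OF assms(1)])
  fix S
  assume "S \<in> range right_translation"
  then obtain g where S: "S = right_translation g"
    by auto
  show "T o\<^sub>L S = S o\<^sub>L T"
    by (rule blinfun_eqI[of "T o\<^sub>L S"], rule ell2_eqI) (simp add: S assms(2))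
qed

lemma right_commutantD:
  assumes "T \<in> right_commutant"
  shows "ell2_apply (blinfun_apply T (blinfun_apply (right_translation g) f)) x =
    ell2_apply (blinfun_apply T f) (x \<otimes> g)"
proof -
  have "T o\<^sub>L right_translation g = right_translation g o\<^sub>L T"
    using assms by (auto simp: right_commutant_def commutant_def)
  from arg_cong[OF this, of "\<lambda>R. ell2_apply (blinfun_apply R f) x"] show ?thesis
    by simp
qed

lemma von_neumann_algebra_commutant_translations:
  assumes "X \<subseteq> bounded_ops" "\<And>S. S \<in> X \<Longrightarrow> is_adjoint S S"
  shows "von_neumann_algebra (right_commutant \<inter> commutant X)"
proof -
  have "right_commutant \<inter> commutant X = commutant (range right_translation \<union> X)"
    by (auto simp: right_commutant_def commutant_def)
  also have "von_neumann_algebra \<dots>"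
    using assms right_translation_bounded right_translation_adjoint
    by (intro von_neumann_algebra_commutant) blast+
  finally show ?thesis .
qed

lemma von_neumann_algebra_right_commutant: "von_neumann_algebra right_commutant"
proof -
  have "right_commutant \<inter> commutant {} = right_commutant"
    by (auto simp: right_commutant_def commutant_def)
  then show ?thesis
    using von_neumann_algebra_commutant_translations[of "{}"] by auto
qed

lemma apply_delta_eq_coeff:
  assumes "T \<in> right_commutant"
  shows "ell2_apply (blinfun_apply T (delta_ell2 y)) x = fourier T (x \<otimes> inv y)"
  using right_commutantD[OF assms, of "inv y" "delta_ell2 \<one>" x]
  by (simp add: right_translation_delta fourier_coeff_def)

lemma apply_has_sum:
  assumes "T \<in> right_commutant"
  shows "((\<lambda>y. ell2_apply f y * fourier T (x \<otimes> inv y)) has_sum ell2_apply (blinfun_apply T f) x) UNIV"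
  using bounded_op_has_sum[OF right_commutant_bounded[OF assms], of f x]
  by (simp only: apply_delta_eq_coeff[OF assms])

lemma coeff_eqI:
  assumes "S \<in> right_commutant" "T \<in> right_commutant" "\<And>x. fourier S x = fourier T x"
  shows "S = T"
  using assms by (intro bounded_op_eqI) (auto simp: right_commutant_bounded apply_delta_eq_coeff)

lemma coeff_comp:
  assumes "S \<in> right_commutant" "T \<in> right_commutant"
  shows "((\<lambda>y. fourier T y * fourier S (x \<otimes> inv y)) has_sum fourier (S o\<^sub>L T) x) UNIV"
  using apply_has_sum[OF assms(1), of "blinfun_apply T (delta_ell2 \<one>)" x]
  by (simp add: fourier_coeff_def)

lemma coeff_add [simp]: "fourier (S + T) x = fourier S x + fourier T x"
  by (simp add: fourier_coeff_def blinfun.add_left ell2_coord)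

lemma coeff_scalar:
  "(\<And>f. blinfun_apply S f = scaleC_ell2 c f) \<Longrightarrow> fourier (S o\<^sub>L T) x = c * fourier T x"
  by (simp add: fourier_coeff_def ell2_coord)

lemma unitary_apply: "ell2_apply (blinfun_apply (U g) f) x = ell2_apply f (inv g \<otimes> x)"
  by (rule group_unitary_apply[OF is_group carrier_UNIV])

lemma coeff_unitary_comp [simp]: "fourier (U g o\<^sub>L T) x = fourier T (inv g \<otimes> x)"
  by (simp add: fourier_coeff_def unitary_apply)

lemma coeff_comp_unitary [simp]:
  "T \<in> right_commutant \<Longrightarrow> fourier (T o\<^sub>L U g) x = fourier T (x \<otimes> inv g)"
  by (simp add: fourier_coeff_def[of _ "T o\<^sub>L U g"] group_unitary_delta[OF is_group carrier_UNIV]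
      apply_delta_eq_coeff)

lemma coeff_unitary: "fourier (U g) x = (if x = g then 1 else 0)"
  by (simp add: fourier_coeff_def group_unitary_delta[OF is_group carrier_UNIV] ell2_coord)

lemma unitary_in_right_commutant: "U g \<in> right_commutant"
proof (rule right_commutantI)
  show "U g \<in> bounded_ops"
    by (auto simp: bounded_ops_def unitary_apply ell2_coord intro!: ell2_eqI)
qed (simp add: unitary_apply m_assoc)

lemma norm_unitary_le: "norm (U g) \<le> 1"
proof (rule norm_blinfun_bound)
  fix f
  have "bij (\<lambda>x. inv g \<otimes> x)"
    by (rule bij_betw_byWitness[where f' = "\<lambda>x. g \<otimes> x"]) auto
  from infsum_reindex_bij_betw[OF this, of "\<lambda>x. (cmod (ell2_apply f x))\<^sup>2"]
  have "(norm (blinfun_apply (U g) f))\<^sup>2 = (norm f)\<^sup>2"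
    by (simp add: norm_ell2_square unitary_apply)
  then show "norm (blinfun_apply (U g) f) \<le> 1 * norm f"
    by (simp add: power2_eq_iff_nonneg)
qed auto

lemma coeff_adjoint:
  assumes "is_adjoint S T" "T \<in> right_commutant"
  shows "fourier S x = cnj (fourier T (inv x))"
proof -
  have coord: "ell2_apply f y = cinner_ell2 f (delta_ell2 y)" for f and y :: 'a
  proof -
    have "cinner_ell2 f (delta_ell2 y) = (\<Sum>\<^sub>\<infinity>x\<in>{y}. ell2_apply f x)"
      unfolding cinner_ell2_def by (rule infsum_cong_neutral) (auto simp: ell2_coord)
    then show ?thesis
      by simp
  qed
  have "fourier S x = cnj (cinner_ell2 (delta_ell2 x) (blinfun_apply S (delta_ell2 \<one>)))"
    by (simp only: fourier_coeff_def coord[of _ x] cinner_commute[of _ "delta_ell2 x"] complex_cnj_cnj)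
  also have "\<dots> = cnj (ell2_apply (blinfun_apply T (delta_ell2 x)) \<one>)"
    using assms(1) by (simp add: is_adjoint_def coord)
  finally show ?thesis
    by (simp add: apply_delta_eq_coeff[OF assms(2)])
qed

subsection \<open>Closure under limits\<close>

text \<open>
  For fixed \<open>x\<close> the convolution is the inner product of \<open>f\<close> with a reindexed copy of the coefficients,
  so this is an instance of weak convergence.
\<close>

lemma tendsto_convolution:
  fixes t :: "'i \<Rightarrow> 'a \<Rightarrow> complex"
  assumes bound: "\<forall>\<^sub>F i in \<F>. \<forall>F. finite F \<longrightarrow> (\<Sum>x\<in>F. (cmod (t i x))\<^sup>2) \<le> C\<^sup>2" and "0 \<le> C"
    and lim: "\<And>x. ((\<lambda>i. t i x) \<longlongrightarrow> t' x) \<F>" and "\<F> \<noteq> bot"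
  shows "((\<lambda>i. \<Sum>\<^sub>\<infinity>y. ell2_apply f y * t i (x \<otimes> inv y)) \<longlongrightarrow>
    (\<Sum>\<^sub>\<infinity>y. ell2_apply f y * t' (x \<otimes> inv y))) \<F>"
proof -
  define h where "h i = Abs_ell2 (\<lambda>y. t i (x \<otimes> inv y))" for i
  have inj: "inj (\<lambda>y. x \<otimes> inv y)"
  proof (rule injI)
    fix y z
    assume "x \<otimes> inv y = x \<otimes> inv z"
    from arg_cong[OF this, of "\<lambda>w. inv (inv x \<otimes> w)"] show "y = z"
      by simp
  qed
  have h: "(\<forall>y. ell2_apply (Abs_ell2 (\<lambda>y. s (x \<otimes> inv y))) y = s (x \<otimes> inv y)) \<and>
      norm (Abs_ell2 (\<lambda>y. s (x \<otimes> inv y))) \<le> C"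
    if s: "\<And>F. finite F \<Longrightarrow> (\<Sum>x\<in>F. (cmod (s x))\<^sup>2) \<le> C\<^sup>2" for s :: "'a \<Rightarrow> complex"
  proof -
    obtain g where g: "\<And>y. ell2_apply g y = s (x \<otimes> inv y)" "norm g \<le> C"
    proof (rule ell2_of_bounded_sums[of "\<lambda>y. s (x \<otimes> inv y)" C])
      fix F :: "'a set"
      assume "finite F"
      have "(\<Sum>y\<in>F. (cmod (s (x \<otimes> inv y)))\<^sup>2) = (\<Sum>z\<in>(\<lambda>y. x \<otimes> inv y) ` F. (cmod (s z))\<^sup>2)"
        using inj by (subst sum.reindex) (auto simp: inj_on_def)
      also have "\<dots> \<le> C\<^sup>2"
        using \<open>finite F\<close> by (intro s) auto
      finally show "(\<Sum>y\<in>F. (cmod (s (x \<otimes> inv y)))\<^sup>2) \<le> C\<^sup>2" .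
    qed (use \<open>0 \<le> C\<close> in auto)
    have "ell2_apply g = (\<lambda>y. s (x \<otimes> inv y))"
      using g by auto
    then have "Abs_ell2 (\<lambda>y. s (x \<otimes> inv y)) = g"
      by (metis ell2_apply_inverse)
    with g show ?thesis
      by simp
  qed
  have "(\<Sum>x\<in>F. (cmod (t' x))\<^sup>2) \<le> C\<^sup>2" if "finite F" for F
  proof (rule tendsto_upperbound[OF _ _ \<open>\<F> \<noteq> bot\<close>])
    show "((\<lambda>i. \<Sum>x\<in>F. (cmod (t i x))\<^sup>2) \<longlongrightarrow> (\<Sum>x\<in>F. (cmod (t' x))\<^sup>2)) \<F>"
      by (intro tendsto_intros lim)
    show "\<forall>\<^sub>F i in \<F>. (\<Sum>x\<in>F. (cmod (t i x))\<^sup>2) \<le> C\<^sup>2"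
      using bound by eventually_elim (use that in auto)
  qed
  note h' = h[OF this]
  obtain g where g: "\<And>y. ell2_apply g y = cnj (ell2_apply f y)"
    by (rule ell2_of_bounded_sums[of "\<lambda>y. cnj (ell2_apply f y)" "norm f"])
      (auto simp: finite_sum_le_norm)
  have sum: "cinner_ell2 k g = (\<Sum>\<^sub>\<infinity>y. ell2_apply f y * s (x \<otimes> inv y))"
    if "\<forall>y. ell2_apply k y = s (x \<otimes> inv y)" for k s
    unfolding cinner_ell2_def using that by (simp add: g mult.commute)
  have ev: "\<forall>\<^sub>F i in \<F>. (\<forall>y. ell2_apply (h i) y = t i (x \<otimes> inv y)) \<and> norm (h i) \<le> C"
    using bound unfolding h_def by eventually_elim (use h in blast)
  have "((\<lambda>i. cinner_ell2 (h i) g) \<longlongrightarrow> cinner_ell2 (Abs_ell2 (\<lambda>y. t' (x \<otimes> inv y))) g) \<F>"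
  proof (rule tendsto_cinner_of_coordinates)
    show "\<forall>\<^sub>F i in \<F>. norm (h i) \<le> C"
      using ev by eventually_elim auto
    fix y
    have "((\<lambda>i. t i (x \<otimes> inv y)) \<longlongrightarrow> ell2_apply (Abs_ell2 (\<lambda>y. t' (x \<otimes> inv y))) y) \<F>"
      using h' lim by simp
    then show "((\<lambda>i. ell2_apply (h i) y) \<longlongrightarrow> ell2_apply (Abs_ell2 (\<lambda>y. t' (x \<otimes> inv y))) y) \<F>"
      by (rule Lim_transform_eventually) (use ev in \<open>auto elim: eventually_mono\<close>)
  qed
  moreover have "\<forall>\<^sub>F i in \<F>. cinner_ell2 (h i) g = (\<Sum>\<^sub>\<infinity>y. ell2_apply f y * t i (x \<otimes> inv y))"
    using ev by eventually_elim (rule sum, simp)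
  moreover have "cinner_ell2 (Abs_ell2 (\<lambda>y. t' (x \<otimes> inv y))) g =
      (\<Sum>\<^sub>\<infinity>y. ell2_apply f y * t' (x \<otimes> inv y))"
    by (rule sum) (use h' in simp)
  ultimately show ?thesis
    using Lim_transform_eventually by fastforce
qed

lemma coeff_finite_sum_le:
  assumes "finite F"
  shows "(\<Sum>x\<in>F. (cmod (fourier T x))\<^sup>2) \<le> (norm (blinfun_apply T (delta_ell2 \<one>)))\<^sup>2"
  unfolding fourier_coeff_def by (rule finite_sum_le_norm[OF assms])

lemma apply_eq_infsum:
  "T \<in> right_commutant \<Longrightarrow>
    ell2_apply (blinfun_apply T f) x = (\<Sum>\<^sub>\<infinity>y. ell2_apply f y * fourier T (x \<otimes> inv y))"
  using apply_has_sum[of T f x] by (simp add: infsumI)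

text \<open>
  To see that \<open>T'\<close> commutes with \<open>S\<close>
  in the commutant of \<open>P\<close>, compare the matrix entries of \<open>T i S = S T i\<close> in the limit. On the left,
  \<open>T i\<close> is applied to a fixed vector, and convolution is continuous; on the right, a fixed row of \<open>S\<close>
  is applied to the columns of \<open>T i\<close>, which converge weakly because they are translates of the
  coefficients.
\<close>

lemma vna_closed_coefficientwise:
  fixes T :: "'i \<Rightarrow> 'a ell2 \<Rightarrow>\<^sub>L 'a ell2"
  assumes P: "von_neumann_algebra P" "P \<subseteq> right_commutant" and T': "T' \<in> right_commutant"
    and T: "\<And>i. T i \<in> P" and bound: "\<forall>\<^sub>F i in \<F>. \<forall>F. finite F \<longrightarrow> (\<Sum>x\<in>F. (cmod (fourier (T i) x))\<^sup>2) \<le> C\<^sup>2"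
    and "0 \<le> C" and lim: "\<And>x. ((\<lambda>i. fourier (T i) x) \<longlongrightarrow> fourier T' x) \<F>" and "\<F> \<noteq> bot"
  shows "T' \<in> P"
proof (rule vnaI[OF P(1)])
  show "T' \<in> bounded_ops"
    using T' by (rule right_commutant_bounded)
  fix S
  assume S: "S \<in> commutant P"
  then have S': "S \<in> bounded_ops"
    using commutant_subset by blast
  have conv: "((\<lambda>i. ell2_apply (blinfun_apply (T i) f) x) \<longlongrightarrow> ell2_apply (blinfun_apply T' f) x) \<F>" for f x
    using tendsto_convolution[OF bound \<open>0 \<le> C\<close> lim \<open>\<F> \<noteq> bot\<close>, of f x] T P(2) T'
    by (simp add: apply_eq_infsum subset_iff)
  show "T' o\<^sub>L S = S o\<^sub>L T'"
  proof (rule bounded_op_eqI)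
    fix x y
    obtain r where r: "\<And>f. ell2_apply (blinfun_apply S f) x = cinner_ell2 f r"
      using bounded_op_row[OF S'] by blast
    have "((\<lambda>i. cinner_ell2 (blinfun_apply (T i) (delta_ell2 y)) r) \<longlongrightarrow>
        cinner_ell2 (blinfun_apply T' (delta_ell2 y)) r) \<F>"
    proof (rule tendsto_cinner_of_coordinates[OF _ conv])
      show "\<forall>\<^sub>F i in \<F>. norm (blinfun_apply (T i) (delta_ell2 y)) \<le> C"
        using bound
      proof eventually_elim
        case (elim i)
        have Ti: "T i \<in> right_commutant"
          using T P(2) by blast
        have "(\<Sum>\<^sub>\<infinity>x. (cmod (fourier (T i) (x \<otimes> inv y)))\<^sup>2) = (\<Sum>\<^sub>\<infinity>x. (cmod (fourier (T i) x))\<^sup>2)"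
          by (rule infsum_reindex_bij_betw[OF bij_right_mult])
        also have "\<dots> \<le> C\<^sup>2"
          using elim ell2_summable by (intro infsum_le_finite_sums) (auto simp: fourier_coeff_def)
        finally have "(norm (blinfun_apply (T i) (delta_ell2 y)))\<^sup>2 \<le> C\<^sup>2"
          by (simp add: norm_ell2_square apply_delta_eq_coeff[OF Ti])
        then show ?case
          using \<open>0 \<le> C\<close> by (simp add: power2_le_iff_abs_le)
      qed
    qed
    then have "((\<lambda>i. ell2_apply (blinfun_apply (T i) (blinfun_apply S (delta_ell2 y))) x) \<longlongrightarrow>
        ell2_apply (blinfun_apply S (blinfun_apply T' (delta_ell2 y))) x) \<F>"
      unfolding r[symmetric] vna_commute[OF P(1) T S] .
    from tendsto_unique[OF \<open>\<F> \<noteq> bot\<close> conv this]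
    show "ell2_apply (blinfun_apply (T' o\<^sub>L S) (delta_ell2 y)) x =
        ell2_apply (blinfun_apply (S o\<^sub>L T') (delta_ell2 y)) x"
      by simp
  qed (use S' right_commutant_bounded[OF T'] in \<open>auto intro: comp_in_bounded_ops\<close>)
qed

text \<open>
  A bound on the operator norms makes the limiting coefficients define a bounded operator: by
  convolution with \<open>f\<close>, coordinates converge, and the bound \<open>C \<parallel>f\<parallel>\<close> on finite sections persists.
\<close>

lemma bounded_coefficientwise_limit:
  fixes T :: "'i \<Rightarrow> 'a ell2 \<Rightarrow>\<^sub>L 'a ell2"
  assumes T: "\<And>i. T i \<in> right_commutant" and bound: "\<And>i. norm (T i) \<le> C"
    and lim: "\<And>x. ((\<lambda>i. fourier (T i) x) \<longlongrightarrow> t x) \<F>" and "\<F> \<noteq> bot"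
  obtains T' where "T' \<in> right_commutant" "\<And>x. fourier T' x = t x"
proof -
  define \<phi> where "\<phi> f x = (\<Sum>\<^sub>\<infinity>y. ell2_apply f y * t (x \<otimes> inv y))" for f x
  have C: "0 \<le> C"
    by (rule order_trans[OF norm_ge_zero bound])
  have fin: "(\<Sum>x\<in>F. (cmod (fourier (T i) x))\<^sup>2) \<le> C\<^sup>2" if "finite F" for i F
  proof -
    have "(cmod (ell2_apply (delta_ell2 \<one>) x))\<^sup>2 = (if x = \<one> then 1 else 0)" for x :: 'a
      by (simp add: ell2_coord)
    then have "(norm (delta_ell2 \<one> :: 'a ell2))\<^sup>2 = (\<Sum>\<^sub>\<infinity>x\<in>{\<one> :: 'a}. 1)"
      unfolding norm_ell2_square by (intro infsum_cong_neutral) auto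
    then have "norm (delta_ell2 \<one> :: 'a ell2) = 1"
      by (simp add: power2_eq_1_iff) (smt (verit) norm_ge_zero)
    then have "norm (blinfun_apply (T i) (delta_ell2 \<one>)) \<le> C"
      using norm_blinfun[of "T i" "delta_ell2 \<one>"] bound[of i] by simp
    then show ?thesis
      by (rule order_trans[OF coeff_finite_sum_le[OF that] power_mono]) simp
  qed
  have conv: "((\<lambda>i. ell2_apply (blinfun_apply (T i) f) x) \<longlongrightarrow> \<phi> f x) \<F>" for f x
    using tendsto_convolution[of "\<lambda>i. fourier (T i)" C \<F> t f x] C lim \<open>\<F> \<noteq> bot\<close> fin
    by (simp add: apply_eq_infsum[OF T] \<phi>_def)
  note eq = tendsto_unique[OF \<open>\<F> \<noteq> bot\<close> conv]
  have ex: "\<exists>g. (\<forall>x. ell2_apply g x = \<phi> f x) \<and> norm g \<le> C * norm f" for f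
  proof (rule ell2_of_bounded_sums[of "\<phi> f" "C * norm f"])
    fix F :: "'a set"
    assume "finite F"
    show "(\<Sum>x\<in>F. (cmod (\<phi> f x))\<^sup>2) \<le> (C * norm f)\<^sup>2"
    proof (rule tendsto_upperbound[OF _ _ \<open>\<F> \<noteq> bot\<close>])
      show "((\<lambda>i. \<Sum>x\<in>F. (cmod (ell2_apply (blinfun_apply (T i) f) x))\<^sup>2) \<longlongrightarrow>
          (\<Sum>x\<in>F. (cmod (\<phi> f x))\<^sup>2)) \<F>"
        by (intro tendsto_intros conv)
      have "(\<Sum>x\<in>F. (cmod (ell2_apply (blinfun_apply (T i) f) x))\<^sup>2) \<le> (C * norm f)\<^sup>2" for i
      proof -
        have "norm (blinfun_apply (T i) f) \<le> C * norm f"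
          using norm_blinfun[of "T i" f] mult_right_mono[OF bound[of i] norm_ge_zero[of f]] by linarith
        then show ?thesis
          by (rule order_trans[OF finite_sum_le_norm[OF \<open>finite F\<close>] power_mono]) simp
      qed
      then show "\<forall>\<^sub>F i in \<F>. (\<Sum>x\<in>F. (cmod (ell2_apply (blinfun_apply (T i) f) x))\<^sup>2) \<le> (C * norm f)\<^sup>2"
        by simp
    qed
  qed (use C in auto)
  then obtain \<Phi> where \<Phi>: "\<And>f x. ell2_apply (\<Phi> f) x = \<phi> f x" "\<And>f. norm (\<Phi> f) \<le> C * norm f"
    by metis
  obtain T' where T': "T' \<in> bounded_ops" "\<And>f. blinfun_apply T' f = \<Phi> f"
  proof (rule bounded_op_exists[of \<Phi> C])
    have "\<phi> (f + g) x = \<phi> f x + \<phi> g x" for f g x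
      by (rule eq) (simp add: blinfun.add_right ell2_coord tendsto_add conv)
    then show "\<Phi> (f + g) = \<Phi> f + \<Phi> g" for f g
      by (intro ell2_eqI) (simp add: \<Phi> ell2_coord)
    have "\<phi> (scaleC_ell2 c f) x = c * \<phi> f x" for c f x
      by (rule eq) (simp add: bounded_opsD[OF right_commutant_bounded[OF T]] ell2_coord tendsto_mult conv)
    then show "\<Phi> (scaleC_ell2 c f) = scaleC_ell2 c (\<Phi> f)" for c f
      by (intro ell2_eqI) (simp add: \<Phi> ell2_coord)
  qed (use \<Phi> in auto)
  have "T' \<in> right_commutant"
  proof (rule right_commutantI[OF T'(1)])
    fix g f x
    have "\<phi> (blinfun_apply (right_translation g) f) x = \<phi> f (x \<otimes> g)"
      by (rule eq) (simp add: right_commutantD[OF T] conv)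
    then show "ell2_apply (blinfun_apply T' (blinfun_apply (right_translation g) f)) x =
        ell2_apply (blinfun_apply T' f) (x \<otimes> g)"
      by (simp add: T' \<Phi>)
  qed
  moreover have "fourier T' x = t x" for x
  proof -
    have "\<phi> (delta_ell2 \<one>) x = t x"
      by (rule eq) (use lim in \<open>simp add: fourier_coeff_def\<close>)
    then show ?thesis
      by (simp add: fourier_coeff_def T' \<Phi>)
  qed
  ultimately show thesis
    by (rule that)
qed

lemma vna_bounded_coefficientwise_limit:
  fixes T :: "'i \<Rightarrow> 'a ell2 \<Rightarrow>\<^sub>L 'a ell2"
  assumes P: "von_neumann_algebra P" "P \<subseteq> right_commutant"
    and T: "\<And>i. T i \<in> P" and bound: "\<And>i. norm (T i) \<le> C"
    and lim: "\<And>x. ((\<lambda>i. fourier (T i) x) \<longlongrightarrow> t x) \<F>" and "\<F> \<noteq> bot"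
  obtains T' where "T' \<in> P" "\<And>x. fourier T' x = t x"
proof -
  obtain T' where T': "T' \<in> right_commutant" "\<And>x. fourier T' x = t x"
    by (rule bounded_coefficientwise_limit[OF _ bound lim \<open>\<F> \<noteq> bot\<close>]) (use T P(2) in auto)
  let ?C = "C * norm (delta_ell2 \<one> :: 'a ell2)"
  have C: "0 \<le> C"
    by (rule order_trans[OF norm_ge_zero bound])
  have "norm (blinfun_apply (T i) (delta_ell2 \<one>)) \<le> ?C" for i
    by (rule order_trans[OF norm_blinfun mult_right_mono[OF bound]]) simp
  then have "(\<Sum>x\<in>F. (cmod (fourier (T i) x))\<^sup>2) \<le> ?C\<^sup>2" if "finite F" for i F
    by (intro order_trans[OF coeff_finite_sum_le[OF that] power_mono]) auto
  then have "T' \<in> P"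
    using C lim by (intro vna_closed_coefficientwise[OF P T'(1) T, where C = ?C and \<F> = \<F>])
      (auto simp: T'(2) \<open>\<F> \<noteq> bot\<close>)
  from that[OF this T'(2)] show thesis .
qed

subsection \<open>Subalgebras described by coefficients\<close>

text \<open>
  The coefficient at \<open>x y\<inverse>\<close> is the matrix entry at \<open>(x, y)\<close>. It vanishes off \<open>H\<close> exactly if the operator
  preserves the functions supported on each coset \<open>H y\<close>; because of the invariance under right
  translations the coset \<open>H\<close> suffices. So the set is the commutant of the right translations and
  one projection.
\<close>

lemma von_neumann_algebra_support_in_subgroup:
  assumes "subgroup H G"
  shows "von_neumann_algebra {T \<in> right_commutant. \<forall>x. fourier T x \<noteq> 0 \<longrightarrow> x \<in> H}"
proof -
  interpret H: subgroup H G by fact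
  let ?p = "pullback_on H (\<lambda>x. x)"
  have p: "ell2_apply (blinfun_apply ?p f) x = (if x \<in> H then ell2_apply f x else 0)" for f x
    by (simp add: pullback_on_apply)
  have iff: "(T \<in> commutant {?p}) = (\<forall>x. fourier T x \<noteq> 0 \<longrightarrow> x \<in> H)" if T: "T \<in> right_commutant" for T
  proof
    assume "T \<in> commutant {?p}"
    then have "T o\<^sub>L ?p = ?p o\<^sub>L T"
      by (simp add: commutant_def)
    then have eq: "blinfun_apply T (blinfun_apply ?p (delta_ell2 \<one>)) =
        blinfun_apply ?p (blinfun_apply T (delta_ell2 \<one>))"
      by (metis blinfun_apply_blinfun_compose)
    have "blinfun_apply ?p (delta_ell2 \<one>) = delta_ell2 \<one>"
      by (rule ell2_eqI) (auto simp: p ell2_coord)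
    with eq have "fourier T x = (if x \<in> H then fourier T x else 0)" for x
      unfolding fourier_coeff_def by (metis p)
    then show "\<forall>x. fourier T x \<noteq> 0 \<longrightarrow> x \<in> H"
      by metis
  next
    assume supp: "\<forall>x. fourier T x \<noteq> 0 \<longrightarrow> x \<in> H"
    have "T o\<^sub>L ?p = ?p o\<^sub>L T"
    proof (rule bounded_op_eqI)
      fix x y
      have "blinfun_apply ?p (delta_ell2 y) = (if y \<in> H then delta_ell2 y else 0)"
        by (rule ell2_eqI) (auto simp: p ell2_coord)
      moreover have "x \<otimes> inv y \<in> H \<Longrightarrow> x \<in> H \<longleftrightarrow> y \<in> H"
        by (metis H.m_closed H.m_inv_closed mult_inv_cancel(1,3) in_carrier inv_inv inv_mult_group)
      ultimately show "ell2_apply (blinfun_apply (T o\<^sub>L ?p) (delta_ell2 y)) x =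
          ell2_apply (blinfun_apply (?p o\<^sub>L T) (delta_ell2 y)) x"
        using supp by (auto simp: p apply_delta_eq_coeff[OF T] ell2_coord)
    qed (use right_commutant_bounded[OF T] in \<open>simp_all add: comp_in_bounded_ops pullback_on_in_bounded_ops\<close>)
    then show "T \<in> commutant {?p}"
      by (intro commutantI right_commutant_bounded T) auto
  qed
  have "von_neumann_algebra (right_commutant \<inter> commutant {?p})"
    by (rule von_neumann_algebra_commutant_translations)
      (auto simp: pullback_on_in_bounded_ops bij_betw_def intro!: pullback_on_adjoint)
  moreover have "right_commutant \<inter> commutant {?p} = {T \<in> right_commutant. \<forall>x. fourier T x \<noteq> 0 \<longrightarrow> x \<in> H}"
    using iff by auto
  ultimately show ?thesis
    by simp
qed

text \<open>
  The invariance says that the operator commutes with the self-adjoint unitary induced by \<open>\<theta>\<close>.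
\<close>

lemma von_neumann_algebra_invariant_coeffs:
  assumes hom: "\<And>x y. \<theta> (x \<otimes> y) = \<theta> x \<otimes> \<theta> y" and invol: "\<And>x. \<theta> (\<theta> x) = x"
  shows "von_neumann_algebra {T \<in> right_commutant. \<forall>x. fourier T (\<theta> x) = fourier T x}"
proof -
  let ?w = "pullback_on UNIV \<theta>"
  have bij: "bij \<theta>"
    using invol by (intro bij_betw_byWitness[where f' = \<theta>]) auto
  have w: "ell2_apply (blinfun_apply ?w f) x = ell2_apply f (\<theta> x)" for f x
    using bij by (simp add: pullback_on_apply bij_is_inj)
  have one: "\<theta> \<one> = \<one>"
    using arg_cong[OF hom[of \<one> \<one>], of "\<lambda>x. x \<otimes> inv (\<theta> \<one>)"] by simp
  have inv: "\<theta> (inv x) = inv (\<theta> x)" for x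
    by (metis hom one in_carrier inv_equality l_inv)
  have delta: "blinfun_apply ?w (delta_ell2 y) = delta_ell2 (\<theta> y)" for y
    by (rule ell2_eqI) (use invol in \<open>auto simp: w ell2_coord\<close>)
  have iff: "(T \<in> commutant {?w}) = (\<forall>x. fourier T (\<theta> x) = fourier T x)" if T: "T \<in> right_commutant" for T
  proof
    assume "T \<in> commutant {?w}"
    then have "T o\<^sub>L ?w = ?w o\<^sub>L T"
      by (simp add: commutant_def)
    then have "blinfun_apply T (blinfun_apply ?w (delta_ell2 \<one>)) =
        blinfun_apply ?w (blinfun_apply T (delta_ell2 \<one>))"
      by (metis blinfun_apply_blinfun_compose)
    then show "\<forall>x. fourier T (\<theta> x) = fourier T x"
      unfolding fourier_coeff_def by (metis w delta one)
  next
    assume inv': "\<forall>x. fourier T (\<theta> x) = fourier T x"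
    have "T o\<^sub>L ?w = ?w o\<^sub>L T"
    proof (rule bounded_op_eqI)
      fix x y
      have "fourier T (\<theta> x \<otimes> inv y) = fourier T (\<theta> (x \<otimes> inv (\<theta> y)))"
        by (simp add: hom inv invol)
      then show "ell2_apply (blinfun_apply (T o\<^sub>L ?w) (delta_ell2 y)) x =
          ell2_apply (blinfun_apply (?w o\<^sub>L T) (delta_ell2 y)) x"
        by (simp add: w delta apply_delta_eq_coeff[OF T] inv')
    qed (use bij right_commutant_bounded[OF T] in
        \<open>simp_all add: bij_is_inj comp_in_bounded_ops pullback_on_in_bounded_ops\<close>)
    then show "T \<in> commutant {?w}"
      by (intro commutantI right_commutant_bounded T) auto
  qed
  have "von_neumann_algebra (right_commutant \<inter> commutant {?w})"
    by (rule von_neumann_algebra_commutant_translations)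
      (use bij invol in \<open>auto intro: pullback_on_in_bounded_ops pullback_on_adjoint simp: bij_is_inj\<close>)
  moreover have "right_commutant \<inter> commutant {?w} = {T \<in> right_commutant. \<forall>x. fourier T (\<theta> x) = fourier T x}"
    using iff by auto
  ultimately show ?thesis
    by simp
qed

subsection \<open>Truncation\<close>

lemma vna_sum_coefficients:
  assumes P: "von_neumann_algebra P" and "finite F"
    and E: "\<And>y. y \<in> F \<Longrightarrow> t y \<noteq> 0 \<Longrightarrow> \<exists>E\<in>P. \<forall>x. fourier E x = e y x"
  shows "\<exists>E\<in>P. \<forall>x. fourier E x = (\<Sum>y\<in>F. t y * e y x)"
  using \<open>finite F\<close> E
proof (induction F)
  case empty
  obtain S where "S \<in> P" "\<And>f. blinfun_apply S f = scaleC_ell2 0 f"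
    by (rule vna_scalar[OF P, of 0], rule that)
  then show ?case
    by (intro bexI[of _ S]) (auto simp: fourier_coeff_def ell2_coord)
next
  case (insert y F)
  then obtain E where E: "E \<in> P" "\<And>x. fourier E x = (\<Sum>y\<in>F. t y * e y x)"
    by (metis insertCI)
  show ?case
  proof (cases "t y = 0")
    case True
    with E insert.hyps show ?thesis
      by (intro bexI[of _ E]) auto
  next
    case False
    then obtain E' where E': "E' \<in> P" "\<And>x. fourier E' x = e y x"
      using insert.prems by blast
    obtain S where S: "S \<in> P" "\<And>f. blinfun_apply S f = scaleC_ell2 (t y) f"
      by (rule vna_scalar[OF P, of "t y"], rule that)
    have "(S o\<^sub>L E') + E \<in> P"
      using P E(1) E'(1) S(1) by (intro vna_add vna_comp)
    moreover have "fourier ((S o\<^sub>L E') + E) x = (\<Sum>y\<in>insert y F. t y * e y x)" for x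
      using insert.hyps by (simp add: E E' coeff_scalar[OF S(2)])
    ultimately show ?thesis
      by blast
  qed
qed

text \<open>
  The Fourier series of \<open>T\<close> need not have terms in \<open>P\<close>, but averages of its terms over the symmetries
  \<open>\<pi> s\<close>, weighted by \<open>c s\<close>, may be. Averaging a finite partial sum of the series multiplies each
  coefficient by the proportion of the points \<open>\<pi> s x\<close> that lie in the finite set; so it stays below the
  coefficient of \<open>T\<close> and eventually equals it.
\<close>

lemma in_vna_by_truncation:
  fixes \<pi> :: "'s \<Rightarrow> 'a \<Rightarrow> 'a" and c :: "'s \<Rightarrow> complex"
  assumes P: "von_neumann_algebra P" "P \<subseteq> right_commutant" and T: "T \<in> right_commutant"
    and S: "finite S" "S \<noteq> {}"
    and inv: "\<And>s x. s \<in> S \<Longrightarrow> c s * fourier T (\<pi> s x) = fourier T x / of_nat (card S)"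
    and E: "\<And>y. fourier T y \<noteq> 0 \<Longrightarrow>
      \<exists>E\<in>P. \<forall>x. fourier E x = (\<Sum>s\<in>S. if \<pi> s x = y then c s else 0)"
  shows "T \<in> P"
proof -
  let ?t = "fourier T"
  have "\<exists>E\<in>P. \<forall>x. fourier E x = (\<Sum>y\<in>F. ?t y * (\<Sum>s\<in>S. if \<pi> s x = y then c s else 0))"
    if "finite F" for F
    using vna_sum_coefficients[OF P(1) that, of ?t "\<lambda>y x. \<Sum>s\<in>S. if \<pi> s x = y then c s else 0"] E
    by auto
  moreover have "(\<Sum>y\<in>F. ?t y * (\<Sum>s\<in>S. if \<pi> s x = y then c s else 0)) =
      (?t x / of_nat (card S)) * of_nat (card {s \<in> S. \<pi> s x \<in> F})" if "finite F" for F x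
  proof -
    have "(\<Sum>y\<in>F. ?t y * (\<Sum>s\<in>S. if \<pi> s x = y then c s else 0)) =
        (\<Sum>s\<in>S. \<Sum>y\<in>F. if \<pi> s x = y then c s * ?t y else 0)"
      by (subst sum.swap) (auto simp: sum_distrib_left mult.commute intro!: sum.cong)
    also have "\<dots> = (\<Sum>s\<in>S. if \<pi> s x \<in> F then ?t x / of_nat (card S) else 0)"
      using that by (intro sum.cong refl) (simp add: sum.delta inv)
    also have "\<dots> = (\<Sum>s\<in>{s \<in> S. \<pi> s x \<in> F}. ?t x / of_nat (card S))"
      using S by (intro sum.inter_filter[symmetric])
    finally show ?thesis
      by simp
  qed
  ultimately have "\<exists>E\<in>P. finite F \<longrightarrow> (\<forall>x. fourier E x =
      (?t x / of_nat (card S)) * of_nat (card {s \<in> S. \<pi> s x \<in> F}))" for F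
  proof (cases "finite F")
    case False
    then show ?thesis
      using vna_scalar[OF P(1)] by metis
  qed fastforce
  then obtain E where EP: "\<And>F. E F \<in> P" and E: "\<And>F x. finite F \<Longrightarrow>
      fourier (E F) x = (?t x / of_nat (card S)) * of_nat (card {s \<in> S. \<pi> s x \<in> F})"
    by metis
  let ?C = "norm (blinfun_apply T (delta_ell2 \<one>))"
  show ?thesis
  proof (rule vna_closed_coefficientwise[OF P T EP, where C = ?C])
    have "cmod (fourier (E F) x) \<le> cmod (?t x)" if "finite F" for F x
    proof -
      have "card {s \<in> S. \<pi> s x \<in> F} \<le> card S"
        using S by (intro card_mono) auto
      then have "cmod (?t x) * (real (card {s \<in> S. \<pi> s x \<in> F}) / real (card S)) \<le> cmod (?t x)"
        using S by (intro mult_left_le) (auto simp: divide_simps)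
      then show ?thesis
        by (simp add: E[OF that] norm_mult norm_divide)
    qed
    then have "(\<Sum>x\<in>A. (cmod (fourier (E F) x))\<^sup>2) \<le> ?C\<^sup>2" if "finite A" "finite F" for A F
      using that by (intro order_trans[OF sum_mono coeff_finite_sum_le]) (auto intro: power_mono)
    then show "\<forall>\<^sub>F F in finite_subsets_at_top UNIV.
        \<forall>A. finite A \<longrightarrow> (\<Sum>x\<in>A. (cmod (fourier (E F) x))\<^sup>2) \<le> ?C\<^sup>2"
      by (intro eventually_finite_subsets_at_top_weakI) auto
    fix x
    have "\<forall>\<^sub>F F in finite_subsets_at_top UNIV. fourier (E F) x = ?t x"
      unfolding eventually_finite_subsets_at_top
    proof (intro exI[of _ "(\<lambda>s. \<pi> s x) ` S"] conjI allI impI)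
      fix F
      assume F: "finite F \<and> (\<lambda>s. \<pi> s x) ` S \<subseteq> F \<and> F \<subseteq> UNIV"
      then have "{s \<in> S. \<pi> s x \<in> F} = S"
        by auto
      with F S show "fourier (E F) x = ?t x"
        by (simp add: E)
    qed (use S in auto)
    then show "((\<lambda>F. fourier (E F) x) \<longlongrightarrow> ?t x) (finite_subsets_at_top UNIV)"
      by (rule tendsto_eventually)
  qed auto
qed

end

section \<open>Sets of functions on the integers closed under dilation and slicing\<close>

abbreviation ind :: "int set \<Rightarrow> int \<Rightarrow> complex" where
  "ind \<equiv> indicator"

lemma ind_eq_if: "ind S k = (if k \<in> S then 1 else 0)"
  by (simp add: indicator_def)

text \<open>
  The set \<open>D\<close> abstracts the coefficient sequences along a line in \<open>\<int>\<^sup>2\<close> of elements of an operator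
  algebra. The last assumption is closure under limits dominated by an element of \<open>D\<close>; it is demanded
  only for limits of finite support, for which the limiting sequence is certain to come from a
  bounded operator.
\<close>

locale line_coefficients =
  fixes D :: "(int \<Rightarrow> complex) set"
  assumes even: "f \<in> D \<Longrightarrow> f (- k) = f k"
    and add: "f \<in> D \<Longrightarrow> g \<in> D \<Longrightarrow> (\<lambda>k. f k + g k) \<in> D"
    and scale: "f \<in> D \<Longrightarrow> (\<lambda>k. z * f k) \<in> D"
    and ind_zero: "ind {0} \<in> D"
    and dilate: "f \<in> D \<Longrightarrow> g \<in> D \<Longrightarrow> c > 0 \<Longrightarrow>
      (\<lambda>k. if c dvd k then f (k div c) * g (k div c) else 0) \<in> D"
    and slice: "f \<in> D \<Longrightarrow> g \<in> D \<Longrightarrow> \<beta> > 0 \<Longrightarrow> \<gamma> > 0 \<Longrightarrow> coprime \<beta> \<gamma> \<Longrightarrow>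
      (\<lambda>k. f (\<beta> * k) * g (\<gamma> * k)) \<in> D"
    and square_summable: "f \<in> D \<Longrightarrow> (\<lambda>k. (cmod (f k))\<^sup>2) summable_on UNIV"
    and dominated_limit: "\<lbrakk>\<And>m. h m \<in> D; f \<in> D; \<And>m k. cmod (h m k) \<le> cmod (f k); finite S;
      \<And>k. k \<in> S \<Longrightarrow> - k \<in> S; \<And>k. (\<lambda>m. h m k) \<longlonglongrightarrow> ind S k\<rbrakk> \<Longrightarrow> ind S \<in> D"
begin

lemma mult: "f \<in> D \<Longrightarrow> g \<in> D \<Longrightarrow> (\<lambda>k. f k * g k) \<in> D"
  using dilate[of f g 1] by simp

lemma ind_Diff:
  assumes "ind S \<in> D" "ind S' \<in> D"
  shows "ind (S - S') \<in> D"
proof -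
  have "(\<lambda>k. ind S k + (-1) * (ind S k * ind S' k)) \<in> D"
    by (rule add[OF assms(1) scale[OF mult[OF assms]]])
  also have "(\<lambda>k. ind S k + (-1) * (ind S k * ind S' k)) = ind (S - S')"
    by (auto simp: ind_eq_if fun_eq_iff)
  finally show ?thesis .
qed

lemma ind_symmetric: "ind S \<in> D \<Longrightarrow> - k \<in> S \<longleftrightarrow> k \<in> S"
  using even[of "ind S" k] by (auto simp: ind_eq_if split: if_splits)

lemma finite_ge:
  assumes "f \<in> D" "e > 0"
  shows "finite {k. e \<le> cmod (f k)}"
proof -
  have "((\<lambda>k. (cmod (f k))\<^sup>2) has_sum (\<Sum>\<^sub>\<infinity>k. (cmod (f k))\<^sup>2)) UNIV"
    using square_summable[OF assms(1)] by (rule has_sum_infsum)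
  then have le: "(\<Sum>k\<in>F. (cmod (f k))\<^sup>2) \<le> (\<Sum>\<^sub>\<infinity>k. (cmod (f k))\<^sup>2)" if "finite F" for F
    using that square_summable[OF assms(1)] by (intro finite_sum_le_infsum) auto
  show ?thesis
  proof (rule ccontr)
    assume inf: "infinite {k. e \<le> cmod (f k)}"
    obtain N where N: "(\<Sum>\<^sub>\<infinity>k. (cmod (f k))\<^sup>2) < real N * e\<^sup>2"
      using reals_Archimedean3[of "e\<^sup>2"] assms(2) by auto
    obtain F where F: "F \<subseteq> {k. e \<le> cmod (f k)}" "finite F" "card F = N"
      using infinite_arbitrarily_large[OF inf] by blast
    have "real N * e\<^sup>2 = (\<Sum>k\<in>F. e\<^sup>2)"
      using F by simp
    also have "\<dots> \<le> (\<Sum>k\<in>F. (cmod (f k))\<^sup>2)"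
      using F assms(2) by (intro sum_mono power_mono) auto
    finally show False
      using le[OF F(2)] N by simp
  qed
qed

text \<open>
  The powers of \<open>r\<close> converge to the indicator function where \<open>r \<le> 1\<close>. The finitely many values above 1
  are first killed by the product of the factors \<open>(r - \<mu>) / (1 - \<mu>)\<close>, which is 1 where \<open>r = 1\<close>. The
  leading factor \<open>r\<close> keeps everything in \<open>D\<close>, which need not contain constants.
\<close>

lemma level_set:
  assumes f: "f \<in> D" "\<And>k. f k = of_real (r k)" and r: "\<And>k. 0 \<le> r k" "r k0 = 1"
  shows "ind {k. r k = 1} \<in> D" "finite {k. r k = 1}"
proof -
  define V where "V = r ` {k. 1 < r k}"
  have fin: "finite {k. 1 \<le> r k}"
    using finite_ge[OF f(1), of 1] r by (simp add: f(2))
  have V: "finite V" "1 \<notin> V"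
    unfolding V_def by (auto intro!: finite_imageI finite_subset[OF _ fin])
  have "(\<lambda>k. f k * of_real (\<Prod>\<mu>\<in>W. (r k - \<mu>) / (1 - \<mu>))) \<in> D" if "finite W" for W
    using that
  proof (induction W)
    case (insert \<mu> W)
    let ?p = "\<lambda>k. \<Prod>\<mu>\<in>W. (r k - \<mu>) / (1 - \<mu>)"
    have "(\<lambda>k. of_real (1 / (1 - \<mu>)) * (f k * (f k * of_real (?p k))) +
        of_real (- \<mu> / (1 - \<mu>)) * (f k * of_real (?p k))) \<in> D"
      by (intro add scale mult[OF f(1)] insert.IH)
    also have "(\<lambda>k. of_real (1 / (1 - \<mu>)) * (f k * (f k * of_real (?p k))) +
        of_real (- \<mu> / (1 - \<mu>)) * (f k * of_real (?p k))) =
        (\<lambda>k. f k * of_real (\<Prod>\<mu>\<in>insert \<mu> W. (r k - \<mu>) / (1 - \<mu>)))"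
    proof
      fix k
      have "1 / (1 - \<mu>) * (r k * (r k * ?p k)) + - \<mu> / (1 - \<mu>) * (r k * ?p k) =
          r k * ((r k - \<mu>) / (1 - \<mu>) * ?p k)"
        by (simp add: algebra_simps add_divide_distrib diff_divide_distrib)
      then show "of_real (1 / (1 - \<mu>)) * (f k * (f k * of_real (?p k))) +
        of_real (- \<mu> / (1 - \<mu>)) * (f k * of_real (?p k)) =
        f k * of_real (\<Prod>\<mu>\<in>insert \<mu> W. (r k - \<mu>) / (1 - \<mu>))"
        by (simp only: f(2) prod.insert[OF insert.hyps] flip: of_real_mult of_real_add)
    qed
    finally show ?case .
  qed (use f(1) in simp)
  note poly = this[OF V(1)]
  define q where "q k = r k * (\<Prod>\<mu>\<in>V. (r k - \<mu>) / (1 - \<mu>))" for k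
  have q: "(\<lambda>k. of_real (q k)) \<in> D"
    using poly by (simp add: q_def f(2))
  have q_zero: "q k = 0" if "1 < r k" for k
    using that V by (auto simp: q_def V_def)
  have q_one: "q k = 1" if "r k = 1" for k
  proof -
    have "(\<Prod>\<mu>\<in>V. (r k - \<mu>) / (1 - \<mu>)) = 1"
      by (rule prod.neutral) (use that V(2) in auto)
    with that show ?thesis
      by (simp add: q_def)
  qed
  have pow: "(\<lambda>k. of_real (q k * r k ^ m)) \<in> D" for m
  proof (induction m)
    case (Suc m)
    from mult[OF f(1) this] show ?case
      by (simp add: f(2) mult_ac)
  qed (use q in simp)
  have le: "cmod (of_real (q k * r k ^ m)) \<le> cmod (of_real (q k))" for k m
  proof (cases "1 < r k")
    case False
    then have "r k ^ m \<le> 1"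
      using r(1)[of k] by (intro power_le_one) auto
    then show ?thesis
      using r(1)[of k] by (simp only: norm_of_real abs_mult) (simp add: mult_left_le)
  qed (simp add: q_zero)
  show fin1: "finite {k. r k = 1}"
    by (rule finite_subset[OF _ fin]) auto
  show "ind {k. r k = 1} \<in> D"
  proof (rule dominated_limit[OF pow q le fin1])
    show "- k \<in> {k. r k = 1}" if "k \<in> {k. r k = 1}" for k
      using that even[OF f(1), of k] by (simp add: f(2))
    show "(\<lambda>m. complex_of_real (q k * r k ^ m)) \<longlonglongrightarrow> ind {k. r k = 1} k" for k
    proof (cases "r k < 1")
      case True
      then have "(\<lambda>m. complex_of_real (q k * r k ^ m)) \<longlonglongrightarrow> of_real (q k * 0)"
        using r(1)[of k] by (intro tendsto_of_real tendsto_mult LIMSEQ_power_zero tendsto_const) auto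
      with True show ?thesis
        by (simp add: ind_eq_if)
    next
      case False
      then show ?thesis
        using q_zero[of k] q_one[of k] by (cases "r k = 1") (auto simp: ind_eq_if)
    qed
  qed
qed

text \<open>
  A minimal set \<open>S\<close> containing \<open>k0\<close> with indicator function in \<open>D\<close> contains no two elements \<open>0 < a < M\<close>, if
  \<open>M\<close> is its maximum and one of them is \<open>\<bar>k0\<bar>\<close>: write \<open>a : M\<close> in lowest terms as \<open>\<beta> : \<gamma>\<close>. The elements
  \<open>\<beta> q\<close> of \<open>S\<close> for which also \<open>\<gamma> q\<close> is in \<open>S\<close> form a subset whose indicator function is obtained by a
  slice and a dilation. It contains \<open>a\<close> and, by maximality, not \<open>M\<close>. So it or its complement in \<open>S\<close>
  contradicts minimality.
\<close>

lemma ind_pair: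
  assumes f: "f \<in> D" "\<And>k. f k = of_real (r k)" and r: "\<And>k. 0 \<le> r k" "r k0 \<noteq> 0"
  shows "ind {k0, - k0} \<in> D"
proof (cases "k0 = 0")
  case True
  then show ?thesis
    using ind_zero by simp
next
  case k0: False
  let ?A = "\<lambda>S. finite S \<and> k0 \<in> S \<and> 0 \<notin> S \<and> ind S \<in> D"
  have fk: "(\<lambda>k. of_real (1 / r k0) * f k) \<in> D"
    by (rule scale[OF f(1)])
  let ?S = "{k. r k / r k0 = 1} - {0}"
  have A: "?A ?S"
    using level_set[OF fk, of "\<lambda>k. r k / r k0" k0] f r k0
    by (auto intro!: ind_Diff ind_zero)
  have "\<exists>S. ?A S \<and> (\<forall>S'. ?A S' \<longrightarrow> card S \<le> card S')"
    by (rule ex_has_least_nat) (rule A)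
  then obtain S where S: "?A S" and min: "\<forall>S'. ?A S' \<longrightarrow> card S \<le> card S'"
    by (elim exE conjE) (rule that, blast+)
  have minimal: "S' = S" if "S' \<subseteq> S" "?A S'" for S'
    using that min[rule_format, of S'] S by (intro card_seteq) auto
  note sym = ind_symmetric[OF conjunct2[OF conjunct2[OF conjunct2[OF S]]]]
  have abs: "\<bar>k\<bar> \<in> S" if "k \<in> S" for k
    using that sym[of k] by (auto simp: abs_if)
  define M where "M = Max (abs ` S)"
  have M: "M \<in> abs ` S" "\<And>k. k \<in> S \<Longrightarrow> \<bar>k\<bar> \<le> M"
    unfolding M_def using S by (auto intro: Max_in)
  then have MS: "M \<in> S" "M > 0"
    using abs S by (auto simp: zero_less_abs_iff)
  have "False" if a: "a \<in> S" "0 < a" "a < M" "a = \<bar>k0\<bar> \<or> \<bar>k0\<bar> = M" for a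
  proof -
    define \<beta> where "\<beta> = a div gcd a M"
    define \<gamma> where "\<gamma> = M div gcd a M"
    have g: "gcd a M > 0"
      using a by simp
    have eqs: "a = \<beta> * gcd a M" "M = \<gamma> * gcd a M"
      by (simp_all add: \<beta>_def \<gamma>_def)
    have pos: "\<beta> > 0" "\<gamma> > 0"
      using eqs a g MS(2) by (metis zero_less_mult_pos2)+
    have lt: "\<beta> < \<gamma>"
      using eqs a(3) g by (metis mult_less_cancel_right_disj not_less_iff_gr_or_eq)
    have cop: "coprime \<beta> \<gamma>"
      unfolding \<beta>_def \<gamma>_def using a by (intro div_gcd_coprime) auto
    define Q where "Q = {k. \<beta> * k \<in> S \<and> \<gamma> * k \<in> S}"
    define S' where "S' = {k. \<beta> dvd k \<and> k div \<beta> \<in> Q}"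
    have "(\<lambda>k. ind S (\<beta> * k) * ind S (\<gamma> * k)) \<in> D"
      using S pos cop by (intro slice) auto
    also have "(\<lambda>k. ind S (\<beta> * k) * ind S (\<gamma> * k)) = ind Q"
      by (auto simp: ind_eq_if Q_def fun_eq_iff)
    finally have "(\<lambda>k. if \<beta> dvd k then ind Q (k div \<beta>) * ind Q (k div \<beta>) else 0) \<in> D"
      using pos by (intro dilate) auto
    also have "(\<lambda>k. if \<beta> dvd k then ind Q (k div \<beta>) * ind Q (k div \<beta>) else 0) = ind S'"
      by (auto simp: ind_eq_if S'_def fun_eq_iff)
    finally have S'D: "ind S' \<in> D" .
    have sub: "S' \<subseteq> S"
      by (auto simp: S'_def Q_def)
    have aS': "a \<in> S'"
    proof -
      have "gcd a M \<in> Q"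
        unfolding Q_def using a(1) MS(1) by (simp flip: eqs)
      moreover have "\<beta> * gcd a M div \<beta> = gcd a M"
        using pos by simp
      then have "a div \<beta> = gcd a M"
        by (simp flip: eqs)
      moreover have "\<beta> dvd a"
        by (subst eqs(1)) simp
      ultimately show ?thesis
        by (simp add: S'_def)
    qed
    have MS': "M \<notin> S'"
    proof
      assume "M \<in> S'"
      then obtain q where q: "M = \<beta> * q" "\<gamma> * q \<in> S"
        using pos by (auto simp: S'_def Q_def elim!: dvdE)
      then have "q > 0"
        using MS(2) pos by (simp add: zero_less_mult_iff)
      then have "M < \<gamma> * q"
        using lt q(1) by simp
      then show False
        using M(2)[OF q(2)] by simp
    qed
    show False
    proof (cases "\<bar>k0\<bar> = M")
      case True
      then have "k0 \<notin> S'"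
        using MS' ind_symmetric[OF S'D, of k0] by (auto simp: abs_if split: if_splits)
      then have "?A (S - S')"
        using S S'D by (auto intro: ind_Diff)
      then have "S - S' = S"
        by (intro minimal) auto
      then show False
        using aS' a(1) by blast
    next
      case False
      then have "k0 \<in> S'"
        using a(4) aS' ind_symmetric[OF S'D, of k0] by (auto simp: abs_if split: if_splits)
      then have "?A S'"
        using S S'D sub finite_subset by blast
      then show False
        using minimal[OF sub] MS' MS(1) by blast
    qed
  qed
  note no = this
  have "S = {k0, - k0}"
  proof -
    have "\<bar>k0\<bar> = M"
      using no[of "\<bar>k0\<bar>"] M(2)[of k0] abs[of k0] S k0 by (cases "\<bar>k0\<bar> < M") auto
    moreover have "\<bar>k\<bar> = M" if "k \<in> S" for k
      using no[of "\<bar>k\<bar>"] M(2)[of k] abs[of k] S that calculation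
      by (cases "k = 0"; cases "\<bar>k\<bar> < M") auto
    ultimately have "k = k0 \<or> k = - k0" if "k \<in> S" for k
      using that by (metis abs_eq_iff)
    then show ?thesis
      using S sym[of k0] by auto
  qed
  with S show ?thesis
    by simp
qed

end

lemma int_subgroup_multiples:
  fixes J :: "int set"
  assumes "0 \<in> J" and add: "\<And>a b. a \<in> J \<Longrightarrow> b \<in> J \<Longrightarrow> a + b \<in> J" and neg: "\<And>a. a \<in> J \<Longrightarrow> - a \<in> J"
  obtains n where "\<And>k. k \<in> J \<longleftrightarrow> n dvd k"
proof (cases "J = {0}")
  case True
  then show thesis
    by (intro that[of 0]) auto
next
  case False
  define n where "n = (LEAST n. n > 0 \<and> int n \<in> J)"
  obtain k where "k \<in> J" "k \<noteq> 0"
    using False assms(1) by auto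
  then have "nat \<bar>k\<bar> > 0 \<and> int (nat \<bar>k\<bar>) \<in> J"
    using neg[of k] by (auto simp: abs_if)
  then have n: "n > 0" "int n \<in> J"
    unfolding n_def by (metis (mono_tags, lifting) LeastI)+
  have mult: "int n * c \<in> J" for c
  proof (induction c rule: int_induct[where k = 0])
    case (step1 i)
    then show ?case
      using add[OF step1(2) n(2)] by (simp add: algebra_simps)
  next
    case (step2 i)
    then show ?case
      using add[OF step2(2) neg[OF n(2)]] by (simp add: algebra_simps)
  qed (use assms in simp)
  have "int n dvd k" if "k \<in> J" for k
  proof (rule ccontr)
    assume "\<not> int n dvd k"
    then have pos: "k mod int n > 0"
      using n(1) by (metis dvd_eq_mod_eq_0 of_nat_0_less_iff order_le_less pos_mod_sign)
    have "k + int n * (- (k div int n)) \<in> J"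
      by (intro add that mult)
    also have "k + int n * (- (k div int n)) = k mod int n"
      by (simp add: minus_mult_div_eq_mod [symmetric])
    finally have "nat (k mod int n) > 0 \<and> int (nat (k mod int n)) \<in> J"
      using pos by simp
    then have "n \<le> nat (k mod int n)"
      unfolding n_def by (rule Least_le)
    then show False
      using n(1) pos_mod_bound[of "int n" k] pos by linarith
  qed
  then show thesis
    using mult by (intro that[of "int n"]) (auto elim: dvdE)
qed

section \<open>Computing in \<open>SL\<^sub>2(\<int>)\<close>\<close>

abbreviation "m11 A \<equiv> mat_of_sl2z A $ 1 $ 1"
abbreviation "m12 A \<equiv> mat_of_sl2z A $ 1 $ 2"
abbreviation "m21 A \<equiv> mat_of_sl2z A $ 2 $ 1"
abbreviation "m22 A \<equiv> mat_of_sl2z A $ 2 $ 2"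
abbreviation "act A v \<equiv> mat_of_sl2z A *v v"

definition vec2 :: "int \<Rightarrow> int \<Rightarrow> int^2" where
  "vec2 a b = (\<chi> i. if i = 1 then a else b)"

lemma vec2_nth [simp]: "vec2 a b $ 1 = a" "vec2 a b $ 2 = b"
  by (simp_all add: vec2_def)

lemma vec2_eq_iff: "v = w \<longleftrightarrow> v $ 1 = w $ 1 \<and> v $ 2 = w $ 2" for v w :: "int^2"
  by (simp add: vec_eq_iff forall_2)

lemma sl2z_det: "m11 A * m22 A - m12 A * m21 A = 1"
  using mat_of_sl2z[of A] by (simp add: det_2)

lemma sl2z_eq_iff:
  "A = B \<longleftrightarrow> m11 A = m11 B \<and> m12 A = m12 B \<and> m21 A = m21 B \<and> m22 A = m22 B"
  by (simp add: mat_of_sl2z_inject[symmetric] vec_eq_iff forall_2)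

definition sl2z_of :: "int \<Rightarrow> int \<Rightarrow> int \<Rightarrow> int \<Rightarrow> sl2z" where
  "sl2z_of a b c d = Abs_sl2z (vector [vector [a, b], vector [c, d]])"

lemma sl2z_of_entries:
  assumes "a * d - b * c = 1"
  shows "m11 (sl2z_of a b c d) = a" "m12 (sl2z_of a b c d) = b"
    "m21 (sl2z_of a b c d) = c" "m22 (sl2z_of a b c d) = d"
proof -
  have "mat_of_sl2z (sl2z_of a b c d) = vector [vector [a, b], vector [c, d]]"
    unfolding sl2z_of_def using assms by (intro Abs_sl2z_inverse) (simp add: det_2)
  then show "m11 (sl2z_of a b c d) = a" "m12 (sl2z_of a b c d) = b"
    "m21 (sl2z_of a b c d) = c" "m22 (sl2z_of a b c d) = d"
    by simp_all
qed

definition sl2z_inv :: "sl2z \<Rightarrow> sl2z" where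
  "sl2z_inv A = sl2z_of (m22 A) (- m12 A) (- m21 A) (m11 A)"

lemma sl2z_inv_entries [simp]:
  "m11 (sl2z_inv A) = m22 A" "m12 (sl2z_inv A) = - m12 A"
  "m21 (sl2z_inv A) = - m21 A" "m22 (sl2z_inv A) = m11 A"
  unfolding sl2z_inv_def using sl2z_det[of A] by (subst sl2z_of_entries; simp add: algebra_simps)+

lemma sl2z_entries [simp]:
  "m11 (sl2z_mult A B) = m11 A * m11 B + m12 A * m21 B"
  "m12 (sl2z_mult A B) = m11 A * m12 B + m12 A * m22 B"
  "m21 (sl2z_mult A B) = m21 A * m11 B + m22 A * m21 B"
  "m22 (sl2z_mult A B) = m21 A * m12 B + m22 A * m22 B"
  "m11 sl2z_id = 1" "m12 sl2z_id = 0" "m21 sl2z_id = 0" "m22 sl2z_id = 1"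
  "m11 (sl2z_neg A) = - m11 A" "m12 (sl2z_neg A) = - m12 A"
  "m21 (sl2z_neg A) = - m21 A" "m22 (sl2z_neg A) = - m22 A"
  by (simp_all add: sl2z_mult.rep_eq sl2z_id.rep_eq sl2z_neg.rep_eq matrix_matrix_mult_def sum_2 mat_def)

lemma act_nth [simp]:
  "act A v $ 1 = m11 A * v $ 1 + m12 A * v $ 2" "act A v $ 2 = m21 A * v $ 1 + m22 A * v $ 2"
  by (simp_all add: matrix_vector_mult_def sum_2)

lemma sl2z_mult_neg [simp]: "sl2z_mult (sl2z_neg A) B = sl2z_neg (sl2z_mult A B)"
    "sl2z_mult A (sl2z_neg B) = sl2z_neg (sl2z_mult A B)" "sl2z_neg (sl2z_neg A) = A"
    "sl2z_inv (sl2z_neg A) = sl2z_neg (sl2z_inv A)"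
  by (simp_all add: sl2z_eq_iff)

lemma sl2z_mult_id [simp]: "sl2z_mult sl2z_id A = A" "sl2z_mult A sl2z_id = A"
    "sl2z_inv sl2z_id = sl2z_id"
  by (simp_all add: sl2z_eq_iff)

lemma sl2z_mult_assoc: "sl2z_mult (sl2z_mult A B) C = sl2z_mult A (sl2z_mult B C)"
  by (simp add: sl2z_eq_iff algebra_simps)

lemma sl2z_mult_inv [simp]: "sl2z_mult (sl2z_inv A) A = sl2z_id" "sl2z_mult A (sl2z_inv A) = sl2z_id"
    "sl2z_inv (sl2z_inv A) = A"
  using sl2z_det[of A] by (simp_all add: sl2z_eq_iff algebra_simps)

lemma sl2z_mult_inv_cancel [simp]: "sl2z_mult A (sl2z_mult (sl2z_inv A) B) = B"
    "sl2z_mult (sl2z_inv A) (sl2z_mult A B) = B"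
  by (simp_all flip: sl2z_mult_assoc)

lemma act_simps [simp]: "act (sl2z_mult A B) v = act A (act B v)" "act sl2z_id v = v"
    "act (sl2z_neg A) v = - act A v" "act A (- v) = - act A v" "act A 0 = 0"
  by (simp_all add: vec2_eq_iff algebra_simps)

lemma act_inv [simp]: "act A (act (sl2z_inv A) v) = v" "act (sl2z_inv A) (act A v) = v"
  by (metis act_simps(1,2) sl2z_mult_inv(2)) (metis act_simps(1,2) sl2z_mult_inv(1))

lemma sl2z_neg_neq [simp]: "sl2z_neg A \<noteq> A" "A \<noteq> sl2z_neg A"
proof -
  have "m11 A \<noteq> 0 \<or> m12 A \<noteq> 0"
    using sl2z_det[of A] by auto
  then show "sl2z_neg A \<noteq> A" "A \<noteq> sl2z_neg A"
    by (auto simp: sl2z_eq_iff)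
qed

lemma sl2z_neg_eq_iff [simp]: "sl2z_neg A = sl2z_neg B \<longleftrightarrow> A = B"
    "sl2z_neg A = sl2z_id \<longleftrightarrow> A = sl2z_neg sl2z_id"
  by (metis sl2z_mult_neg(3))+

lemma exists_first_column:
  assumes "coprime a c"
  obtains A where "m11 A = a" "m21 A = c"
proof -
  obtain x y where "x * a + y * c = 1"
    using assms bezout_int[of a c] by auto
  then have "a * x - (- y) * c = 1"
    by (simp add: algebra_simps)
  from sl2z_of_entries[OF this] show thesis
    by (intro that)
qed

text \<open>
  Divide by the greatest common divisor of the entries and complete to a matrix by Bezout.
\<close>

lemma exists_act_first_axis:
  obtains A k where "v = act A (vec2 k 0)"
proof (cases "v = 0")
  case True
  then show thesis
    by (intro that[of sl2z_id 0]) (simp add: vec2_eq_iff)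
next
  case False
  let ?g = "gcd (v $ 1) (v $ 2)"
  have g: "?g \<noteq> 0"
    using False by (simp add: vec2_eq_iff)
  then have "coprime (v $ 1 div ?g) (v $ 2 div ?g)"
    by (intro div_gcd_coprime) auto
  then obtain A where "m11 A = v $ 1 div ?g" "m21 A = v $ 2 div ?g"
    by (rule exists_first_column)
  then show thesis
    by (intro that[of A ?g]) (simp add: vec2_eq_iff)
qed

section \<open>The algebras \<open>(B \<inter> L(n\<int>\<^sup>2)) \<rtimes> SL\<^sub>2(\<int>)\<close> in terms of coefficients\<close>

interpretation G: full_group Z2_SL2Z
  by (simp add: full_group_def full_group_axioms_def group_Z2_SL2Z) (simp add: Z2_SL2Z_def)

lemma G_mult [simp]: "(v, A) \<otimes>\<^bsub>Z2_SL2Z\<^esub> (w, B) = (v + act A w, sl2z_mult A B)"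
  by (simp add: Z2_SL2Z_def)

lemma G_one: "\<one>\<^bsub>Z2_SL2Z\<^esub> = (0, sl2z_id)"
  by (simp add: Z2_SL2Z_def)

lemma G_inv [simp]: "inv\<^bsub>Z2_SL2Z\<^esub> (v, A) = (- act (sl2z_inv A) v, sl2z_inv A)"
  by (rule G.inv_equality) (simp_all add: G_one)

abbreviation "coef \<equiv> fourier_coeff Z2_SL2Z"
abbreviation "U \<equiv> group_unitary Z2_SL2Z"
abbreviation "LG \<equiv> G.right_commutant"

text \<open>
  The algebra \<open>(B \<inter> L(n\<int>\<^sup>2)) \<rtimes> SL\<^sub>2(\<int>)\<close>, by \<open>crossed_eq_even_lattice_algebra\<close> below.
\<close>

definition even_lattice_algebra :: "int \<Rightarrow> Z2_SL2Z_op set" where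
  "even_lattice_algebra n = {T \<in> LG. (\<forall>v A. coef T (- v, A) = coef T (v, A)) \<and>
    (\<forall>v A. coef T (v, A) \<noteq> 0 \<longrightarrow> (\<exists>w. v = n *s w))}"

lemma von_neumann_algebra_even_lattice_algebra: "von_neumann_algebra (even_lattice_algebra n)"
proof -
  let ?H = "{(n *s w, A) | w A. True} :: ((int^2) \<times> sl2z) set"
  have H: "subgroup ?H Z2_SL2Z"
  proof (rule G.subgroupI)
    fix x y
    assume "x \<in> ?H" "y \<in> ?H"
    then obtain w A w' B where xy: "x = (n *s w, A)" "y = (n *s w', B)"
      by auto
    have eq: "n *s w + act A (n *s w') = n *s (w + act A w')"
      "- act (sl2z_inv A) (n *s w) = n *s (- act (sl2z_inv A) w)"
      by (simp_all add: vec2_eq_iff algebra_simps)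
    show "x \<otimes>\<^bsub>Z2_SL2Z\<^esub> y \<in> ?H" "inv\<^bsub>Z2_SL2Z\<^esub> x \<in> ?H"
      unfolding xy G_mult G_inv eq by blast+
  qed auto
  let ?\<theta> = "\<lambda>(v, A). (- v, A) :: (int^2) \<times> sl2z"
  have "von_neumann_algebra {T \<in> LG. \<forall>x. coef T (?\<theta> x) = coef T x}"
    by (rule G.von_neumann_algebra_invariant_coeffs) auto
  from von_neumann_algebra_Int[OF this G.von_neumann_algebra_support_in_subgroup[OF H]]
  have "von_neumann_algebra ({T \<in> LG. \<forall>x. coef T (?\<theta> x) = coef T x} \<inter>
      {T \<in> LG. \<forall>x. coef T x \<noteq> 0 \<longrightarrow> x \<in> ?H})" .
  also have "{T \<in> LG. \<forall>x. coef T (?\<theta> x) = coef T x} \<inter>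
      {T \<in> LG. \<forall>x. coef T x \<noteq> 0 \<longrightarrow> x \<in> ?H} = even_lattice_algebra n"
    by (auto simp: even_lattice_algebra_def)
  finally show ?thesis .
qed

lemma U_in_even_lattice_algebra: "U (0, A) \<in> even_lattice_algebra n"
proof -
  have "\<exists>w. 0 = n *s w"
    by (rule exI[of _ 0]) (simp add: vec2_eq_iff)
  then show ?thesis
    by (auto simp: even_lattice_algebra_def G.unitary_in_right_commutant G.coeff_unitary)
qed

lemma L_SL2Z_subset: "L_SL2Z \<subseteq> even_lattice_algebra n"
  unfolding L_SL2Z_def group_vna_def using U_in_even_lattice_algebra
  by (intro vn_generated_least von_neumann_algebra_even_lattice_algebra) auto

lemma U_in_L_SL2Z: "U (0, A) \<in> L_SL2Z"
  unfolding L_SL2Z_def group_vna_def by (rule subsetD[OF subset_vn_generated]) auto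

lemma L_nZ2_subset: "L_nZ2 n \<subseteq> {T \<in> LG. \<forall>x. coef T x \<noteq> 0 \<longrightarrow> x \<in> {(n *s w, sl2z_id) | w. True}}"
proof -
  let ?H = "{(n *s w, sl2z_id) | w. True} :: ((int^2) \<times> sl2z) set"
  have "subgroup ?H Z2_SL2Z"
  proof (rule G.subgroupI)
    fix x y
    assume "x \<in> ?H" "y \<in> ?H"
    then obtain w w' where xy: "x = (n *s w, sl2z_id)" "y = (n *s w', sl2z_id)"
      by auto
    have eq: "n *s w + n *s w' = n *s (w + w')" "- (n *s w) = n *s (- w)"
      by (simp_all add: vec2_eq_iff algebra_simps)
    show "x \<otimes>\<^bsub>Z2_SL2Z\<^esub> y \<in> ?H" "inv\<^bsub>Z2_SL2Z\<^esub> x \<in> ?H"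
      unfolding xy G_mult G_inv act_simps sl2z_mult_id eq by blast+
  qed auto
  from G.von_neumann_algebra_support_in_subgroup[OF this] show ?thesis
    unfolding L_nZ2_def group_vna_def
    by (rule vn_generated_least)
      (auto simp: G.unitary_in_right_commutant G.coeff_unitary split: if_splits)
qed

lemma B_alg_Int_L_nZ2_subset: "B_alg \<inter> L_nZ2 n \<subseteq> even_lattice_algebra n"
proof
  fix T
  assume T: "T \<in> B_alg \<inter> L_nZ2 n"
  then have "T \<in> LG" and supp: "\<And>v A. coef T (v, A) \<noteq> 0 \<Longrightarrow> (\<exists>w. v = n *s w) \<and> A = sl2z_id"
    using L_nZ2_subset[of n] by auto
  moreover have "coef T (- v, A) = coef T (v, A)" for v A
  proof (cases "A = sl2z_id")
    case True
    with T show ?thesis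
      by (auto simp: B_alg_def)
  next
    case False
    then show ?thesis
      using supp[of v A] supp[of "- v" A] by metis
  qed
  ultimately show "T \<in> even_lattice_algebra n"
    by (auto simp: even_lattice_algebra_def)
qed

lemma L_Z2_eq: "L_Z2 = L_nZ2 1"
proof -
  have "{(v, sl2z_id) | v :: int^2. True} = {(1 *s v, sl2z_id) | v :: int^2. True}"
    by (simp add: vec2_eq_iff)
  then show ?thesis
    by (simp add: L_Z2_def L_nZ2_def)
qed

lemma crossed_B_alg_subset: "crossed_SL2Z B_alg \<subseteq> even_lattice_algebra 1"
  unfolding crossed_SL2Z_def
proof (rule vn_generated_least[OF von_neumann_algebra_even_lattice_algebra])
  have "B_alg = B_alg \<inter> L_nZ2 1"
    by (auto simp: B_alg_def L_Z2_eq)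
  then show "B_alg \<union> L_SL2Z \<subseteq> even_lattice_algebra 1"
    using B_alg_Int_L_nZ2_subset[of 1] L_SL2Z_subset[of 1] by auto
qed

text \<open>
  The symmetry \<open>v \<mapsto> -v\<close> averages \<open>u\<^sub>v u\<^sub>A\<close> to \<open>(u\<^sub>v + u\<^sub>-\<^sub>v) u\<^sub>A / 2\<close>, which lies in the crossed product for \<open>v\<close>
  in \<open>n\<int>\<^sup>2\<close>; so operators with even coefficients are recovered by truncation.
\<close>

lemma crossed_eq_even_lattice_algebra: "crossed_SL2Z (B_alg \<inter> L_nZ2 n) = even_lattice_algebra n"
proof
  show sub: "crossed_SL2Z (B_alg \<inter> L_nZ2 n) \<subseteq> even_lattice_algebra n"
    unfolding crossed_SL2Z_def
    using vn_generated_least[OF von_neumann_algebra_even_lattice_algebra]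
      B_alg_Int_L_nZ2_subset L_SL2Z_subset by (metis Un_least)
  have "B_alg \<inter> L_nZ2 n \<union> L_SL2Z \<subseteq> bounded_ops"
    using B_alg_Int_L_nZ2_subset[of n] L_SL2Z_subset[of n]
      vna_bounded[OF von_neumann_algebra_even_lattice_algebra] by blast
  then have P: "von_neumann_algebra (crossed_SL2Z (B_alg \<inter> L_nZ2 n))"
    unfolding crossed_SL2Z_def by (rule von_neumann_algebra_vn_generated)
  show "even_lattice_algebra n \<subseteq> crossed_SL2Z (B_alg \<inter> L_nZ2 n)"
  proof
    fix T
    assume T: "T \<in> even_lattice_algebra n"
    let ?\<pi> = "\<lambda>s (v, A). (if s then v else - v, A) :: (int^2) \<times> sl2z"
    show "T \<in> crossed_SL2Z (B_alg \<inter> L_nZ2 n)"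
    proof (rule G.in_vna_by_truncation[OF P, where S = UNIV and \<pi> = ?\<pi> and c = "\<lambda>_. 1 / 2"])
      fix y
      assume "coef T y \<noteq> 0"
      then obtain w A where y: "y = (n *s w, A)"
        using T by (cases y) (auto simp: even_lattice_algebra_def)
      let ?v = "n *s w"
      have L: "U (n *s w, sl2z_id) \<in> L_nZ2 n" for n w
        unfolding L_nZ2_def group_vna_def by (rule subsetD[OF subset_vn_generated]) auto
      have vna: "von_neumann_algebra (L_nZ2 n)" for n
        unfolding L_nZ2_def group_vna_def
        using vna_bounded[OF G.von_neumann_algebra_right_commutant] G.unitary_in_right_commutant
        by (intro von_neumann_algebra_vn_generated) auto
      have minus: "- ?v = n *s (- w)"
        by (simp add: vec2_eq_iff)
      have "U (?v, sl2z_id) + U (- ?v, sl2z_id) \<in> L_nZ2 n"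
        unfolding minus by (intro vna_add[OF vna] L)
      moreover have "U (?v, sl2z_id) + U (- ?v, sl2z_id) \<in> L_Z2"
        unfolding L_Z2_eq using L[of 1 ?v] L[of 1 "- ?v"] by (intro vna_add[OF vna]) simp_all
      moreover have neg: "- x = ?v \<longleftrightarrow> x = - ?v" for x
        by (metis minus_minus)
      ultimately have "U (?v, sl2z_id) + U (- ?v, sl2z_id) \<in> B_alg \<inter> L_nZ2 n"
        by (simp add: B_alg_def G.coeff_unitary)
      then have X: "U (?v, sl2z_id) + U (- ?v, sl2z_id) \<in> crossed_SL2Z (B_alg \<inter> L_nZ2 n)"
        unfolding crossed_SL2Z_def by (intro subsetD[OF subset_vn_generated]) auto
      have "U (0, A) \<in> crossed_SL2Z (B_alg \<inter> L_nZ2 n)"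
        unfolding crossed_SL2Z_def using U_in_L_SL2Z by (intro subsetD[OF subset_vn_generated]) auto
      note X = vna_comp[OF P X this]
      obtain S where S: "S \<in> crossed_SL2Z (B_alg \<inter> L_nZ2 n)"
        "\<And>f. blinfun_apply S f = scaleC_ell2 (1 / 2) f"
        by (rule vna_scalar[OF P, of "1 / 2"], rule that)
      have XLG: "U (?v, sl2z_id) + U (- ?v, sl2z_id) \<in> LG"
        by (intro vna_add[OF G.von_neumann_algebra_right_commutant] G.unitary_in_right_commutant)
      have "coef (S o\<^sub>L ((U (?v, sl2z_id) + U (- ?v, sl2z_id)) o\<^sub>L U (0, A))) x =
          (\<Sum>s\<in>UNIV. if ?\<pi> s x = y then 1 / 2 else 0)" for x
      proof -
        obtain w' C where x: "x = (w', C)"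
          by fastforce
        have eq: "sl2z_mult C (sl2z_inv A) = sl2z_id \<longleftrightarrow> C = A"
          by (metis sl2z_mult_assoc sl2z_mult_id sl2z_mult_inv)
        show ?thesis
          unfolding G.coeff_scalar[OF S(2)] G.coeff_comp_unitary[OF XLG]
          by (auto simp: UNIV_bool x y G.coeff_unitary eq neg)
      qed
      then show "\<exists>E\<in>crossed_SL2Z (B_alg \<inter> L_nZ2 n).
          \<forall>x. coef E x = (\<Sum>s\<in>UNIV. if ?\<pi> s x = y then 1 / 2 else 0)"
        using vna_comp[OF P S(1) X] by blast
    qed (use T sub in \<open>auto simp: even_lattice_algebra_def UNIV_bool\<close>)
  qed
qed

section \<open>Products of unipotent matrices\<close>

lemma upper_triangular_diagonal:
  assumes "m21 A = 0"
  shows "m22 A = m11 A" "m11 A = 1 \<or> m11 A = -1"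
  using sl2z_det[of A] assms by (auto simp: zmult_eq_1_iff)

text \<open>
  The equation says \<open>A (g B g\<inverse>) = h C h\<inverse>\<close>; up to sign, \<open>A\<close>, \<open>g B g\<inverse>\<close> and \<open>h C h\<inverse>\<close> are unipotent with fixed
  vectors \<open>e = (1, 0)\<close>, \<open>g e\<close> and \<open>h e\<close>. Comparing the images of \<open>h e\<close> under both sides leaves two
  cases. If the signs are compatible, the unipotent parts of \<open>A\<close> and \<open>B\<close> are trivial. If not,
  their off-diagonal entries \<open>m\<close>, \<open>m'\<close> satisfy \<open>m m' c\<^sup>2 = \<plusminus>4\<close> with \<open>c\<close> the lower left entry of \<open>g\<close>. This does
  occur for \<open>c = 1\<close> and \<open>c = 2\<close>, but not for \<open>c \<ge> 3\<close>.
\<close>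

lemma upper_triangular_product_rigidity:
  assumes A: "m21 A = 0" and B: "m21 B = 0" and C: "m21 C = 0"
    and eq: "sl2z_mult A (sl2z_mult g (sl2z_mult B (sl2z_mult (sl2z_inv g) h))) = sl2z_mult h C"
    and large: "m21 g \<ge> 3" and h: "m21 h \<noteq> 0" and r: "m21 g * m11 h - m11 g * m21 h \<noteq> 0"
  shows "A = sl2z_id \<or> A = sl2z_neg sl2z_id" "B = sl2z_id \<or> B = sl2z_neg sl2z_id"
proof -
  define a where "a = m11 g"
  define b where "b = m12 g"
  define c where "c = m21 g"
  define d where "d = m22 g"
  define p where "p = m11 h"
  define s where "s = m21 h"
  define Y where "Y = a * s - c * p"
  define m where "m = m12 A"
  define m' where "m' = m12 B"
  define \<epsilon> where "\<epsilon> = m11 A"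
  define \<epsilon>' where "\<epsilon>' = m11 B"
  define \<epsilon>'' where "\<epsilon>'' = m11 C"
  note defs = a_def b_def c_def d_def p_def s_def m_def m'_def \<epsilon>_def \<epsilon>'_def \<epsilon>''_def
  have det: "a * d - b * c = 1"
    unfolding defs by (rule sl2z_det)
  have signs: "\<epsilon> = 1 \<or> \<epsilon> = -1" "\<epsilon>' = 1 \<or> \<epsilon>' = -1" "\<epsilon>'' = 1 \<or> \<epsilon>'' = -1"
    unfolding defs using upper_triangular_diagonal A B C by blast+
  have nz: "c \<ge> 3" "s \<noteq> 0" "Y \<noteq> 0"
    using large h r by (auto simp: Y_def defs)
  define X where "X = d * p - b * s"
  have "a * X + b * Y = (a * d - b * c) * p" "c * X + d * Y = (a * d - b * c) * s"
    by (simp_all add: X_def Y_def algebra_simps)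
  then have XY: "a * X + b * Y = p" "c * X + d * Y = s"
    by (simp_all add: det)
  have "m11 (sl2z_mult A (sl2z_mult g (sl2z_mult B (sl2z_mult (sl2z_inv g) h)))) = \<epsilon>'' * p"
    "m21 (sl2z_mult A (sl2z_mult g (sl2z_mult B (sl2z_mult (sl2z_inv g) h)))) = \<epsilon>'' * s"
    unfolding eq by (simp_all add: C defs)
  then have "\<epsilon> * (a * (\<epsilon>' * X + m' * Y) + b * (\<epsilon>' * Y)) + m * (c * (\<epsilon>' * X + m' * Y) + d * (\<epsilon>' * Y)) = \<epsilon>'' * p"
    "\<epsilon> * (c * (\<epsilon>' * X + m' * Y) + d * (\<epsilon>' * Y)) = \<epsilon>'' * s"
    by (simp_all add: A B upper_triangular_diagonal(1)[OF A] upper_triangular_diagonal(1)[OF B]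
        X_def Y_def algebra_simps defs)
  moreover have "a * (\<epsilon>' * X + m' * Y) + b * (\<epsilon>' * Y) = \<epsilon>' * (a * X + b * Y) + a * m' * Y"
    "c * (\<epsilon>' * X + m' * Y) + d * (\<epsilon>' * Y) = \<epsilon>' * (c * X + d * Y) + c * m' * Y"
    by (simp_all add: algebra_simps)
  ultimately have E: "\<epsilon> * (\<epsilon>' * p + a * m' * Y) + m * (\<epsilon>' * s + c * m' * Y) = \<epsilon>'' * p"
    "\<epsilon> * (\<epsilon>' * s + c * m' * Y) = \<epsilon>'' * s"
    by (simp_all add: XY)
  have "m = 0 \<and> m' = 0"
  proof (cases "\<epsilon>'' = \<epsilon> * \<epsilon>'")
    case True
    then have "c * m' * Y = 0"
      using E(2) signs by (auto simp: algebra_simps)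
    then have "m' = 0"
      using nz by simp
    moreover have "m * s = 0"
      using E(1) signs True \<open>m' = 0\<close> by (auto simp: algebra_simps)
    ultimately show ?thesis
      using nz by simp
  next
    case False
    then have neg: "\<epsilon>'' = - (\<epsilon> * \<epsilon>')"
      using signs by auto
    have m'Y: "c * m' * Y = - (2 * \<epsilon>' * s)"
      using E(2) signs unfolding neg by (auto simp: algebra_simps)
    have "\<epsilon> * (\<epsilon>' * p + a * m' * Y) - m * \<epsilon>' * s = - (\<epsilon> * \<epsilon>' * p)"
      using E(1) unfolding m'Y neg by (simp add: algebra_simps)
    then have "m * \<epsilon>' * s = 2 * \<epsilon> * \<epsilon>' * p + \<epsilon> * a * m' * Y"
      by (simp add: algebra_simps)
    then have "m * \<epsilon>' * s * c = 2 * \<epsilon> * \<epsilon>' * p * c + \<epsilon> * a * (c * m' * Y)"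
      by (simp add: algebra_simps)
    also have "\<dots> = - (2 * \<epsilon> * \<epsilon>' * Y)"
      unfolding m'Y by (simp add: Y_def algebra_simps)
    finally have "(m * \<epsilon>' * s * c) * (c * m' * Y) = (2 * \<epsilon> * \<epsilon>' * Y) * (2 * \<epsilon>' * s)"
      unfolding m'Y by simp
    then have "(s * Y * \<epsilon>') * (c * c * (m * m')) = (s * Y * \<epsilon>') * (4 * \<epsilon> * \<epsilon>')"
      by (simp add: algebra_simps)
    then have "c * c * (m * m') = 4 * \<epsilon> * \<epsilon>'"
      using nz signs by (subst (asm) mult_cancel_left) auto
    then have "c * c dvd 4"
      using signs by (metis dvd_triv_left dvd_minus_iff mult.right_neutral mult_minus_right)
    then have "c * c \<le> 4"
      by (rule zdvd_imp_le) simp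
    moreover have "3 * 3 \<le> c * c"
      using nz by (intro mult_mono) auto
    ultimately show ?thesis
      by simp
  qed
  then show "A = sl2z_id \<or> A = sl2z_neg sl2z_id" "B = sl2z_id \<or> B = sl2z_neg sl2z_id"
    using signs A B upper_triangular_diagonal(1)[OF A] upper_triangular_diagonal(1)[OF B]
    by (auto simp: sl2z_eq_iff defs)
qed

section \<open>One sign component of an intermediate algebra\<close>

locale intermediate_algebra =
  fixes P :: "Z2_SL2Z_op set" and \<sigma> :: complex
  assumes P: "von_neumann_algebra P" and even: "P \<subseteq> even_lattice_algebra 1"
    and U_in_P: "U (0, A) \<in> P" and sign: "\<sigma> = 1 \<or> \<sigma> = -1"
begin

text \<open>
  Since coefficients are even, multiplication by \<open>u\<close> at \<open>-id\<close> turns the coefficient at \<open>(v, A)\<close> into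
  the one at \<open>(v, -A)\<close>. So these are the elements of \<open>q P\<close> if \<open>\<sigma> = 1\<close> and of
  \<open>(1 - q) P\<close> if \<open>\<sigma> = -1\<close>.
\<close>

definition signed :: "Z2_SL2Z_op set" where
  "signed = {T \<in> P. \<forall>v A. coef T (v, sl2z_neg A) = \<sigma> * coef T (v, A)}"

lemma sign_square [simp]: "\<sigma> * \<sigma> = 1" "\<sigma> * (\<sigma> * z) = z" "cnj \<sigma> = \<sigma>"
  using sign by auto

lemma P_subset_LG: "P \<subseteq> LG"
  using even by (auto simp: even_lattice_algebra_def)

lemma coef_minus: "T \<in> P \<Longrightarrow> coef T (- v, A) = coef T (v, A)"
  using even by (auto simp: even_lattice_algebra_def)

lemma signedD:
  assumes "T \<in> signed"
  shows "T \<in> P" "T \<in> LG" "coef T (v, sl2z_neg A) = \<sigma> * coef T (v, A)"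
  using assms P_subset_LG by (auto simp: signed_def)

lemma signed_add: "S \<in> signed \<Longrightarrow> T \<in> signed \<Longrightarrow> S + T \<in> signed"
  by (auto simp: signed_def intro: vna_add[OF P] simp: algebra_simps)

lemma signed_scale:
  assumes "T \<in> signed"
  obtains T' where "T' \<in> signed" "\<And>x. coef T' x = c * coef T x"
proof -
  obtain S where S: "S \<in> P" "\<And>f. blinfun_apply S f = scaleC_ell2 c f"
    by (rule vna_scalar[OF P, of c], rule that)
  have "coef (S o\<^sub>L T) x = c * coef T x" for x
    by (rule G.coeff_scalar[OF S(2)])
  moreover have "S o\<^sub>L T \<in> signed"
    using assms S(1) calculation by (auto simp: signed_def intro: vna_comp[OF P])
  ultimately show thesis
    using that by blast
qed

lemma signed_translate:
  assumes "T \<in> signed"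
  obtains T' where "T' \<in> signed"
    "\<And>v C. coef T' (v, C) = coef T (act A v, sl2z_mult A (sl2z_mult C B))"
proof -
  let ?T = "U (0, sl2z_inv A) o\<^sub>L (T o\<^sub>L U (0, sl2z_inv B))"
  have "coef ?T (v, C) = coef T (act A v, sl2z_mult A (sl2z_mult C B))" for v C
    using signedD(2)[OF assms] by (simp add: sl2z_mult_assoc)
  moreover have "?T \<in> signed"
    using calculation signedD[OF assms] by (auto simp: signed_def intro!: vna_comp[OF P] U_in_P)
  ultimately show thesis
    using that by blast
qed

text \<open>
  The sign condition says that right multiplication by \<open>u\<close> at \<open>-id\<close> is multiplication by \<open>\<sigma>\<close>; in this form
  it is inherited from the right factor.
\<close>

lemma signed_comp:
  assumes "S \<in> signed" "T \<in> signed"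
  shows "S o\<^sub>L T \<in> signed"
proof -
  let ?c = "U (0, sl2z_neg sl2z_id)"
  have in_P: "S o\<^sub>L T \<in> P"
    using assms by (auto simp: signed_def intro: vna_comp[OF P])
  obtain R where R: "R \<in> P" "\<And>f. blinfun_apply R f = scaleC_ell2 \<sigma> f"
    by (rule vna_scalar[OF P, of \<sigma>], rule that)
  have "T o\<^sub>L ?c = R o\<^sub>L T"
  proof (rule G.coeff_eqI)
    show "T o\<^sub>L ?c \<in> LG" "R o\<^sub>L T \<in> LG"
      using signedD[OF assms(2)] R(1) U_in_P P_subset_LG vna_comp[OF P] by blast+
    fix x
    show "coef (T o\<^sub>L ?c) x = coef (R o\<^sub>L T) x"
      using signedD(2,3)[OF assms(2)] by (cases x) (simp add: G.coeff_scalar[OF R(2)])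
  qed
  moreover have "(S o\<^sub>L T) o\<^sub>L ?c = S o\<^sub>L (T o\<^sub>L ?c)"
    by (rule blinfun_eqI) simp
  ultimately have "(S o\<^sub>L T) o\<^sub>L ?c = S o\<^sub>L (R o\<^sub>L T)"
    by simp
  also have "\<dots> = R o\<^sub>L (S o\<^sub>L T)"
    by (rule blinfun_eqI) (simp add: R(2) bounded_opsD[OF vna_bounded[OF P signedD(1)[OF assms(1)]]])
  finally have eq: "(S o\<^sub>L T) o\<^sub>L ?c = R o\<^sub>L (S o\<^sub>L T)" .
  have "coef (S o\<^sub>L T) (v, sl2z_neg A) = \<sigma> * coef (S o\<^sub>L T) (v, A)" for v A
    using in_P P_subset_LG arg_cong[OF eq, of "\<lambda>T. coef T (v, A)"]
    by (simp add: G.coeff_scalar[OF R(2)] subset_iff)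
  with in_P show ?thesis
    by (simp add: signed_def)
qed

lemma signed_adjoint:
  assumes "T \<in> signed"
  obtains S where "S \<in> signed" "\<And>x. coef S x = cnj (coef T (inv\<^bsub>Z2_SL2Z\<^esub> x))"
proof -
  obtain S where S: "S \<in> P" "is_adjoint S T"
    using vna_adjoint[OF P signedD(1)[OF assms]] by blast
  note coef = G.coeff_adjoint[OF S(2) signedD(2)[OF assms]]
  have "coef S (v, sl2z_neg A) = \<sigma> * coef S (v, A)" for v A
    by (simp add: coef signedD(3)[OF assms] coef_minus[OF signedD(1)[OF assms]])
  with S(1) coef show thesis
    by (intro that[of S]) (auto simp: signed_def)
qed

lemma coef_vanishes_along_injective:
  assumes "inj \<phi>"
  shows "(\<lambda>n. coef T (\<phi> n)) \<longlonglongrightarrow> 0"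
proof -
  have "(\<lambda>x. (cmod (coef T x))\<^sup>2) summable_on range \<phi>"
    unfolding fourier_coeff_def by (rule summable_on_subset_banach[OF ell2_summable]) simp
  then have "(\<lambda>n. (cmod (coef T (\<phi> n)))\<^sup>2) summable_on UNIV"
    using summable_on_reindex[OF assms, of "\<lambda>x. (cmod (coef T x))\<^sup>2"] by (simp add: o_def)
  then have "(\<lambda>n. (cmod (coef T (\<phi> n)))\<^sup>2) \<longlonglongrightarrow> 0"
    by (intro summable_LIMSEQ_zero summable_on_imp_summable)
  then have "(\<lambda>n. sqrt ((cmod (coef T (\<phi> n)))\<^sup>2)) \<longlonglongrightarrow> sqrt 0"
    by (rule tendsto_real_sqrt)
  then show ?thesis
    by (simp add: tendsto_norm_zero_iff)
qed

text \<open>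
  Conjugate \<open>T\<close> by the powers of the matrix with rows \<open>(1, 1)\<close>, \<open>(0, 1)\<close>. The points \<open>(v, A)\<close> with \<open>v\<close> on
  the first axis and \<open>A\<close> upper triangular commute with it and keep their coefficients. For any other
  point the conjugates are pairwise distinct, so the coefficients found there tend to 0, being
  values of a square-summable function along an injective sequence.
\<close>

lemma signed_line_part:
  assumes T: "T \<in> signed"
  obtains T' where "T' \<in> signed"
    "\<And>v A. coef T' (v, A) = (if v $ 2 = 0 \<and> m21 A = 0 then coef T (v, A) else 0)"
proof -
  define un where "un n = sl2z_of 1 (int n) 0 1" for n
  have un [simp]: "m11 (un n) = 1" "m12 (un n) = int n" "m21 (un n) = 0" "m22 (un n) = 1" for n
    by (simp_all add: un_def sl2z_of_entries)
  define X where "X n = U (0, un n) o\<^sub>L (T o\<^sub>L U (0, sl2z_inv (un n)))" for n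
  have XP: "X n \<in> P" for n
    unfolding X_def using signedD(1)[OF T] by (intro vna_comp[OF P] U_in_P)
  have norm: "norm (X n) \<le> norm T" for n
  proof -
    have "norm (X n) \<le> norm (U (0, un n)) * (norm T * norm (U (0, sl2z_inv (un n))))"
      unfolding X_def
      by (rule order_trans[OF norm_blinfun_compose mult_left_mono[OF norm_blinfun_compose]]) simp
    also have "\<dots> \<le> 1 * (norm T * 1)"
      using G.norm_unitary_le by (intro mult_mono) auto
    finally show ?thesis
      by simp
  qed
  define \<phi> where "\<phi> x n = (act (sl2z_inv (un n)) (fst x),
    sl2z_mult (sl2z_inv (un n)) (sl2z_mult (snd x) (un n)))" for x n
  have coefX: "coef (X n) x = coef T (\<phi> x n)" for n x
    using signedD(2)[OF T] by (cases x) (simp add: X_def \<phi>_def sl2z_mult_assoc)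
  define t where "t = (\<lambda>(v, A). if v $ 2 = 0 \<and> m21 A = 0 then coef T (v, A) else 0)"
  have lim: "(\<lambda>n. coef (X n) x) \<longlonglongrightarrow> t x" for x
  proof (cases "fst x $ 2 = 0 \<and> m21 (snd x) = 0")
    case True
    then have "\<phi> x n = x" for n
      using upper_triangular_diagonal(1)[of "snd x"]
      by (cases x) (simp add: \<phi>_def vec2_eq_iff sl2z_eq_iff)
    with True show ?thesis
      by (simp add: coefX t_def split_beta)
  next
    case False
    have "inj (\<phi> x)"
    proof (rule injI)
      fix n n'
      assume eq: "\<phi> x n = \<phi> x n'"
      show "n = n'"
      proof (cases "fst x $ 2 = 0")
        case nz: False
        from arg_cong[OF eq, of "\<lambda>y. fst y $ 1"] nz show ?thesis
          by (simp add: \<phi>_def)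
      next
        case True
        with False have "m21 (snd x) \<noteq> 0"
          by simp
        with arg_cong[OF eq, of "\<lambda>y. m11 (snd y)"] show ?thesis
          by (simp add: \<phi>_def)
      qed
    qed
    with False show ?thesis
      using coef_vanishes_along_injective by (auto simp: coefX t_def split_beta)
  qed
  obtain T' where T': "T' \<in> P" "\<And>x. coef T' x = t x"
    by (rule G.vna_bounded_coefficientwise_limit[OF P P_subset_LG XP norm lim]) auto
  then have "T' \<in> signed"
    by (auto simp: signed_def t_def signedD(3)[OF T])
  with T'(2) show thesis
    by (intro that[of T']) (auto simp: t_def)
qed

subsection \<open>Coefficients on a line\<close>

definition line_coefs :: "(int \<Rightarrow> complex) set" where
  "line_coefs = {\<lambda>k. coef T (vec2 k 0, sl2z_id) | T. T \<in> signed}"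

text \<open>
  In contrast to \<open>line_coefs\<close>, the element of the component is required to have no further
  coefficients: it is the projection for \<open>\<sigma>\<close> times an element of \<open>L(\<int>\<^sup>2)\<close> supported on the line.
\<close>

definition central_line_coefs :: "(int \<Rightarrow> complex) set" where
  "central_line_coefs = {f. \<exists>T\<in>signed. \<forall>v A. coef T (v, A) =
    (if v $ 2 = 0 \<and> A = sl2z_id then f (v $ 1)
     else if v $ 2 = 0 \<and> A = sl2z_neg sl2z_id then \<sigma> * f (v $ 1) else 0)}"

lemma central_subset_line_coefs: "central_line_coefs \<subseteq> line_coefs"
proof
  fix f
  assume "f \<in> central_line_coefs"
  then obtain T where T: "T \<in> signed" "\<And>k. coef T (vec2 k 0, sl2z_id) = f k"
    unfolding central_line_coefs_def by force
  then show "f \<in> line_coefs"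
    by (auto simp: line_coefs_def intro!: exI[of _ T])
qed

text \<open>
  Let \<open>g\<close> and \<open>h\<close> have first columns \<open>(a, c)\<close> and \<open>(p, s)\<close>. After \<open>T1\<close> and \<open>T2\<close> are cut down to the first axis
  and upper triangular matrices, the element \<open>h\<inverse> T1 g T2 g\<inverse> h\<close> is cut down in the same way. By
  rigidity only pairs of coefficients at \<open>((j, 0), \<plusminus>id)\<close> and \<open>((j', 0), \<plusminus>id)\<close> contribute, and \<open>rel\<close>
  describes the solutions of \<open>(j, 0) + j' (a, c) = k (p, s)\<close>. There is at most one for each \<open>k\<close>.
\<close>

lemma line_coefs_combination:
  assumes f: "f \<in> line_coefs" and g: "g \<in> line_coefs"
    and cop: "coprime a c" "coprime p s" and c: "c \<ge> 3" and s: "s \<noteq> 0" "c * p - a * s \<noteq> 0"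
    and rel: "\<And>k j j'. j + j' * a = k * p \<and> j' * c = k * s \<longleftrightarrow>
      (\<exists>i. k = \<alpha> * i \<and> j = \<beta> * i \<and> j' = \<gamma> * i)" and \<alpha>: "\<alpha> \<noteq> 0"
  shows "(\<lambda>k. if \<alpha> dvd k then f (\<beta> * (k div \<alpha>)) * g (\<gamma> * (k div \<alpha>)) else 0) \<in> central_line_coefs"
proof -
  let ?F = "\<lambda>k. if \<alpha> dvd k then f (\<beta> * (k div \<alpha>)) * g (\<gamma> * (k div \<alpha>)) else 0"
  have ex: "\<exists>T\<in>signed. (\<forall>v A. coef T (v, A) \<noteq> 0 \<longrightarrow> v $ 2 = 0 \<and> m21 A = 0) \<and>
      (\<forall>k. coef T (vec2 k 0, sl2z_id) = h k)" if h: "h \<in> line_coefs" for h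
  proof -
    obtain T where T: "T \<in> signed" "h = (\<lambda>k. coef T (vec2 k 0, sl2z_id))"
      using h unfolding line_coefs_def by blast
    obtain T' where T': "T' \<in> signed"
      "\<And>v A. coef T' (v, A) = (if v $ 2 = 0 \<and> m21 A = 0 then coef T (v, A) else 0)"
      using signed_line_part[OF T(1)] by blast
    with T(2) show ?thesis
      by (intro bexI[of _ T']) auto
  qed
  obtain T1 where T1: "T1 \<in> signed" "\<And>v A. coef T1 (v, A) \<noteq> 0 \<Longrightarrow> v $ 2 = 0 \<and> m21 A = 0"
    "\<And>k. coef T1 (vec2 k 0, sl2z_id) = f k"
    using ex[OF f] by blast
  obtain T2 where T2: "T2 \<in> signed" "\<And>v A. coef T2 (v, A) \<noteq> 0 \<Longrightarrow> v $ 2 = 0 \<and> m21 A = 0"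
    "\<And>k. coef T2 (vec2 k 0, sl2z_id) = g k"
    using ex[OF g] by blast
  obtain \<gg> where \<gg>: "m11 \<gg> = a" "m21 \<gg> = c"
    using exists_first_column[OF cop(1)] .
  obtain h where h: "m11 h = p" "m21 h = s"
    using exists_first_column[OF cop(2)] .
  obtain T1' where T1': "T1' \<in> signed" "\<And>v C. coef T1' (v, C) = coef T1 (v, sl2z_mult C (sl2z_inv \<gg>))"
    using signed_translate[OF T1(1), of sl2z_id "sl2z_inv \<gg>"] by (simp, blast)
  note V = signed_comp[OF T1'(1) T2(1)]
  obtain W where W: "W \<in> signed"
    "\<And>v C. coef W (v, C) = coef (T1' o\<^sub>L T2) (act h v, sl2z_mult h (sl2z_mult C (sl2z_mult (sl2z_inv h) \<gg>)))"
    using signed_translate[OF V, of h "sl2z_mult (sl2z_inv h) \<gg>"] by blast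
  define left where "left C B = sl2z_mult h (sl2z_mult C (sl2z_mult (sl2z_inv h) (sl2z_mult \<gg> (sl2z_mult (sl2z_inv B) (sl2z_inv \<gg>)))))" for C B
  define summand where "summand k C y = coef T2 y * (case y of (w, B) \<Rightarrow> coef T1
    (act h (vec2 k 0) - act (sl2z_mult h (sl2z_mult C (sl2z_mult (sl2z_inv h) \<gg>))) (act (sl2z_inv B) w), left C B))"
    for k C y
  have sum: "(summand k C has_sum coef W (vec2 k 0, C)) UNIV" for k C
    using G.coeff_comp[OF signedD(2)[OF T1'(1)] signedD(2)[OF T2(1)],
        of "(act h (vec2 k 0), sl2z_mult h (sl2z_mult C (sl2z_mult (sl2z_inv h) \<gg>)))"]
    unfolding W(2)
    by (rule has_sum_cong[THEN iffD1, rotated]) (auto simp: summand_def left_def T1'(2) sl2z_mult_assoc)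
  have supp: "m21 B = 0 \<and> m21 (left C B) = 0" if "summand k C (w, B) \<noteq> 0" for k C w B
  proof -
    from that have "coef T2 (w, B) \<noteq> 0" "\<exists>v. coef T1 (v, left C B) \<noteq> 0"
      by (auto simp: summand_def)
    with T1(2) T2(2) show ?thesis
      by blast
  qed
  have central: "(A = sl2z_id \<or> A = sl2z_neg sl2z_id) \<and> (B = sl2z_id \<or> B = sl2z_neg sl2z_id)"
    if "m21 C = 0" "m21 B = 0" "m21 A = 0"
      and A: "A = left C B"
    for A B C
  proof -
    have "sl2z_mult A (sl2z_mult \<gg> (sl2z_mult B (sl2z_mult (sl2z_inv \<gg>) h))) = sl2z_mult h C"
      unfolding A left_def by (simp add: sl2z_mult_assoc)
    from upper_triangular_product_rigidity[OF that(3,2,1) this] show ?thesis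
      using c s by (simp add: \<gg> h)
  qed
  \<comment> \<open>Away from the centre, every summand of the convolution vanishes by rigidity.\<close>
  have W_zero: "coef W (vec2 k 0, C) = 0" if "m21 C = 0" "C \<noteq> sl2z_id" "C \<noteq> sl2z_neg sl2z_id" for k C
  proof -
    have "summand k C y = 0" for y
    proof (rule ccontr)
      assume nz: "summand k C y \<noteq> 0"
      obtain w B where y: "y = (w, B)"
        by fastforce
      define A where "A = left C B"
      have "m21 B = 0" "m21 A = 0"
        using supp nz unfolding y A_def by blast+
      with central[OF that(1) _ _ A_def] have AB: "A = sl2z_id \<or> A = sl2z_neg sl2z_id"
        "B = sl2z_id \<or> B = sl2z_neg sl2z_id"
        by auto
      have "C = sl2z_mult (sl2z_inv h) (sl2z_mult A (sl2z_mult \<gg> (sl2z_mult B (sl2z_mult (sl2z_inv \<gg>) h))))"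
        unfolding A_def left_def by (simp add: sl2z_mult_assoc)
      with AB have "C = sl2z_id \<or> C = sl2z_neg sl2z_id"
        by auto
      with that show False
        by simp
    qed
    then have "summand k C = (\<lambda>_. 0)"
      by auto
    with sum[of k C] have "((\<lambda>_ :: (int^2) \<times> sl2z. 0) has_sum coef W (vec2 k 0, C)) UNIV"
      by simp
    then show ?thesis
      by (rule has_sum_unique) simp
  qed
  \<comment> \<open>The factor 2 counts the two signs of the pair of central matrices with product \<open>id\<close>.\<close>
  have W_id: "coef W (vec2 k 0, sl2z_id) = 2 * ?F k" for k
  proof -
    have summand_id: "summand k sl2z_id (w, sl2z_id) = coef T2 (w, sl2z_id) * coef T1 (act h (vec2 k 0) - act \<gg> w, sl2z_id)"
      "summand k sl2z_id (w, sl2z_neg sl2z_id) = coef T2 (w, sl2z_id) * coef T1 (act h (vec2 k 0) - act \<gg> (- w), sl2z_id)" for w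
      by (simp_all add: summand_def left_def signedD(3)[OF T1(1)] signedD(3)[OF T2(1)])
    have solve: "w = vec2 (w $ 1) 0 \<and> (\<exists>i. k = \<alpha> * i \<and> w $ 1 = \<gamma> * i)"
      if "coef T2 (w, sl2z_id) * coef T1 (act h (vec2 k 0) - act \<gg> w, sl2z_id) \<noteq> 0" for w
    proof -
      from that have "coef T2 (w, sl2z_id) \<noteq> 0" "coef T1 (act h (vec2 k 0) - act \<gg> w, sl2z_id) \<noteq> 0"
        by auto
      then have w: "w $ 2 = 0" and "(act h (vec2 k 0) - act \<gg> w) $ 2 = 0"
        using T1(2) T2(2) by blast+
      then have "(p * k - w $ 1 * a) + w $ 1 * a = k * p \<and> w $ 1 * c = k * s"
        by (simp add: \<gg> h algebra_simps)
      with w show ?thesis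
        unfolding rel by (auto simp: vec2_eq_iff)
    qed
    have sol: "act h (vec2 (\<alpha> * i) 0) - act \<gg> (vec2 (\<gamma> * i) 0) = vec2 (\<beta> * i) 0" for i
    proof -
      have "\<beta> * i + \<gamma> * i * a = \<alpha> * i * p \<and> \<gamma> * i * c = \<alpha> * i * s"
        unfolding rel by auto
      then show ?thesis
        by (auto simp: vec2_eq_iff \<gg> h algebra_simps)
    qed
    define Y where "Y = (if \<alpha> dvd k then {(vec2 (\<gamma> * (k div \<alpha>)) 0, sl2z_id),
      (- vec2 (\<gamma> * (k div \<alpha>)) 0, sl2z_neg sl2z_id)} else {})"
    have zero: "summand k sl2z_id y = 0" if "y \<notin> Y" for y
    proof (rule ccontr)
      assume nz: "summand k sl2z_id y \<noteq> 0"
      obtain w B where y: "y = (w, B)"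
        by fastforce
      have "B = sl2z_id \<or> B = sl2z_neg sl2z_id"
      proof (rule conjunct2[OF central[where C = sl2z_id and A = "left sl2z_id B"]])
        show "m21 B = 0" "m21 (left sl2z_id B) = 0"
          using supp nz unfolding y by blast+
      qed auto
      then show False
      proof
        assume B: "B = sl2z_id"
        then have "w = vec2 (w $ 1) 0 \<and> (\<exists>i. k = \<alpha> * i \<and> w $ 1 = \<gamma> * i)"
          using nz by (intro solve) (simp add: y summand_id)
        then have "y \<in> Y"
          using \<alpha> by (auto simp: Y_def y B)
        with that show False
          by simp
      next
        assume B: "B = sl2z_neg sl2z_id"
        have "coef T2 (- w, sl2z_id) * coef T1 (act h (vec2 k 0) - act \<gg> (- w), sl2z_id) \<noteq> 0"
          using nz coef_minus[OF signedD(1)[OF T2(1)], of w sl2z_id] by (simp add: y B summand_id)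
        from solve[OF this] have "y \<in> Y"
          using \<alpha> by (auto simp: Y_def y B vec2_eq_iff)
        with that show False
          by simp
      qed
    qed
    have "(summand k sl2z_id has_sum (\<Sum>y\<in>Y. summand k sl2z_id y)) UNIV"
      by (rule has_sum_finite_neutralI) (use zero in \<open>auto simp: Y_def\<close>)
    then have "coef W (vec2 k 0, sl2z_id) = (\<Sum>y\<in>Y. summand k sl2z_id y)"
      by (rule has_sum_unique[OF sum])
    also have "\<dots> = 2 * ?F k"
    proof (cases "\<alpha> dvd k")
      case True
      then obtain i where k: "k = \<alpha> * i"
        by blast
      have "(\<Sum>y\<in>Y. summand k sl2z_id y) = summand k sl2z_id (vec2 (\<gamma> * i) 0, sl2z_id)
          + summand k sl2z_id (- vec2 (\<gamma> * i) 0, sl2z_neg sl2z_id)"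
        using \<alpha> by (simp add: Y_def k)
      also have "\<dots> = 2 * (f (\<beta> * i) * g (\<gamma> * i))"
        using coef_minus[OF signedD(1)[OF T2(1)], of "vec2 (\<gamma> * i) 0" sl2z_id]
        by (simp only: summand_id) (simp add: k sol T1(3) T2(3))
      finally show ?thesis
        using \<alpha> by (simp add: k)
    qed (simp add: Y_def)
    finally show ?thesis .
  qed
  obtain R where R: "R \<in> signed"
    "\<And>v A. coef R (v, A) = (if v $ 2 = 0 \<and> m21 A = 0 then coef W (v, A) else 0)"
    using signed_line_part[OF W(1)] by blast
  obtain R' where R': "R' \<in> signed" "\<And>x. coef R' x = 1 / 2 * coef R x"
    using signed_scale[OF R(1), of "1 / 2"] by blast
  have "coef R' (v, A) = (if v $ 2 = 0 \<and> A = sl2z_id then ?F (v $ 1)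
     else if v $ 2 = 0 \<and> A = sl2z_neg sl2z_id then \<sigma> * ?F (v $ 1) else 0)" for v A
  proof (cases "v $ 2 = 0")
    case True
    then have v: "v = vec2 (v $ 1) 0"
      by (simp add: vec2_eq_iff)
    have id: "coef R' (v, sl2z_id) = ?F (v $ 1)"
      using W_id[of "v $ 1"] unfolding v[symmetric] by (simp add: R' R True)
    show ?thesis
    proof (cases "A = sl2z_id \<or> A = sl2z_neg sl2z_id")
      case True
      with \<open>v $ 2 = 0\<close> id show ?thesis
        by (elim disjE) (simp_all only: signedD(3)[OF R'(1)] simp_thms if_True if_False sl2z_neg_neq)
    next
      case False
      then have "coef R' (v, A) = 0"
        using W_zero[of A "v $ 1"] unfolding v[symmetric] by (simp add: R' R)
      with False show ?thesis
        by simp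
    qed
  qed (simp add: R' R)
  with R'(1) show ?thesis
    unfolding central_line_coefs_def by blast
qed

lemma line_coefs_dilate:
  assumes "f \<in> line_coefs" "g \<in> line_coefs" "c > 0"
  shows "(\<lambda>k. if c dvd k then f (k div c) * g (k div c) else 0) \<in> central_line_coefs"
proof -
  \<comment> \<open>The columns satisfy \<open>c (2, 2c + 1) = (1, 0) + (2c - 1, c(2c + 1))\<close>, the lower left entry
    \<open>c(2c + 1)\<close> is at least 3, and both columns are primitive for all \<open>c > 0\<close>.\<close>
  have "(\<lambda>k. if c dvd k then f (1 * (k div c)) * g (1 * (k div c)) else 0) \<in> central_line_coefs"
  proof (rule line_coefs_combination[OF assms(1,2), where a = "2 * c - 1" and c = "c * (2 * c + 1)"
        and p = 2 and s = "2 * c + 1"])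
    have "coprime (2 * c - 1) c"
    proof (rule coprimeI)
      fix d
      assume d: "d dvd 2 * c - 1" "d dvd c"
      from dvd_diff[OF dvd_mult[OF d(2), of 2] d(1)] show "is_unit d"
        by simp
    qed
    moreover have "coprime (2 * c - 1) (2 * c + 1)"
    proof (rule coprimeI)
      fix d
      assume d: "d dvd 2 * c - 1" "d dvd 2 * c + 1"
      from dvd_diff[OF d(2,1)] have "d dvd 2"
        by simp
      from dvd_diff[OF d(2) dvd_mult2[OF this, of c]] show "is_unit d"
        by simp
    qed
    ultimately show "coprime (2 * c - 1) (c * (2 * c + 1))"
      by simp
    show "coprime 2 (2 * c + 1)"
      by simp
    have "1 * 3 \<le> c * (2 * c + 1)"
      using assms(3) by (intro mult_mono) auto
    then show "3 \<le> c * (2 * c + 1)"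
      by simp
    show "2 * c + 1 \<noteq> 0" "c * (2 * c + 1) * 2 - (2 * c - 1) * (2 * c + 1) \<noteq> 0"
      using assms(3) by (auto simp: algebra_simps)
    fix k j j'
    have "j' * (c * (2 * c + 1)) = k * (2 * c + 1) \<longleftrightarrow> k = c * j'"
    proof -
      have "j' * (c * (2 * c + 1)) = (c * j') * (2 * c + 1)"
        by simp
      moreover have "2 * c + 1 \<noteq> 0"
        using assms(3) by simp
      ultimately show ?thesis
        by (metis mult_cancel_right)
    qed
    then show "j + j' * (2 * c - 1) = k * 2 \<and> j' * (c * (2 * c + 1)) = k * (2 * c + 1) \<longleftrightarrow>
        (\<exists>i. k = c * i \<and> j = 1 * i \<and> j' = 1 * i)"
      by (auto simp: algebra_simps)
  qed (use assms(3) in auto)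
  then show ?thesis
    by (simp only: mult_1)
qed

lemma line_coefs_slice:
  assumes "f \<in> line_coefs" "g \<in> line_coefs" "\<beta> > 0" "\<gamma> > 0" "coprime \<beta> \<gamma>"
  shows "(\<lambda>k. f (\<beta> * k) * g (\<gamma> * k)) \<in> central_line_coefs"
proof -
  define d where "d = \<beta> + \<gamma> + 1"
  have d: "d \<ge> 3"
    using assms(3,4) by (simp add: d_def)
  \<comment> \<open>The columns satisfy \<open>(\<beta> + \<gamma>, \<gamma> d) = \<beta> (1, 0) + \<gamma> (1, d)\<close>. The choice of \<open>d\<close> makes it coprime to
    \<open>\<beta> + \<gamma>\<close>, hence the left-hand side primitive, and at least 3.\<close>
  have "(\<lambda>k. if 1 dvd k then f (\<beta> * (k div 1)) * g (\<gamma> * (k div 1)) else 0) \<in> central_line_coefs"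
  proof (rule line_coefs_combination[OF assms(1,2), where a = 1 and c = d and p = "\<beta> + \<gamma>" and s = "\<gamma> * d"])
    have "coprime (\<beta> + \<gamma>) \<gamma>"
      using assms(5) by (simp add: coprime_iff_gcd_eq_1)
    moreover have "coprime (\<beta> + \<gamma>) d"
      unfolding d_def by simp
    ultimately show "coprime (\<beta> + \<gamma>) (\<gamma> * d)"
      by simp
    show "\<gamma> * d \<noteq> 0" "d * (\<beta> + \<gamma>) - 1 * (\<gamma> * d) \<noteq> 0"
      using d assms(3,4) by (auto simp: algebra_simps)
    fix k j j'
    have "j' * d = k * (\<gamma> * d) \<longleftrightarrow> j' = \<gamma> * k"
      using d by (auto simp: mult_ac)
    then show "j + j' * 1 = k * (\<beta> + \<gamma>) \<and> j' * d = k * (\<gamma> * d) \<longleftrightarrow>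
        (\<exists>i. k = 1 * i \<and> j = \<beta> * i \<and> j' = \<gamma> * i)"
      by (auto simp: algebra_simps)
  qed (use d in auto)
  then show ?thesis
    by simp
qed

lemma central_line_coefsE:
  assumes "f \<in> central_line_coefs"
  obtains T where "T \<in> signed" "\<And>v A. coef T (v, A) =
    (if v $ 2 = 0 \<and> A = sl2z_id then f (v $ 1)
     else if v $ 2 = 0 \<and> A = sl2z_neg sl2z_id then \<sigma> * f (v $ 1) else 0)"
  using assms unfolding central_line_coefs_def by blast

lemma central_line_coefsI:
  assumes "T \<in> signed" "\<And>v A. coef T (v, A) =
    (if v $ 2 = 0 \<and> A = sl2z_id then f (v $ 1)
     else if v $ 2 = 0 \<and> A = sl2z_neg sl2z_id then \<sigma> * f (v $ 1) else 0)"
  shows "f \<in> central_line_coefs"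
  using assms unfolding central_line_coefs_def by blast

lemma ind_in_central_line_coefs:
  assumes h: "\<And>m. h m \<in> central_line_coefs" and f: "f \<in> central_line_coefs"
    and le: "\<And>m k. cmod (h m k) \<le> cmod (f k)" and S: "finite S" "\<And>k. k \<in> S \<Longrightarrow> - k \<in> S"
    and lim: "\<And>k. (\<lambda>m. h m k) \<longlonglongrightarrow> ind S k"
  shows "ind S \<in> central_line_coefs"
proof -
  define t where "t f = (\<lambda>(v :: int^2, A). if v $ 2 = 0 \<and> A = sl2z_id then f (v $ 1)
     else if v $ 2 = 0 \<and> A = sl2z_neg sl2z_id then \<sigma> * f (v $ 1) else 0)" for f :: "int \<Rightarrow> complex"
  have "\<exists>T\<in>signed. \<forall>x. coef T x = t f x" if f: "f \<in> central_line_coefs" for f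
  proof -
    obtain T where "T \<in> signed" "\<And>v A. coef T (v, A) =
      (if v $ 2 = 0 \<and> A = sl2z_id then f (v $ 1)
       else if v $ 2 = 0 \<and> A = sl2z_neg sl2z_id then \<sigma> * f (v $ 1) else 0)"
      using central_line_coefsE[OF f] by blast
    then show ?thesis
      by (intro bexI[of _ T]) (simp_all add: t_def)
  qed
  then obtain T where T: "\<And>f. f \<in> central_line_coefs \<Longrightarrow> T f \<in> signed"
    "\<And>f x. f \<in> central_line_coefs \<Longrightarrow> coef (T f) x = t f x"
    by metis
  let ?F = "(\<lambda>(k, A). (vec2 k 0, A)) ` (S \<times> {sl2z_id, sl2z_neg sl2z_id})"
  have fin: "finite ?F"
    using S by auto
  obtain R where R: "R \<in> LG" "\<And>x. coef R x = (\<Sum>y\<in>?F. t (ind S) y * (if x = y then 1 else 0))"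
    using G.vna_sum_coefficients[OF G.von_neumann_algebra_right_commutant fin, of "t (ind S)" "\<lambda>y x. if x = y then 1 else 0"]
      G.unitary_in_right_commutant G.coeff_unitary by blast
  have out: "t (ind S) x = 0" if "x \<notin> ?F" for x
    using that by (cases x) (force simp: t_def ind_eq_if vec2_eq_iff image_iff split: if_splits)
  have R': "coef R x = t (ind S) x" for x
    using fin out[of x] unfolding R(2) by (auto simp: if_distrib cong: if_cong)
  have "R \<in> P"
  proof (rule G.vna_closed_coefficientwise[OF P P_subset_LG R(1), where T = "\<lambda>m. T (h m)" and \<F> = sequentially])
    let ?C = "norm (blinfun_apply (T f) (delta_ell2 \<one>\<^bsub>Z2_SL2Z\<^esub>))"
    have "cmod (coef (T (h m)) x) \<le> cmod (coef (T f) x)" for m x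
      using le by (cases x) (simp add: T(2)[OF h] T(2)[OF f] t_def norm_mult mult_left_mono)
    then have "(\<Sum>x\<in>F. (cmod (coef (T (h m)) x))\<^sup>2) \<le> ?C\<^sup>2" if "finite F" for F m
      using that by (intro order_trans[OF sum_mono G.coeff_finite_sum_le]) (auto intro: power_mono)
    then show "\<forall>\<^sub>F m in sequentially. \<forall>F. finite F \<longrightarrow> (\<Sum>x\<in>F. (cmod (coef (T (h m)) x))\<^sup>2) \<le> ?C\<^sup>2"
      by simp
    show "(\<lambda>m. coef (T (h m)) x) \<longlonglongrightarrow> coef R x" for x
      using lim by (cases x) (auto simp: T(2)[OF h] R' t_def intro: tendsto_mult_left)
  qed (use T(1)[OF h] in \<open>auto simp: signed_def\<close>)
  then have "R \<in> signed"
    by (auto simp: signed_def R' t_def)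
  then show ?thesis
    by (rule central_line_coefsI) (simp add: R' t_def)
qed

lemma line_coefficients_central: "line_coefficients central_line_coefs"
proof
  fix f g :: "int \<Rightarrow> complex"
  assume f: "f \<in> central_line_coefs"
  note sub = subsetD[OF central_subset_line_coefs]
  obtain T where T: "T \<in> signed" "\<And>v A. coef T (v, A) =
    (if v $ 2 = 0 \<and> A = sl2z_id then f (v $ 1)
     else if v $ 2 = 0 \<and> A = sl2z_neg sl2z_id then \<sigma> * f (v $ 1) else 0)"
    using central_line_coefsE[OF f] by blast
  show "f (- k) = f k" for k
    using coef_minus[OF signedD(1)[OF T(1)], of "vec2 k 0" sl2z_id] by (simp add: T(2))
  show "(\<lambda>k. z * f k) \<in> central_line_coefs" for z
  proof -
    obtain T' where "T' \<in> signed" "\<And>x. coef T' x = z * coef T x"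
      using signed_scale[OF T(1)] by blast
    then show ?thesis
      by (intro central_line_coefsI[of T']) (auto simp: T(2))
  qed
  show "(\<lambda>k. (cmod (f k))\<^sup>2) summable_on UNIV"
  proof -
    have "(\<lambda>x. (cmod (coef T x))\<^sup>2) summable_on range (\<lambda>k. (vec2 k 0, sl2z_id))"
      unfolding fourier_coeff_def by (rule summable_on_subset_banach[OF ell2_summable]) simp
    moreover have "inj (\<lambda>k. (vec2 k 0, sl2z_id))"
      by (auto simp: inj_on_def vec2_eq_iff)
    ultimately show ?thesis
      by (subst (asm) summable_on_reindex) (auto simp: o_def T(2))
  qed
  assume g: "g \<in> central_line_coefs"
  obtain T' where T': "T' \<in> signed" "\<And>v A. coef T' (v, A) =
    (if v $ 2 = 0 \<and> A = sl2z_id then g (v $ 1)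
     else if v $ 2 = 0 \<and> A = sl2z_neg sl2z_id then \<sigma> * g (v $ 1) else 0)"
    using central_line_coefsE[OF g] by blast
  show "(\<lambda>k. f k + g k) \<in> central_line_coefs"
    by (rule central_line_coefsI[OF signed_add[OF T(1) T'(1)]]) (simp add: T(2) T'(2) algebra_simps)
  show "(\<lambda>k. if c dvd k then f (k div c) * g (k div c) else 0) \<in> central_line_coefs" if "c > 0" for c
    using line_coefs_dilate[OF sub[OF f] sub[OF g] that] .
  show "(\<lambda>k. f (\<beta> * k) * g (\<gamma> * k)) \<in> central_line_coefs" if "\<beta> > 0" "\<gamma> > 0" "coprime \<beta> \<gamma>" for \<beta> \<gamma>
    using line_coefs_slice[OF sub[OF f] sub[OF g] that] .
next
  obtain S where S: "S \<in> P" "\<And>f. blinfun_apply S f = scaleC_ell2 \<sigma> f"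
    by (rule vna_scalar[OF P, of \<sigma>], rule that)
  let ?T = "U (0, sl2z_id) + (S o\<^sub>L U (0, sl2z_neg sl2z_id))"
  have coef: "coef ?T (v, A) = (if v $ 2 = 0 \<and> A = sl2z_id then ind {0} (v $ 1)
     else if v $ 2 = 0 \<and> A = sl2z_neg sl2z_id then \<sigma> * ind {0} (v $ 1) else 0)" for v A
    by (auto simp: G.coeff_scalar[OF S(2)] G.coeff_unitary ind_eq_if vec2_eq_iff)
  have "?T \<in> signed"
    unfolding signed_def
  proof (intro CollectI conjI allI)
    show "?T \<in> P"
      by (intro vna_add[OF P] vna_comp[OF P] U_in_P S)
    show "coef ?T (v, sl2z_neg A) = \<sigma> * coef ?T (v, A)" for v A
      unfolding coef by auto
  qed
  then show "ind {0} \<in> central_line_coefs"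
    by (rule central_line_coefsI) (rule coef)
qed (rule ind_in_central_line_coefs)

text \<open>
  The coefficients \<open>f\<close> of \<open>T\<close> and those of its adjoint, which are \<open>cnj f\<close> by evenness, have the product
  \<open>\<bar>f\<bar>\<^sup>2\<close>, which is nonnegative as required for extracting level sets.
\<close>

lemma ind_pair_of_coef:
  assumes T: "T \<in> signed" and nz: "coef T (vec2 k 0, sl2z_id) \<noteq> 0"
  shows "ind {k, - k} \<in> central_line_coefs"
proof -
  interpret line_coefficients central_line_coefs
    by (rule line_coefficients_central)
  define f where "f k = coef T (vec2 k 0, sl2z_id)" for k
  obtain S where S: "S \<in> signed" "\<And>x. coef S x = cnj (coef T (inv\<^bsub>Z2_SL2Z\<^esub> x))"
    using signed_adjoint[OF T] by blast
  have f: "f \<in> line_coefs"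
    unfolding line_coefs_def f_def[abs_def] using T by blast
  have "(\<lambda>k. coef S (vec2 k 0, sl2z_id)) \<in> line_coefs"
    unfolding line_coefs_def using S(1) by blast
  also have "(\<lambda>k. coef S (vec2 k 0, sl2z_id)) = (\<lambda>k. cnj (f k))"
    by (simp add: S(2) coef_minus[OF signedD(1)[OF T]] f_def)
  finally have "(\<lambda>k. f k * cnj (f k)) \<in> central_line_coefs"
    using line_coefs_dilate[OF f, of "\<lambda>k. cnj (f k)" 1] by simp
  then show ?thesis
    by (rule ind_pair[where r = "\<lambda>k. (cmod (f k))\<^sup>2"])
      (use nz in \<open>simp_all only: complex_norm_square f_def, simp_all\<close>)
qed

text \<open>
  Multiply the elements belonging to the two pairs. All terms of the convolution are nonnegative since
  \<open>\<sigma>\<^sup>2 = 1\<close>, and the term for \<open>k\<close> and \<open>l\<close> is 1, so no cancellation occurs at \<open>k + l\<close>.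
\<close>

lemma coef_comp_pairs:
  assumes "ind {k, - k} \<in> central_line_coefs" "ind {l, - l} \<in> central_line_coefs"
  obtains T where "T \<in> signed" "coef T (vec2 (k + l) 0, sl2z_id) \<noteq> 0"
proof -
  obtain T1 where T1: "T1 \<in> signed" "\<And>v A. coef T1 (v, A) =
    (if v $ 2 = 0 \<and> A = sl2z_id then ind {k, - k} (v $ 1)
     else if v $ 2 = 0 \<and> A = sl2z_neg sl2z_id then \<sigma> * ind {k, - k} (v $ 1) else 0)"
    using central_line_coefsE[OF assms(1)] by blast
  obtain T2 where T2: "T2 \<in> signed" "\<And>v A. coef T2 (v, A) =
    (if v $ 2 = 0 \<and> A = sl2z_id then ind {l, - l} (v $ 1)
     else if v $ 2 = 0 \<and> A = sl2z_neg sl2z_id then \<sigma> * ind {l, - l} (v $ 1) else 0)"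
    using central_line_coefsE[OF assms(2)] by blast
  define summand where "summand y = coef T2 y *
    coef T1 ((vec2 (k + l) 0, sl2z_id) \<otimes>\<^bsub>Z2_SL2Z\<^esub> inv\<^bsub>Z2_SL2Z\<^esub> y)" for y
  have sum: "(summand has_sum coef (T1 o\<^sub>L T2) (vec2 (k + l) 0, sl2z_id)) UNIV"
    unfolding summand_def by (rule G.coeff_comp[OF signedD(2)[OF T1(1)] signedD(2)[OF T2(1)]])
  have "0 \<le> Re (summand y)" for y
  proof (cases y)
    case (Pair w B)
    have "sl2z_inv B = sl2z_id \<longleftrightarrow> B = sl2z_id" "sl2z_inv B = sl2z_neg sl2z_id \<longleftrightarrow> B = sl2z_neg sl2z_id"
      by (metis sl2z_mult_inv(3) sl2z_mult_id(3), metis sl2z_mult_inv(3) sl2z_mult_id(3) sl2z_mult_neg(4))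
    moreover have "Im \<sigma> * Im \<sigma> \<le> Re \<sigma> * Re \<sigma>"
      using sign by auto
    ultimately show ?thesis
      unfolding summand_def Pair by (auto simp: T1 T2 ind_eq_if)
  qed
  note nonneg = this
  have "summand (vec2 l 0, sl2z_id) = 1"
    by (simp add: summand_def T1 T2 ind_eq_if)
  then have "((\<lambda>y. Re (summand y)) has_sum 1) {(vec2 l 0, sl2z_id)}"
    by (intro has_sum_finiteI) auto
  then have "1 \<le> Re (coef (T1 o\<^sub>L T2) (vec2 (k + l) 0, sl2z_id))"
    by (rule has_sum_mono_neutral[OF _ has_sum_Re[OF sum]]) (use nonneg in auto)
  then show thesis
    by (intro that[OF signed_comp[OF T1(1) T2(1)]]) auto
qed

subsection \<open>Classification\<close>

text \<open>
  By \<open>ind_pair_of_coef\<close> and \<open>coef_comp_pairs\<close> the \<open>k\<close> for which a coefficient at \<open>((k, 0), id)\<close> can be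
  nonzero form a subgroup of \<open>\<int>\<close>, say the multiples of \<open>n\<close>. Translations by \<open>SL\<^sub>2(\<int>)\<close> move every point
  to such a position, which confines the support to \<open>n\<int>\<^sup>2\<close>. Conversely, averaging \<open>u\<^sub>v u\<^sub>A\<close> over the
  symmetries \<open>v \<mapsto> \<plusminus>v\<close>, \<open>A \<mapsto> \<plusminus>A\<close> gives a multiple of a translate of the element belonging to a pair,
  so truncation applies.
\<close>

lemma signed_classification:
  obtains n where "\<And>T. T \<in> signed \<longleftrightarrow>
    T \<in> even_lattice_algebra n \<and> (\<forall>v A. coef T (v, sl2z_neg A) = \<sigma> * coef T (v, A))"
proof -
  interpret line_coefficients central_line_coefs
    by (rule line_coefficients_central)
  define J where "J = {k. ind {k, - k} \<in> central_line_coefs}"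
  obtain n where n: "\<And>k. k \<in> J \<longleftrightarrow> n dvd k"
  proof (rule int_subgroup_multiples[of J])
    show "0 \<in> J"
      using ind_zero by (simp add: J_def)
    show "a + b \<in> J" if "a \<in> J" "b \<in> J" for a b
      using coef_comp_pairs[of a b] ind_pair_of_coef that unfolding J_def by blast
    show "- a \<in> J" if "a \<in> J" for a
      using that by (simp add: J_def insert_commute)
  qed (rule that)
  show thesis
  proof (rule that[of n], rule iffI)
    fix T
    assume T: "T \<in> signed"
    have "\<exists>w. v = n *s w" if nz: "coef T (v, A) \<noteq> 0" for v A
    proof -
      obtain h k where v: "v = act h (vec2 k 0)"
        by (rule exists_act_first_axis)
      obtain T' where T': "T' \<in> signed"
        "\<And>v C. coef T' (v, C) = coef T (act h v, sl2z_mult h (sl2z_mult C (sl2z_mult (sl2z_inv h) A)))"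
        using signed_translate[OF T] by blast
      have "coef T' (vec2 k 0, sl2z_id) \<noteq> 0"
        using nz by (simp add: T'(2) v)
      then have "n dvd k"
        using ind_pair_of_coef[OF T'(1)] n by (simp add: J_def)
      then obtain i where "k = n * i"
        by blast
      then have "v = n *s act h (vec2 i 0)"
        by (simp add: v vec2_eq_iff algebra_simps)
      then show ?thesis
        by blast
    qed
    then show "T \<in> even_lattice_algebra n \<and> (\<forall>v A. coef T (v, sl2z_neg A) = \<sigma> * coef T (v, A))"
      using signedD[OF T] coef_minus by (auto simp: even_lattice_algebra_def)
  next
    fix T
    assume "T \<in> even_lattice_algebra n \<and> (\<forall>v A. coef T (v, sl2z_neg A) = \<sigma> * coef T (v, A))"
    then have T: "T \<in> LG" "\<And>v A. coef T (- v, A) = coef T (v, A)"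
      "\<And>v A. coef T (v, A) \<noteq> 0 \<Longrightarrow> \<exists>w. v = n *s w"
      "\<And>v A. coef T (v, sl2z_neg A) = \<sigma> * coef T (v, A)"
      by (auto simp: even_lattice_algebra_def)
    define \<pi> where "\<pi> = (\<lambda>(s, s') (v :: int^2, A). (if s then v else - v, if s' then A else sl2z_neg A))"
    define c where "c = (\<lambda>(s :: bool, s'). (if s' then 1 else \<sigma>) / 4)"
    have "T \<in> P"
    proof (rule G.in_vna_by_truncation[OF P P_subset_LG T(1), where S = UNIV and \<pi> = \<pi> and c = c])
      show "c s * coef T (\<pi> s x) = coef T x / of_nat (card (UNIV :: (bool \<times> bool) set))" for s x
        by (cases x; cases s) (auto simp: c_def \<pi>_def T(2,4) card_UNIV_bool card_cartesian_product UNIV_Times_UNIV[symmetric] simp del: UNIV_Times_UNIV)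
      fix y
      assume nz: "coef T y \<noteq> 0"
      obtain v A where y: "y = (v, A)"
        by fastforce
      obtain h k where v: "v = act h (vec2 k 0)"
        by (rule exists_act_first_axis)
      obtain w where w: "v = n *s w"
        using T(3) nz y by blast
      have "vec2 k 0 = n *s act (sl2z_inv h) w"
        using arg_cong[OF w, of "act (sl2z_inv h)"] v by (simp add: vec2_eq_iff algebra_simps)
      then have "n dvd k"
        by (simp add: vec2_eq_iff)
      then have "ind {k, - k} \<in> central_line_coefs"
        using n by (simp add: J_def)
      \<comment> \<open>For \<open>k = 0\<close> the points \<open>k\<close> and \<open>-k\<close> coincide and their contributions to the average add up.\<close>
      then have "(\<lambda>j. (if k = 0 then 2 else 1) / 4 * ind {k, - k} j) \<in> central_line_coefs"
        by (rule scale)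
      then obtain R where R: "R \<in> signed" "\<And>v A. coef R (v, A) =
        (if v $ 2 = 0 \<and> A = sl2z_id then (if k = 0 then 2 else 1) / 4 * ind {k, - k} (v $ 1)
         else if v $ 2 = 0 \<and> A = sl2z_neg sl2z_id then \<sigma> * ((if k = 0 then 2 else 1) / 4 * ind {k, - k} (v $ 1)) else 0)"
        by (rule central_line_coefsE) (rule that)
      obtain E where E: "E \<in> signed" "\<And>v C. coef E (v, C) =
          coef R (act (sl2z_inv h) v, sl2z_mult (sl2z_inv h) (sl2z_mult C (sl2z_mult (sl2z_inv A) h)))"
        using signed_translate[OF R(1)] by blast
      have "coef E x = (\<Sum>s\<in>UNIV. if \<pi> s x = y then c s else 0)" for x
      proof -
        obtain w C where x: "x = (w, C)"
          by fastforce
        define w' where "w' = act (sl2z_inv h) w"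
        have w: "w = act h w'"
          by (simp add: w'_def)
        have act_eq: "act h a = act h b \<longleftrightarrow> a = b" for a b
          by (metis act_inv(2))
        have mult_eq: "sl2z_mult (sl2z_inv h) (sl2z_mult C (sl2z_mult (sl2z_inv A) h)) = sl2z_id \<longleftrightarrow> C = A"
          "sl2z_mult (sl2z_inv h) (sl2z_mult C (sl2z_mult (sl2z_inv A) h)) = sl2z_neg sl2z_id \<longleftrightarrow> sl2z_neg C = A"
        proof -
          let ?X = "sl2z_mult (sl2z_inv h) (sl2z_mult C (sl2z_mult (sl2z_inv A) h))"
          have "C = sl2z_mult h (sl2z_mult ?X (sl2z_mult (sl2z_inv h) A))"
            by (simp add: sl2z_mult_assoc)
          then have "?X = sl2z_id \<Longrightarrow> C = A" "?X = sl2z_neg sl2z_id \<Longrightarrow> sl2z_neg C = A"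
            by (metis sl2z_mult_id(1) sl2z_mult_inv_cancel(1), metis sl2z_mult_id(1) sl2z_mult_inv_cancel(1) sl2z_mult_neg(1,2,3))
          moreover have "C = A \<Longrightarrow> ?X = sl2z_id" "sl2z_neg C = A \<Longrightarrow> ?X = sl2z_neg sl2z_id"
            by (auto simp: sl2z_mult_assoc)
          ultimately show "?X = sl2z_id \<longleftrightarrow> C = A" "?X = sl2z_neg sl2z_id \<longleftrightarrow> sl2z_neg C = A"
            by blast+
        qed
        have "w = v \<longleftrightarrow> w' = vec2 k 0"
          by (simp only: w v act_eq)
        moreover have "- w = v \<longleftrightarrow> - w' = vec2 k 0"
          by (simp only: w v act_eq flip: act_simps(4))
        ultimately have vec_eq: "w = v \<longleftrightarrow> w' $ 2 = 0 \<and> w' $ 1 = k"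
          "- w = v \<longleftrightarrow> w' $ 2 = 0 \<and> w' $ 1 = - k"
          by (auto simp: vec2_eq_iff)
        have "(\<Sum>s\<in>UNIV. if \<pi> s x = y then c s else 0) =
            (\<Sum>s\<in>UNIV. \<Sum>s'\<in>UNIV. if \<pi> (s, s') x = y then c (s, s') else 0)"
          by (simp add: sum.cartesian_product flip: UNIV_Times_UNIV)
        also have "\<dots> = (if w = v \<and> C = A then 1 / 4 else 0) + (if - w = v \<and> C = A then 1 / 4 else 0) +
            ((if w = v \<and> sl2z_neg C = A then \<sigma> / 4 else 0) + (if - w = v \<and> sl2z_neg C = A then \<sigma> / 4 else 0))"
          by (simp add: UNIV_bool x y \<pi>_def c_def)
        also have "\<dots> = coef E x"
          unfolding x E(2) w'_def[symmetric] R(2) mult_eq vec_eq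
          by (cases "w' $ 2 = 0"; cases "C = A"; cases "k = 0") (auto simp: ind_eq_if)
        finally show ?thesis ..
      qed
      with signedD(1)[OF E(1)] show "\<exists>E\<in>P. \<forall>x. coef E x = (\<Sum>s\<in>UNIV. if \<pi> s x = y then c s else 0)"
        by blast
    qed auto
    with T show "T \<in> signed"
      by (simp add: signed_def)
  qed
qed

end

section \<open>The decomposition\<close>

lemma unitary_one: "U (0, sl2z_id) = id_blinfun"
  by (rule blinfun_eqI, rule ell2_eqI) (simp add: G.unitary_apply flip: G_one)

lemma coef_q_comp:
  "coef (q_proj o\<^sub>L T) (v, A) = (coef T (v, A) + coef T (- v, sl2z_neg A)) / 2"
proof -
  have "coef (q_proj o\<^sub>L T) (v, A) =
      1 / 2 * (coef T (v, A) + coef (U (0, sl2z_neg sl2z_id) o\<^sub>L T) (v, A))"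
    by (simp add: q_proj_def fourier_coeff_def unitary_one scaleR_blinfun.rep_eq blinfun.add_left ell2_coord)
  then show ?thesis
    by simp
qed

lemma q_in_vna:
  assumes P: "von_neumann_algebra P" and U: "\<And>A. U (0, A) \<in> P"
  shows "q_proj \<in> P" "id_blinfun - q_proj \<in> P"
proof -
  obtain S where S: "S \<in> P" "\<And>f. blinfun_apply S f = scaleC_ell2 (1 / 2) f"
    by (rule vna_scalar[OF P, of "1 / 2"], rule that)
  obtain S' where S': "S' \<in> P" "\<And>f. blinfun_apply S' f = scaleC_ell2 (- 1) f"
    by (rule vna_scalar[OF P, of "- 1"], rule that)
  have "q_proj = S o\<^sub>L (U (0, sl2z_id) + U (0, sl2z_neg sl2z_id))"
    by (rule blinfun_eqI) (simp add: q_proj_def S(2) scaleR_blinfun.rep_eq scaleR_conv_scaleC)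
  also have "\<dots> \<in> P"
    by (intro vna_comp[OF P] vna_add[OF P] S(1) U)
  finally show q: "q_proj \<in> P" .
  have "id_blinfun - q_proj = U (0, sl2z_id) + (S' o\<^sub>L q_proj)"
    by (rule blinfun_eqI, rule ell2_eqI)
      (simp add: unitary_one S'(2) blinfun.diff_left blinfun.add_left ell2_coord)
  also have "\<dots> \<in> P"
    by (intro vna_comp[OF P] vna_add[OF P] S'(1) U q)
  finally show "id_blinfun - q_proj \<in> P" .
qed

theorem theorem4p1:
  fixes P :: "(((int^2) \<times> sl2z) ell2 \<Rightarrow>\<^sub>L ((int^2) \<times> sl2z) ell2) set"
  assumes "von_neumann_algebra P"
    and "L_SL2Z \<subseteq> P"
    and "P \<subseteq> crossed_SL2Z B_alg"
  shows "\<exists>n m :: int.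
    is_direct_sum P
      ((\<lambda>T. q_proj o\<^sub>L T) ` crossed_SL2Z (B_alg \<inter> L_nZ2 n))
      ((\<lambda>T. (id_blinfun - q_proj) o\<^sub>L T) ` crossed_SL2Z (B_alg \<inter> L_nZ2 m))"
proof -
  have P_even: "P \<subseteq> even_lattice_algebra 1"
    using assms(3) crossed_B_alg_subset by blast
  have U_in_P: "U (0, A) \<in> P" for A
    using assms(2) U_in_L_SL2Z by blast
  interpret plus: intermediate_algebra P 1
    using assms(1) P_even U_in_P by unfold_locales auto
  interpret minus: intermediate_algebra P "- 1"
    using assms(1) P_even U_in_P by unfold_locales auto
  obtain n where n: "\<And>T. T \<in> plus.signed \<longleftrightarrow>
      T \<in> even_lattice_algebra n \<and> (\<forall>v A. coef T (v, sl2z_neg A) = 1 * coef T (v, A))"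
    using plus.signed_classification by blast
  obtain m where m: "\<And>T. T \<in> minus.signed \<longleftrightarrow>
      T \<in> even_lattice_algebra m \<and> (\<forall>v A. coef T (v, sl2z_neg A) = - 1 * coef T (v, A))"
    using minus.signed_classification by blast
  let ?q = "q_proj" and ?q' = "id_blinfun - q_proj"
  have q'_comp: "?q' o\<^sub>L T = T - (?q o\<^sub>L T)" for T
    by (rule blinfun_eqI) (simp add: blinfun.diff_left)
  have coef_diff: "coef (S - T) x = coef S x - coef T x" for S T x
    by (simp add: fourier_coeff_def blinfun.diff_left ell2_coord)
  have coefs: "coef (?q o\<^sub>L T) (v, A) = (coef T (v, A) + coef T (v, sl2z_neg A)) / 2"
    "coef (?q' o\<^sub>L T) (v, A) = (coef T (v, A) - coef T (v, sl2z_neg A)) / 2"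
    if "T \<in> even_lattice_algebra k" for T v A k
    using that by (auto simp: coef_q_comp q'_comp coef_diff even_lattice_algebra_def field_simps)
  have closed: "?q o\<^sub>L T \<in> M" "?q' o\<^sub>L T \<in> M"
    if "T \<in> M" "von_neumann_algebra M" "\<And>A. U (0, A) \<in> M" for M T
    using q_in_vna[OF that(2,3)] vna_comp[OF that(2)] that(1) by auto
  note closed' = closed[OF _ von_neumann_algebra_even_lattice_algebra U_in_even_lattice_algebra]
  have LG: "T \<in> LG" if "T \<in> even_lattice_algebra k" for T k
    using that by (simp add: even_lattice_algebra_def)
  \<comment> \<open>Multiplication by \<open>q\<close> symmetrizes coefficients under \<open>A \<mapsto> -A\<close>, and multiplication by \<open>1 - q\<close>
    antisymmetrizes them; so the two summands are exactly the two sign components.\<close>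
  have X: "(\<lambda>T. ?q o\<^sub>L T) ` even_lattice_algebra n = plus.signed"
  proof
    show "(\<lambda>T. ?q o\<^sub>L T) ` even_lattice_algebra n \<subseteq> plus.signed"
      using closed'(1) by (auto simp: n coefs(1))
    show "plus.signed \<subseteq> (\<lambda>T. ?q o\<^sub>L T) ` even_lattice_algebra n"
    proof
      fix T
      assume "T \<in> plus.signed"
      then have T: "T \<in> even_lattice_algebra n" "\<And>v A. coef T (v, sl2z_neg A) = coef T (v, A)"
        by (auto simp: n)
      have "T = ?q o\<^sub>L T"
        using LG[OF T(1)] LG[OF closed'(1)[OF T(1)]]
        by (rule G.coeff_eqI) (auto simp: coefs(1)[OF T(1)] T(2))
      with T(1) show "T \<in> (\<lambda>T. ?q o\<^sub>L T) ` even_lattice_algebra n"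
        by blast
    qed
  qed
  have Y: "(\<lambda>T. ?q' o\<^sub>L T) ` even_lattice_algebra m = minus.signed"
  proof
    show "(\<lambda>T. ?q' o\<^sub>L T) ` even_lattice_algebra m \<subseteq> minus.signed"
      using closed'(2) by (auto simp: m coefs(2) field_simps)
    show "minus.signed \<subseteq> (\<lambda>T. ?q' o\<^sub>L T) ` even_lattice_algebra m"
    proof
      fix T
      assume "T \<in> minus.signed"
      then have T: "T \<in> even_lattice_algebra m" "\<And>v A. coef T (v, sl2z_neg A) = - coef T (v, A)"
        by (auto simp: m)
      have "T = ?q' o\<^sub>L T"
        using LG[OF T(1)] LG[OF closed'(2)[OF T(1)]]
        by (rule G.coeff_eqI) (auto simp: coefs(2)[OF T(1)] T(2))
      with T(1) show "T \<in> (\<lambda>T. ?q' o\<^sub>L T) ` even_lattice_algebra m"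
        by blast
    qed
  qed
  have "is_direct_sum P plus.signed minus.signed"
    unfolding is_direct_sum_def
  proof
    show "P = {x + y | x y. x \<in> plus.signed \<and> y \<in> minus.signed}"
    proof
      show "P \<subseteq> {x + y | x y. x \<in> plus.signed \<and> y \<in> minus.signed}"
      proof
        fix T
        assume T: "T \<in> P"
        then have T': "T \<in> even_lattice_algebra 1"
          using P_even by blast
        have "?q o\<^sub>L T \<in> plus.signed" "?q' o\<^sub>L T \<in> minus.signed"
          unfolding plus.signed_def minus.signed_def
          using closed[OF T assms(1) U_in_P] by (auto simp: coefs[OF T'] field_simps)
        moreover have "T = (?q o\<^sub>L T) + (?q' o\<^sub>L T)"
          by (simp add: q'_comp)
        ultimately show "T \<in> {x + y | x y. x \<in> plus.signed \<and> y \<in> minus.signed}"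
          by blast
      qed
    qed (auto simp: plus.signed_def minus.signed_def intro: vna_add[OF assms(1)])
    have "T = 0" if "T \<in> plus.signed" "T \<in> minus.signed" for T
    proof (rule bounded_op_eqI)
      have "coef T (v, A) = 0" for v A
        using plus.signedD(3)[OF that(1), of v A] minus.signedD(3)[OF that(2), of v A] by simp
      then show "ell2_apply (blinfun_apply T (delta_ell2 y)) x = ell2_apply (blinfun_apply 0 (delta_ell2 y)) x" for x y
        using G.apply_delta_eq_coeff[OF plus.signedD(2)[OF that(1)], of y x]
        by (metis ell2_coord(4) surj_pair zero_blinfun.rep_eq)
    qed (use that vna_bounded[OF assms(1)] in \<open>auto simp: plus.signed_def bounded_ops_def intro!: ell2_eqI simp: ell2_coord\<close>)
    moreover have "0 \<in> plus.signed" "0 \<in> minus.signed"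
    proof -
      obtain S where S: "S \<in> P" "\<And>f. blinfun_apply S f = scaleC_ell2 0 f"
        by (rule vna_scalar[OF assms(1), of 0], rule that)
      then have "S = 0"
        by (intro blinfun_eqI ell2_eqI) (simp add: ell2_coord)
      with S(1) show "0 \<in> plus.signed" "0 \<in> minus.signed"
        by (auto simp: plus.signed_def minus.signed_def fourier_coeff_def ell2_coord)
    qed
    ultimately show "plus.signed \<inter> minus.signed = {0}"
      by blast
  qed
  then show ?thesis
    unfolding crossed_eq_even_lattice_algebra X[symmetric] Y[symmetric] by blast
qed

end
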